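(* Let $k,n\in\mathbb{N}$ and let $\pi^i:(X_i,T_i)\to(Y_i,T_i)$, $1\le i\le k$, be factor maps of minimal t.d.s. For each $i$ let the complete canonical PI tower of order $n$ of $\pi^i$ be given, consisting of systems $(X_i)_m,(Y_i)_m$ ($0\le m\le n$) and $(Z_i)_m$ ($1\le m\le n$), with RIC maps $\pi^i_m:(X_i)_m\to(Y_i)_m$. Let $T=T_1\times\cdots\times T_k$. Then $(\prod_{i=1}^k (Y_i)_n,T)$ is an $n$-step topological characteristic factor of $(\prod_{i=1}^k (X_i)_n,T)$ (with respect to the factor map $\pi^1_n\times\cdots\times\pi^k_n$). If in addition $(\prod_{i=1}^k (X_i)_n,T)$ is transitive, then $(\prod_{i=1}^k (Y_i)_n,T)$ is an $(n+1)$-step topological characteristic factor of $(\prod_{i=1}^k (X_i)_n,T)$.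
   Context: A t.d.s. $(X,T)$ is a compact metric space $X$ with a homeomorphism $T$; a factor map is a continuous equivariant surjection (the same letter denotes the transformation on the factor). Minimal: every orbit is dense. Transitive: for all non-empty open $U,V$ there is $n\in\mathbb{Z}$ with $U\cap T^{-n}V\ne\emptyset$. Characteristic factor: let $\pi:(X,T)\to(Y,T)$ be a factor map of t.d.s. and $d\in\mathbb{N}$. Put $\tau_d=T\times T^2\times\cdots\times T^d$ on $X^d$, $x^{(d)}=(x,\dots,x)\in X^d$. $(Y,T)$ is a $d$-step topological characteristic factor of $(X,T)$ if there is a dense $G_\delta$ set $X_0\subseteq X$ such that for every $x\in X_0$ the orbit closure $L_x=\overline{\{\tau_d^n x^{(d)}:n\in\mathbb{Z}\}}$ is $\pi\times\cdots\times\pi$ ($d$ times) saturated, i.e. if $(x_1,\dots,x_d)\in L_x$ and $\pi(x_i)=\pi(x_i')$ for all $i$ then $(x_1',\dots,x_d')\in L_x$. Relations and extensions for a factor map $\pi:X\to Y$ of minimal systems: $R_\pi=\{(x,x'):\pi(x)=\pi(x')\}$, $R_\pi^n=\{(x_1,\dots,x_n):\pi(x_1)=\cdots=\pi(x_n)\}$. $\pi$ is proximal if $\inf_n\rho(T^nx,T^nx')=0$ for all $(x,x')\in R_\pi$. $\pi$ is equicontinuous if for every $\epsilon>0$ there is $\delta>0$ such that $(x,x')\in R_\pi$, $\rho(x,x')<\delta$ imply $\rho(T^nx,T^nx')<\epsilon$ for all $n\in\mathbb{Z}$. $\pi$ is RIC if, for a minimal left ideal $M$ of $\beta\mathbb{Z}$,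 an idempotent $u\in M$ and $y_0\in Y$ with $uy_0=y_0$, one has $\pi^{-1}(py_0)=p\circ u\pi^{-1}(y_0)$ for all $p\in M$, where $p\circ A=\lim_\lambda T^{m_\lambda}A$ in the Hausdorff topology on closed subsets for a net $m_\lambda\to p$ in $\beta\mathbb{Z}$; equivalently, $\pi$ is open and for every $n\ge1$ the minimal points are dense in $R_\pi^n$. $Q_\pi(X,T)$ is the set of $(x,y)$ for which there are $(x_i,y_i)\in R_\pi$, $n_i\in\mathbb{Z}$, $z\in X$ with $(x_i,y_i)\to(x,y)$ and $(T^{n_i}x_i,T^{n_i}y_i)\to(z,z)$; if $\pi$ is RIC it is a closed invariant equivalence relation and $X/Q_\pi(X,T)$ is the largest equicontinuous extension of $Y$ within $X$. The canonical tower of order $n$ of a factor map $\pi:X\to Y$ of minimal systems is a commutative diagram of minimal systems $X_0,\dots,X_n$, $Y_0,\dots,Y_n$, $Z_1,\dots,Z_n$ and factor maps $\pi_m:X_m\to Y_m$, $\tilde\theta_0:X_0\to X$, $\theta_0:Y_0\to Y$, and for $0\le m<n$: $\sigma_{m+1}:X_m\to Z_{m+1}$, $\rho_{m+1}:Z_{m+1}\to Y_m$, $\theta_{m+1}:Y_{m+1}\to Z_{m+1}$, $\tilde\theta_{m+1}:X_{m+1}\to X_m$, with $\pi\tilde\theta_0=\theta_0\pi_0$, $\rho_{m+1}\sigma_{m+1}=\pi_m$, $\sigma_{m+1}\tilde\theta_{m+1}=\theta_{m+1}\pi_{m+1}$, where every $\pi_m$ is RIC, all $\theta_m,\tilde\theta_m$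 are proximal, and $Z_{m+1}=X_m/Q_{\pi_m}(X_m,T)$ (so $\rho_{m+1}$ is equicontinuous, the largest such within $X_m$). It arises by repeatedly lifting a factor map to a RIC one by proximal extensions (the Ellis–Glasner–Shapiro diagram) and passing to the largest equicontinuous extension. It is called complete if in addition, for every $m<n$, the induced map $\lambda_m:X_n\to Y_m$ is RIC (this can be achieved by enlarging the proximal extensions). *)

theory Defs
  imports "HOL-Analysis.Analysis"
begin

section \<open>Topological dynamical systems\<close>

text \<open>A system is given by a topology on its carrier and a self-map; where the definitions refer
  to a metric, the space is an element of the type \<open>'a metric\<close>.\<close>

definition tds :: "'a topology \<Rightarrow> ('a \<Rightarrow> 'a) \<Rightarrow> bool" where
  "tds X T \<longleftrightarrow> compact_space X \<and> metrizable_space X \<and> homeomorphic_map X X T"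

definition ziter :: "'a topology \<Rightarrow> ('a \<Rightarrow> 'a) \<Rightarrow> int \<Rightarrow> 'a \<Rightarrow> 'a" where
  "ziter X T n =
     (if n \<ge> 0 then T ^^ nat n else inv_into (topspace X) T ^^ nat (- n))"

definition orbit :: "'a topology \<Rightarrow> ('a \<Rightarrow> 'a) \<Rightarrow> 'a \<Rightarrow> 'a set" where
  "orbit X T x = range (\<lambda>n. ziter X T n x)"

definition minimal_tds :: "'a topology \<Rightarrow> ('a \<Rightarrow> 'a) \<Rightarrow> bool" where
  "minimal_tds X T \<longleftrightarrow>
     tds X T \<and> (\<forall>x \<in> topspace X. X closure_of orbit X T x = topspace X)"

definition transitive_tds :: "'a topology \<Rightarrow> ('a \<Rightarrow> 'a) \<Rightarrow> bool" where
  "transitive_tds X T \<longleftrightarrow> tds X T \<and>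
     (\<forall>U V. openin X U \<and> U \<noteq> {} \<and> openin X V \<and> V \<noteq> {} \<longrightarrow>
        (\<exists>n. U \<inter> ziter X T (- n) ` V \<noteq> {}))"

definition factor_map ::
    "'a topology \<Rightarrow> ('a \<Rightarrow> 'a) \<Rightarrow> 'b topology \<Rightarrow> ('b \<Rightarrow> 'b) \<Rightarrow> ('a \<Rightarrow> 'b) \<Rightarrow> bool" where
  "factor_map X T Y S \<pi> \<longleftrightarrow> tds X T \<and> tds Y S \<and>
     continuous_map X Y \<pi> \<and> \<pi> ` topspace X = topspace Y \<and>
     (\<forall>x \<in> topspace X. \<pi> (T x) = S (\<pi> x))"

text \<open>Coordinatewise product of maps, on the extensional functions that make up
  \<^term>\<open>topspace (product_topology X I)\<close>.\<close>

definition prod_map :: "'i set \<Rightarrow> ('i \<Rightarrow> 'a \<Rightarrow> 'b) \<Rightarrow> ('i \<Rightarrow> 'a) \<Rightarrow> 'i \<Rightarrow> 'b" where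
  "prod_map I f x = (\<lambda>i\<in>I. f i (x i))"


section \<open>Topological characteristic factors\<close>

abbreviation power_topology :: "nat \<Rightarrow> 'a topology \<Rightarrow> (nat \<Rightarrow> 'a) topology" where
  "power_topology d X \<equiv> product_topology (\<lambda>_. X) {1..d}"

definition tau :: "nat \<Rightarrow> ('a \<Rightarrow> 'a) \<Rightarrow> (nat \<Rightarrow> 'a) \<Rightarrow> nat \<Rightarrow> 'a" where
  "tau d T = prod_map {1..d} (\<lambda>j. T ^^ j)"

definition diag_orbit_closure ::
    "nat \<Rightarrow> 'a topology \<Rightarrow> ('a \<Rightarrow> 'a) \<Rightarrow> 'a \<Rightarrow> (nat \<Rightarrow> 'a) set" where
  "diag_orbit_closure d X T x =
     power_topology d X closure_of orbit (power_topology d X) (tau d T) (\<lambda>j\<in>{1..d}. x)"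

definition power_saturated ::
    "nat \<Rightarrow> 'a topology \<Rightarrow> ('a \<Rightarrow> 'b) \<Rightarrow> (nat \<Rightarrow> 'a) set \<Rightarrow> bool" where
  "power_saturated d X \<pi> L \<longleftrightarrow>
     (\<forall>x \<in> L. \<forall>x' \<in> topspace (power_topology d X).
        (\<forall>j \<in> {1..d}. \<pi> (x j) = \<pi> (x' j)) \<longrightarrow> x' \<in> L)"

definition top_char_factor ::
    "nat \<Rightarrow> 'a topology \<Rightarrow> ('a \<Rightarrow> 'a) \<Rightarrow> 'b topology \<Rightarrow> ('b \<Rightarrow> 'b) \<Rightarrow> ('a \<Rightarrow> 'b) \<Rightarrow> bool" where
  "top_char_factor d X T Y S \<pi> \<longleftrightarrow> factor_map X T Y S \<pi> \<and>
     (\<exists>X0. gdelta_in X X0 \<and> X closure_of X0 = topspace X \<and>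
        (\<forall>x \<in> X0. power_saturated d X \<pi> (diag_orbit_closure d X T x)))"


section \<open>The semigroup \<open>\<beta>\<int>\<close>\<close>

text \<open>Points of \<open>\<beta>\<int>\<close> are ultrafilters. The product is the one for which
  \<open>p \<mapsto> p q\<close> is continuous and \<open>(p q) x = p (q x)\<close> for the action on a compact system.\<close>

definition betaZ :: "int filter set" where
  "betaZ = {p. p \<noteq> bot \<and> (\<forall>P. eventually P p \<or> eventually (\<lambda>n. \<not> P n) p)}"

definition beta_mult :: "int filter \<Rightarrow> int filter \<Rightarrow> int filter" where
  "beta_mult p q = Abs_filter (\<lambda>P. \<forall>\<^sub>F m in p. \<forall>\<^sub>F n in q. P (m + n))"

lemma eventually_beta_mult:
  "eventually P (beta_mult p q) \<longleftrightarrow> (\<forall>\<^sub>F m in p. \<forall>\<^sub>F n in q. P (m + n))"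
proof -
  have "is_filter (\<lambda>P. \<forall>\<^sub>F m in p. \<forall>\<^sub>F n in q. P (m + n))"
  proof
    fix P Q :: "int \<Rightarrow> bool"
    assume P: "\<forall>\<^sub>F m in p. \<forall>\<^sub>F n in q. P (m + n)"
    show "\<forall>\<^sub>F m in p. \<forall>\<^sub>F n in q. P (m + n) \<and> Q (m + n)"
      if "\<forall>\<^sub>F m in p. \<forall>\<^sub>F n in q. Q (m + n)"
      using P that by eventually_elim (rule eventually_conj)
    show "\<forall>\<^sub>F m in p. \<forall>\<^sub>F n in q. Q (m + n)" if "\<forall>x. P x \<longrightarrow> Q x"
      using P by eventually_elim (use that in \<open>auto elim: eventually_mono\<close>)
  qed simp
  then show ?thesis
    unfolding beta_mult_def by (rule eventually_Abs_filter)
qed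

definition left_ideal :: "int filter set \<Rightarrow> bool" where
  "left_ideal M \<longleftrightarrow> M \<noteq> {} \<and> M \<subseteq> betaZ \<and> (\<forall>p \<in> betaZ. \<forall>q \<in> M. beta_mult p q \<in> M)"

definition minimal_left_ideal :: "int filter set \<Rightarrow> bool" where
  "minimal_left_ideal M \<longleftrightarrow> left_ideal M \<and> (\<forall>N. left_ideal N \<and> N \<subseteq> M \<longrightarrow> N = M)"

text \<open>\<open>p x = lim T\<^sup>m x\<close> as \<open>m \<rightarrow> p\<close>; the limit exists and is unique since the
  space is compact Hausdorff and \<open>p\<close> is an ultrafilter.\<close>

definition beta_act :: "'a topology \<Rightarrow> ('a \<Rightarrow> 'a) \<Rightarrow> int filter \<Rightarrow> 'a \<Rightarrow> 'a" where
  "beta_act X T p x = (THE y. limitin X (\<lambda>m. ziter X T m x) y p)"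


section \<open>Classes of extensions\<close>

definition fibre :: "'a metric \<Rightarrow> ('a \<Rightarrow> 'b) \<Rightarrow> 'b \<Rightarrow> 'a set" where
  "fibre X \<pi> y = {x \<in> mspace X. \<pi> x = y}"

definition fibre_rel :: "'a metric \<Rightarrow> ('a \<Rightarrow> 'b) \<Rightarrow> ('a \<times> 'a) set" where
  "fibre_rel X \<pi> = {(x, x'). x \<in> mspace X \<and> x' \<in> mspace X \<and> \<pi> x = \<pi> x'}"

definition proximal_map ::
    "'a metric \<Rightarrow> ('a \<Rightarrow> 'a) \<Rightarrow> 'b metric \<Rightarrow> ('b \<Rightarrow> 'b) \<Rightarrow> ('a \<Rightarrow> 'b) \<Rightarrow> bool" where
  "proximal_map X T Y S \<pi> \<longleftrightarrow> factor_map (mtopology_of X) T (mtopology_of Y) S \<pi> \<and>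
     (\<forall>(x, x') \<in> fibre_rel X \<pi>.
        (INF n. mdist X (ziter (mtopology_of X) T n x) (ziter (mtopology_of X) T n x')) = 0)"

text \<open>Convergence of \<open>A m\<close> to the closed set \<open>C\<close> in the Hausdorff distance.\<close>

definition hausdorff_limit ::
    "'a metric \<Rightarrow> ('m \<Rightarrow> 'a set) \<Rightarrow> 'a set \<Rightarrow> 'm filter \<Rightarrow> bool" where
  "hausdorff_limit X A C F \<longleftrightarrow> closedin (mtopology_of X) C \<and>
     (\<forall>\<epsilon> > 0. \<forall>\<^sub>F m in F.
        (\<forall>a \<in> A m. \<exists>c \<in> C. mdist X a c < \<epsilon>) \<and> (\<forall>c \<in> C. \<exists>a \<in> A m. mdist X c a < \<epsilon>))"

text \<open>\<open>circ_limit X T p A C\<close> says \<open>p \<circ> A = C\<close>. A limit along a net converging to \<open>p\<close> in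
  \<open>\<beta>\<int>\<close> is a limit along the ultrafilter \<open>p\<close>. The set \<open>A\<close> is replaced by its closure,
  as \<open>u \<pi>\<^sup>-\<^sup>1(y)\<close> below need not be closed.\<close>

definition circ_limit ::
    "'a metric \<Rightarrow> ('a \<Rightarrow> 'a) \<Rightarrow> int filter \<Rightarrow> 'a set \<Rightarrow> 'a set \<Rightarrow> bool" where
  "circ_limit X T p A C \<longleftrightarrow>
     hausdorff_limit X
       (\<lambda>m. ziter (mtopology_of X) T m ` (mtopology_of X closure_of A)) C p"

text \<open>The condition does not depend on the choice of \<open>M\<close>, \<open>u\<close> and \<open>y0\<close>.\<close>

definition RIC_map ::
    "'a metric \<Rightarrow> ('a \<Rightarrow> 'a) \<Rightarrow> 'b metric \<Rightarrow> ('b \<Rightarrow> 'b) \<Rightarrow> ('a \<Rightarrow> 'b) \<Rightarrow> bool" where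
  "RIC_map X T Y S \<pi> \<longleftrightarrow> factor_map (mtopology_of X) T (mtopology_of Y) S \<pi> \<and>
     (\<exists>M u y0. minimal_left_ideal M \<and> u \<in> M \<and> beta_mult u u = u \<and>
        y0 \<in> mspace Y \<and> beta_act (mtopology_of Y) S u y0 = y0 \<and>
        (\<forall>p \<in> M. circ_limit X T p
           (beta_act (mtopology_of X) T u ` fibre X \<pi> y0)
           (fibre X \<pi> (beta_act (mtopology_of Y) S p y0))))"

definition rel_reg_proximal ::
    "'a metric \<Rightarrow> ('a \<Rightarrow> 'a) \<Rightarrow> ('a \<Rightarrow> 'b) \<Rightarrow> ('a \<times> 'a) set" where
  "rel_reg_proximal X T \<pi> = {(x, y).
     \<exists>xs ys (n :: nat \<Rightarrow> int) z.
       (\<forall>i. (xs i, ys i) \<in> fibre_rel X \<pi>) \<and>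
       limitin (mtopology_of X) xs x sequentially \<and>
       limitin (mtopology_of X) ys y sequentially \<and>
       limitin (mtopology_of X) (\<lambda>i. ziter (mtopology_of X) T (n i) (xs i)) z sequentially \<and>
       limitin (mtopology_of X) (\<lambda>i. ziter (mtopology_of X) T (n i) (ys i)) z sequentially}"


section \<open>Canonical towers\<close>

text \<open>\<open>X\<close>, \<open>T\<close>, \<open>Y\<close>, \<open>S\<close>, \<open>\<pi>\<close> is the given factor map; \<open>XX m\<close>, \<open>YY m\<close>, \<open>ZZ m\<close> with
  self-maps \<open>TX m\<close>, \<open>TY m\<close>, \<open>TZ m\<close> are the levels of the tower. The maps \<open>\<theta>\<close> and \<open>\<theta>'\<close>
  (the latter between the \<open>XX m\<close>) are indexed from 1 on; those of index 0, which end in \<open>Y\<close>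
  and \<open>X\<close>, are the separate parameters \<open>\<theta>0\<close> and \<open>\<theta>0'\<close>.\<close>

locale canonical_tower =
  fixes n :: nat
    and X :: "'a metric" and T :: "'a \<Rightarrow> 'a"
    and Y :: "'b metric" and S :: "'b \<Rightarrow> 'b"
    and \<pi> :: "'a \<Rightarrow> 'b"
    and XX :: "nat \<Rightarrow> 'x metric" and TX :: "nat \<Rightarrow> 'x \<Rightarrow> 'x"
    and YY :: "nat \<Rightarrow> 'y metric" and TY :: "nat \<Rightarrow> 'y \<Rightarrow> 'y"
    and ZZ :: "nat \<Rightarrow> 'z metric" and TZ :: "nat \<Rightarrow> 'z \<Rightarrow> 'z"
    and \<pi>m :: "nat \<Rightarrow> 'x \<Rightarrow> 'y"
    and \<theta>0' :: "'x \<Rightarrow> 'a" and \<theta>0 :: "'y \<Rightarrow> 'b"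
    and \<sigma> :: "nat \<Rightarrow> 'x \<Rightarrow> 'z" and \<rho> :: "nat \<Rightarrow> 'z \<Rightarrow> 'y"
    and \<theta> :: "nat \<Rightarrow> 'y \<Rightarrow> 'z" and \<theta>' :: "nat \<Rightarrow> 'x \<Rightarrow> 'x"
  assumes minimal_base: "minimal_tds (mtopology_of X) T" "minimal_tds (mtopology_of Y) S"
    and factor_base: "factor_map (mtopology_of X) T (mtopology_of Y) S \<pi>"
    and minimal_XX: "\<And>m. m \<le> n \<Longrightarrow> minimal_tds (mtopology_of (XX m)) (TX m)"
    and minimal_YY: "\<And>m. m \<le> n \<Longrightarrow> minimal_tds (mtopology_of (YY m)) (TY m)"
    and minimal_ZZ: "\<And>m. m < n \<Longrightarrow> minimal_tds (mtopology_of (ZZ (Suc m))) (TZ (Suc m))"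
    and RIC: "\<And>m. m \<le> n \<Longrightarrow> RIC_map (XX m) (TX m) (YY m) (TY m) (\<pi>m m)"
    and proximal_base:
      "proximal_map (XX 0) (TX 0) X T \<theta>0'"
      "proximal_map (YY 0) (TY 0) Y S \<theta>0"
    and factor_\<sigma>: "\<And>m. m < n \<Longrightarrow>
      factor_map (mtopology_of (XX m)) (TX m) (mtopology_of (ZZ (Suc m))) (TZ (Suc m)) (\<sigma> (Suc m))"
    and factor_\<rho>: "\<And>m. m < n \<Longrightarrow>
      factor_map (mtopology_of (ZZ (Suc m))) (TZ (Suc m)) (mtopology_of (YY m)) (TY m) (\<rho> (Suc m))"
    and proximal_\<theta>: "\<And>m. m < n \<Longrightarrow>
      proximal_map (YY (Suc m)) (TY (Suc m)) (ZZ (Suc m)) (TZ (Suc m)) (\<theta> (Suc m))"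
    and proximal_\<theta>': "\<And>m. m < n \<Longrightarrow>
      proximal_map (XX (Suc m)) (TX (Suc m)) (XX m) (TX m) (\<theta>' (Suc m))"
    and commute_base: "\<And>x. x \<in> mspace (XX 0) \<Longrightarrow> \<pi> (\<theta>0' x) = \<theta>0 (\<pi>m 0 x)"
    and commute_level: "\<And>m x. m < n \<Longrightarrow> x \<in> mspace (XX m) \<Longrightarrow>
      \<rho> (Suc m) (\<sigma> (Suc m) x) = \<pi>m m x"
    and commute_step: "\<And>m x. m < n \<Longrightarrow> x \<in> mspace (XX (Suc m)) \<Longrightarrow>
      \<sigma> (Suc m) (\<theta>' (Suc m) x) = \<theta> (Suc m) (\<pi>m (Suc m) x)"
    \<comment> \<open>\<open>ZZ (Suc m)\<close> is the quotient of \<open>XX m\<close>: a continuous surjection of compact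
        Hausdorff spaces is a quotient map, so it remains to prescribe its kernel\<close>
    and quotient: "\<And>m. m < n \<Longrightarrow>
      fibre_rel (XX m) (\<sigma> (Suc m)) = rel_reg_proximal (XX m) (TX m) (\<pi>m m)"

text \<open>\<open>tower_proj \<theta>' m j\<close> is the composite map from \<open>XX (m + j)\<close> down to \<open>XX m\<close>.\<close>

primrec tower_proj :: "(nat \<Rightarrow> 'x \<Rightarrow> 'x) \<Rightarrow> nat \<Rightarrow> nat \<Rightarrow> 'x \<Rightarrow> 'x" where
  "tower_proj \<theta>' m 0 = id"
| "tower_proj \<theta>' m (Suc j) = tower_proj \<theta>' m j \<circ> \<theta>' (m + Suc j)"

locale complete_canonical_tower = canonical_tower +
  assumes complete: "\<And>m. m < n \<Longrightarrow>
    RIC_map (XX n) (TX n) (YY m) (TY m) (\<pi>m m \<circ> tower_proj \<theta>' m (n - m))"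

end

theory Submission
  imports Defs "HOL-Library.Function_Algebras"
begin

text \<open>Let \<open>u\<close> be an idempotent of \<open>\<beta>\<int>\<close> that is minimal. On the set \<open>F\<close> of \<open>u\<close>-fixed points of a fibre of an
  RIC extension, \<open>A \<mapsto> F \<inter> u \<circ> A\<close> is the closure operator of a compact \<open>T\<^sub>1\<close> topology, on which a group of
  elements of \<open>\<beta>\<int>\<close> acts transitively by homeomorphisms. Two regionally proximal points of \<open>F\<close> have no disjoint
  neighbourhoods in it. Proximal maps are bijective on \<open>u\<close>-fixed points, so this property is inherited by the pairs in the
  top system with the same image in \<open>(Y\<^sub>i)\<^sub>m\<^sub>+\<^sub>1\<close>.

  Let \<open>N\<close> be the set of limits of the points \<open>(T\<^sub>i\<^bsup>a\<^sub>i + j l\<^esup> x\<^sub>i)\<close>. It is minimal under the group of these motions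
  (Ellis). If \<open>N\<close> is saturated over \<open>(Y\<^sub>i)\<^sub>m\<close>, finitely many translates of an open set \<open>U\<close> cover a fibre, so the closure
  of one of them has interior in the compact \<open>T\<^sub>1\<close> topology of the product, and the preceding paragraph makes the
  closure of \<open>\<Union>\<^sub>n \<tau>\<^sup>n U\<close> saturated over \<open>(Y\<^sub>i)\<^sub>m\<^sub>+\<^sub>1\<close>. For generic \<open>x\<close> the orbit closure of the diagonal point over \<open>x\<close> is the
  intersection of such sets. Hence the orbit closures in the power \<open>d\<close> are saturated over \<open>(Y\<^sub>i)\<^sub>m\<^sub>+\<^sub>1\<close>; they are the
  slices of the set \<open>N\<close> for the power \<open>d + 1\<close>, which is therefore saturated over \<open>(Y\<^sub>i)\<^sub>m\<^sub>+\<^sub>1\<close>, and so on. Transitivity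
  gives one power more to start from.\<close>

section \<open>Ultrafilters\<close>

text \<open>In coordinate \<open>(j, i)\<close> of a power the motion has speed \<open>j\<close>, so
  \<open>u\<close> acts there through its image under multiplication by \<open>j\<close>, again a
  minimal idempotent but in general not \<open>u\<close>. Hence the RIC condition has to be moved
  from the one idempotent of its definition to all minimal ones. The obstacle is that
  \<open>\<tau>\<close> need not even be transitive on \<open>N\<close>. Only the larger group moves
  open sets around, whereas the sets to be saturated are invariant under \<open>\<tau>\<close>
  alone. Translates under the larger group are harmless since they commute with
  \<open>\<tau>\<close>: what is found for one translate of \<open>U\<close> is carried back to
  \<open>U\<close>. The compact topology on fixed points is never formed as an object. On a product
  fibre it is given by limits along \<open>u\<close> in the whole product; what links it to the
  factors is continuity in one coordinate, and therefore saturation is obtained one coordinate at a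
  time. Completeness of the towers makes the fibres of the top systems over every
  \<open>(Y_i)_m\<close> accessible to these arguments, while regional proximality is known only
  further down; proximality of the connecting maps bridges the two.\<close>

definition ultra :: "'g filter \<Rightarrow> bool" where
  "ultra p \<longleftrightarrow> p \<noteq> bot \<and> (\<forall>P. eventually P p \<or> eventually (\<lambda>x. \<not> P x) p)"

lemma betaZ_iff: "p \<in> betaZ \<longleftrightarrow> ultra p"
  by (simp add: betaZ_def ultra_def)

lemma ultra_ex: "ultra p \<Longrightarrow> eventually P p \<Longrightarrow> \<exists>x. P x"
  unfolding ultra_def by (metis eventually_happens)

lemma ultra_not:
  assumes "ultra p"
  shows "eventually (\<lambda>x. \<not> P x) p \<longleftrightarrow> \<not> eventually P p"
proof -
  have False if "eventually (\<lambda>x. \<not> P x) p" "eventually P p"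
    using ultra_ex[OF assms eventually_conj[OF that]] by simp
  then show ?thesis
    using assms unfolding ultra_def by blast
qed

lemma ultra_disj:
  assumes "ultra p" "eventually (\<lambda>x. P x \<or> Q x) p"
  shows "eventually P p \<or> eventually Q p"
proof (rule ccontr)
  assume "\<not> ?thesis"
  then have "eventually (\<lambda>x. \<not> P x \<and> \<not> Q x) p"
    using assms(1) by (simp add: eventually_conj_iff ultra_not)
  from ultra_ex[OF assms(1) eventually_conj[OF this assms(2)]] show False by blast
qed

section \<open>Minimal filters and the existence of ultrafilters\<close>

lemma eventually_Inf_chain:
  assumes "C \<noteq> {}" "\<And>g h. g \<in> C \<Longrightarrow> h \<in> C \<Longrightarrow> g \<le> h \<or> h \<le> g"
  shows "eventually P (Inf C) \<longleftrightarrow> (\<exists>b\<in>C. eventually P b)"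
proof (rule eventually_Inf_base[OF assms(1)])
  fix F G assume "F \<in> C" "G \<in> C"
  with assms(2)[OF this] show "\<exists>x\<in>C. x \<le> inf F G"
    by (auto intro: bexI[of _ F] bexI[of _ G])
qed

lemma ultra_le_eq:
  assumes "ultra p" "q \<noteq> bot" "q \<le> p"
  shows "q = p"
proof (rule antisym[OF assms(3)], rule filter_leI)
  fix P assume P: "eventually P q"
  show "eventually P p"
  proof (rule ccontr)
    assume "\<not> eventually P p"
    then have "eventually (\<lambda>x. \<not> P x) p"
      using assms(1) ultra_not by blast
    then have "eventually (\<lambda>x. \<not> P x) q"
      using assms(3) by (rule filter_leD[rotated])
    with P have "eventually (\<lambda>x. False) q"
      by eventually_elim simp
    then show False
      using assms(2) by (simp add: trivial_limit_def)
  qed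
qed

text \<open>Zorn's lemma for filters, applied twice: with trivial \<open>Q\<close> it yields
  ultrafilters, and with invariance for \<open>Q\<close> it yields a minimal closed invariant set of
  ultrafilters.\<close>

lemma minimal_filter_ex:
  fixes f :: "'g filter"
  assumes f: "f \<noteq> bot" "Q f"
    and Inf: "\<And>C. C \<noteq> {} \<Longrightarrow> (\<And>g. g \<in> C \<Longrightarrow> g \<noteq> bot \<and> Q g) \<Longrightarrow>
      (\<And>g h. g \<in> C \<Longrightarrow> h \<in> C \<Longrightarrow> g \<le> h \<or> h \<le> g) \<Longrightarrow> Q (Inf C)"
  shows "\<exists>m \<le> f. m \<noteq> bot \<and> Q m \<and> (\<forall>g \<le> m. g \<noteq> bot \<longrightarrow> Q g \<longrightarrow> g = m)"
proof -
  define A where "A = {g. g \<le> f \<and> g \<noteq> bot \<and> Q g}"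
  have "\<exists>m\<in>A. \<forall>g\<in>A. m \<ge> g \<longrightarrow> g = m"
  proof (rule predicate_Zorn)
    show "partial_order_on A (relation_of (\<ge>) A)"
      by (rule partial_order_on_relation_ofI) auto
    fix C assume C: "C \<in> Chains (relation_of (\<ge>) A)"
    then have CA: "C \<subseteq> A" and chain: "\<And>g h. g \<in> C \<Longrightarrow> h \<in> C \<Longrightarrow> g \<le> h \<or> h \<le> g"
      by (auto simp: Chains_def relation_of_def)
    show "\<exists>u\<in>A. \<forall>a\<in>C. a \<ge> u"
    proof (cases "C = {}")
      case True
      then show ?thesis using f unfolding A_def by auto
    next
      case False
      have ev: "eventually P (Inf C) \<longleftrightarrow> (\<exists>b\<in>C. eventually P b)" for P
        using False chain by (rule eventually_Inf_chain)
      have "Inf C \<noteq> bot"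
        using ev[of "\<lambda>_. False"] CA by (auto simp: A_def trivial_limit_def)
      moreover have "Q (Inf C)"
        using False CA chain by (intro Inf) (auto simp: A_def)
      moreover have "Inf C \<le> f"
        using False CA by (auto simp: A_def intro: Inf_lower2)
      ultimately show ?thesis
        by (intro bexI[of _ "Inf C"]) (auto simp: A_def Inf_lower)
    qed
  qed
  then show ?thesis
    unfolding A_def by (auto intro: order_trans)
qed

lemma ultra_below:
  assumes "f \<noteq> bot"
  shows "\<exists>p \<le> f. ultra p"
proof -
  obtain m where m: "m \<le> f" "m \<noteq> bot" "\<And>g. g \<le> m \<Longrightarrow> g \<noteq> bot \<Longrightarrow> g = m"
    using minimal_filter_ex[of f "\<lambda>_. True"] assms by auto
  have "ultra m"
    unfolding ultra_def
  proof (intro conjI allI m(2))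
    fix P
    show "eventually P m \<or> eventually (\<lambda>x. \<not> P x) m"
    proof (cases "inf m (principal {x. P x}) = bot")
      case True
      then have "eventually (\<lambda>x. False) (inf m (principal {x. P x}))"
        by simp
      then show ?thesis
        by (simp add: eventually_inf_principal)
    next
      case False
      then have "inf m (principal {x. P x}) = m"
        by (simp add: m(3))
      moreover have "eventually P (inf m (principal {x. P x}))"
        by (simp add: eventually_inf_principal)
      ultimately show ?thesis by simp
    qed
  qed
  with m(1) show ?thesis by blast
qed

text \<open>Compactness of the space of ultrafilters in the form used throughout: conditions that
  are directed and individually satisfiable hold together along one ultrafilter.\<close>

lemma ultra_directed:
  assumes "I \<noteq> {}"
    and ne: "\<And>a. a \<in> I \<Longrightarrow> \<exists>n. Q a n"
    and dir: "\<And>a b. a \<in> I \<Longrightarrow> b \<in> I \<Longrightarrow> \<exists>c\<in>I. \<forall>n. Q c n \<longrightarrow> Q a n \<and> Q b n"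
  shows "\<exists>p. ultra p \<and> (\<forall>a\<in>I. eventually (Q a) p)"
proof -
  define f where "f = (INF a\<in>I. principal {n. Q a n})"
  have ev: "eventually P f \<longleftrightarrow> (\<exists>a\<in>I. eventually P (principal {n. Q a n}))" for P
    unfolding f_def
  proof (rule eventually_INF_base[OF assms(1)])
    fix a b assume "a \<in> I" "b \<in> I"
    from dir[OF this] show "\<exists>x\<in>I. principal {n. Q x n} \<le> inf (principal {n. Q a n}) (principal {n. Q b n})"
      by auto
  qed
  have "f \<noteq> bot"
    using ev[of "\<lambda>_. False"] ne by (auto simp: trivial_limit_def eventually_principal)
  from ultra_below[OF this] obtain p where p: "p \<le> f" "ultra p" by blast
  have "eventually (Q a) p" if "a \<in> I" for a
    using p(1) by (rule filter_leD) (auto simp: ev eventually_principal that intro!: bexI[of _ a])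
  with p show ?thesis by blast
qed


section \<open>The Stone-Cech compactification of an abelian group as a semigroup\<close>

text \<open>\<open>beta_mult\<close> for an arbitrary abelian group, since the minimality of
  \<open>N\<close> concerns a group of vectors of exponents and its ultrafilters have to be
  multiplied as well.\<close>

definition bmul :: "'g::ab_group_add filter \<Rightarrow> 'g filter \<Rightarrow> 'g filter" where
  "bmul p q = Abs_filter (\<lambda>P. \<forall>\<^sub>F m in p. \<forall>\<^sub>F n in q. P (m + n))"

lemma beta_mult_bmul: "beta_mult = bmul"
  by (intro ext) (simp add: beta_mult_def bmul_def)

lemma eventually_bmul:
  "eventually P (bmul p q) \<longleftrightarrow> (\<forall>\<^sub>F m in p. \<forall>\<^sub>F n in q. P (m + n))"
proof -
  have "is_filter (\<lambda>P. \<forall>\<^sub>F m in p. \<forall>\<^sub>F n in q. P (m + n))"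
  proof
    fix P Q :: "'a \<Rightarrow> bool"
    assume P: "\<forall>\<^sub>F m in p. \<forall>\<^sub>F n in q. P (m + n)"
    show "\<forall>\<^sub>F m in p. \<forall>\<^sub>F n in q. P (m + n) \<and> Q (m + n)"
      if "\<forall>\<^sub>F m in p. \<forall>\<^sub>F n in q. Q (m + n)"
      using P that by eventually_elim (rule eventually_conj)
    show "\<forall>\<^sub>F m in p. \<forall>\<^sub>F n in q. Q (m + n)" if "\<forall>x. P x \<longrightarrow> Q x"
      using P by eventually_elim (use that in \<open>auto elim: eventually_mono\<close>)
  qed simp
  then show ?thesis
    unfolding bmul_def by (rule eventually_Abs_filter)
qed

lemma bmul_assoc: "bmul (bmul p q) r = bmul p (bmul q r)"
  by (simp add: filter_eq_iff eventually_bmul add.assoc)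

lemma ultra_bmul:
  assumes p: "ultra p" and q: "ultra q"
  shows "ultra (bmul p q)"
  unfolding ultra_def
proof (intro conjI allI notI)
  assume "bmul p q = bot"
  then have "\<forall>\<^sub>F m in p. \<forall>\<^sub>F n in q. False"
    by (simp flip: eventually_bmul[of "\<lambda>_. False"])
  from ultra_ex[OF p this] show False
    using ultra_ex[OF q] by blast
next
  fix P
  show "eventually P (bmul p q) \<or> (\<forall>\<^sub>F x in bmul p q. \<not> P x)"
    unfolding eventually_bmul ultra_not[OF q] ultra_not[OF p] by blast
qed

lemma ultra_principal: "ultra (principal {n})"
  by (auto simp: ultra_def eventually_principal principal_eq_bot_iff)

lemma bmul_0_left [simp]: "bmul (principal {0}) p = p"
  by (simp add: filter_eq_iff eventually_bmul eventually_principal)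

lemma eventually_bmul_principal_left:
  "eventually P (bmul (principal {k}) p) \<longleftrightarrow> eventually (\<lambda>n. P (k + n)) p"
  by (simp add: eventually_bmul eventually_principal)

lemma ultra_filtermap: "ultra p \<Longrightarrow> ultra (filtermap f p)"
  by (auto simp: ultra_def eventually_filtermap filtermap_bot_iff)

lemma filtermap_bmul:
  assumes "\<And>a b. h (a + b) = h a + h b"
  shows "filtermap h (bmul p q) = bmul (filtermap h p) (filtermap h q)"
  by (simp add: filter_eq_iff eventually_bmul eventually_filtermap assms)

text \<open>A filter stands for the closed set of ultrafilters below it, an invariant filter for a
  closed invariant set. Thus \<open>m\<close> is a minimal set of this kind, and each
  \<open>s\<close> in it lies in the orbit closure of \<open>bmul q s\<close>.\<close>

lemma ultra_minimal_ex:
  "\<exists>s::'g::ab_group_add filter. ultra s \<and> (\<forall>q. ultra q \<longrightarrow> (\<exists>r. ultra r \<and> bmul (bmul r q) s = s))"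
proof -
  define inv where "inv f \<longleftrightarrow> (\<forall>P (g::'g). eventually P f \<longrightarrow> eventually (\<lambda>x. P (g + x)) f)"
    for f :: "'g filter"
  have "\<exists>m \<le> top. m \<noteq> bot \<and> inv m \<and> (\<forall>g \<le> m. g \<noteq> bot \<longrightarrow> inv g \<longrightarrow> g = m)"
  proof (rule minimal_filter_ex[where f = top and Q = inv])
    show "inv top" by (simp add: inv_def)
    fix C :: "'g filter set"
    assume C: "C \<noteq> {}" "\<And>g. g \<in> C \<Longrightarrow> g \<noteq> bot \<and> inv g"
      "\<And>g h. g \<in> C \<Longrightarrow> h \<in> C \<Longrightarrow> g \<le> h \<or> h \<le> g"
    have ev: "eventually P (Inf C) \<longleftrightarrow> (\<exists>b\<in>C. eventually P b)" for P
      using C(1,3) by (rule eventually_Inf_chain)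
    show "inv (Inf C)"
      using C(2) unfolding inv_def ev by blast
  next
    show "(top :: 'g filter) \<noteq> bot"
      by (simp add: trivial_limit_def eventually_top)
  qed
  then obtain m where m: "m \<noteq> bot" "inv m" "\<And>g. g \<le> m \<Longrightarrow> g \<noteq> bot \<Longrightarrow> inv g \<Longrightarrow> g = m"
    by auto
  obtain s where s: "s \<le> m" "ultra s"
    using ultra_below[OF m(1)] by blast
  have "\<exists>r. ultra r \<and> bmul (bmul r q) s = s" if q: "ultra q" for q
  proof -
    define p where "p = bmul q s"
    have p: "ultra p"
      unfolding p_def using q s(2) by (rule ultra_bmul)
    \<comment> \<open>The filter of the orbit closure of \<open>p\<close>; by minimality it is all
      of \<open>m\<close>.\<close>
    define f where "f = (SUP g. filtermap ((+) g) p)"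
    have evf: "eventually P f \<longleftrightarrow> (\<forall>g. eventually (\<lambda>x. P (g + x)) p)" for P
      by (simp add: f_def eventually_Sup eventually_filtermap)
    have "f \<le> m"
    proof (rule filter_leI)
      fix P assume P: "eventually P m"
      have "eventually (\<lambda>x. P (g + (h + x))) m" for g h
        using m(2)[unfolded inv_def, rule_format, OF m(2)[unfolded inv_def, rule_format, OF P, of g], of h] .
      then have "eventually (\<lambda>x. P (g + (h + x))) s" for g h
        using s(1) filter_leD by blast
      then show "eventually P f"
        by (simp add: evf p_def eventually_bmul)
    qed
    moreover have "f \<noteq> bot"
      using p by (auto simp: trivial_limit_def evf ultra_def)
    moreover have "inv f"
      unfolding inv_def evf by (simp add: add.assoc[symmetric])
    ultimately have fm: "f = m"
      by (rule m(3))
    have "\<exists>r. ultra r \<and> (\<forall>S\<in>{S. eventually S s}. eventually (\<lambda>g. eventually (\<lambda>x. S (g + x)) p) r)"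
    proof (rule ultra_directed)
      show "{S. eventually S s} \<noteq> {}"
        using eventually_True by blast
      fix S assume S: "S \<in> {S. eventually S s}"
      show "\<exists>g. eventually (\<lambda>x. S (g + x)) p"
      proof (rule ccontr)
        assume "\<not> ?thesis"
        then have "eventually (\<lambda>x. \<not> S x) f"
          by (simp add: evf ultra_not[OF p])
        then have "eventually (\<lambda>x. \<not> S x) s"
          using s(1) fm filter_leD by blast
        with S s(2) show False by (simp add: ultra_not)
      qed
    next
      fix S S' assume "S \<in> {S. eventually S s}" "S' \<in> {S. eventually S s}"
      then show "\<exists>c\<in>{S. eventually S s}. \<forall>n. (\<forall>\<^sub>F x in p. c (n + x)) \<longrightarrow>
          (\<forall>\<^sub>F x in p. S (n + x)) \<and> (\<forall>\<^sub>F x in p. S' (n + x))"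
        by (intro bexI[of _ "\<lambda>x. S x \<and> S' x"]) (auto simp: eventually_conj_iff)
    qed
    then obtain r where r: "ultra r" "\<And>S. eventually S s \<Longrightarrow> eventually (\<lambda>g. eventually (\<lambda>x. S (g + x)) p) r"
      by auto
    have "bmul r p \<le> s"
      by (rule filter_leI) (simp add: eventually_bmul r(2))
    then have "bmul r p = s"
      using ultra_bmul[OF r(1) p] by (intro ultra_le_eq[OF s(2)]) (auto simp: ultra_def)
    then show ?thesis
      using r(1) by (auto simp: p_def bmul_assoc)
  qed
  with s(2) show ?thesis by blast
qed

text \<open>Says that \<open>v\<close> is an idempotent whose left ideal
  \<open>\<beta>\<int> v\<close> is minimal. No ideal is mentioned, which makes the condition easy
  to pass through maps such as multiplication by \<open>j\<close>.\<close>

definition minid :: "int filter \<Rightarrow> bool" where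
  "minid v \<longleftrightarrow> ultra v \<and> bmul v v = v \<and> (\<forall>q. ultra q \<longrightarrow> (\<exists>r. ultra r \<and> bmul (bmul r q) v = v))"

lemma minidD:
  assumes "minid v"
  shows "ultra v" "bmul v v = v" "bmul v (bmul v p) = bmul v p"
    "ultra q \<Longrightarrow> \<exists>r. ultra r \<and> bmul (bmul r q) v = v"
  using assms unfolding minid_def by (auto simp: bmul_assoc[symmetric])

text \<open>Each member \<open>r\<close> of \<open>M\<close> generates a left ideal inside
  \<open>M\<close>, hence all of \<open>M\<close>; the main claims are instances of this.\<close>

lemma minid_of_minimal_left_ideal:
  assumes M: "minimal_left_ideal M" and u: "u \<in> M" "beta_mult u u = u"
  shows "minid u"
    and "\<And>r. r \<in> M \<Longrightarrow> \<exists>t. ultra t \<and> bmul t r = u"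
    and "\<And>p. p \<in> M \<Longrightarrow> bmul p u = p"
    and "\<And>p q. ultra p \<Longrightarrow> q \<in> M \<Longrightarrow> bmul p q \<in> M"
    and "\<And>p. p \<in> M \<Longrightarrow> ultra p"
proof -
  have L: "left_ideal M" and min: "\<And>N. left_ideal N \<Longrightarrow> N \<subseteq> M \<Longrightarrow> N = M"
    using M unfolding minimal_left_ideal_def by auto
  show ul: "ultra p" if "p \<in> M" for p
    using L that by (auto simp: left_ideal_def betaZ_iff)
  show closed: "bmul p q \<in> M" if "ultra p" "q \<in> M" for p q
    using L that by (auto simp: left_ideal_def betaZ_iff beta_mult_bmul)
  have ex: "\<exists>t. ultra t \<and> bmul t r = x" if "r \<in> M" "x \<in> M" for r x
  proof -
    define N where "N = {bmul t r | t. ultra t}"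
    have "left_ideal N"
      unfolding left_ideal_def N_def
    proof (intro conjI ballI)
      show "{bmul t r |t. ultra t} \<noteq> {}"
        by (auto intro: ultra_principal)
      show "{bmul t r |t. ultra t} \<subseteq> betaZ"
        using that by (auto simp: betaZ_iff intro!: ul closed)
      show "beta_mult p q \<in> {bmul t r |t. ultra t}" if pq: "p \<in> betaZ" "q \<in> {bmul t r |t. ultra t}" for p q
      proof -
        obtain t where "ultra t" "q = bmul t r"
          using pq(2) by blast
        then show ?thesis
          using pq(1) by (intro CollectI exI[of _ "bmul p t"])
            (simp add: betaZ_iff beta_mult_bmul bmul_assoc ultra_bmul)
      qed
    qed
    moreover have "N \<subseteq> M"
      using closed that by (auto simp: N_def)
    ultimately have "N = M" by (rule min)
    then show ?thesis using that(2) by (auto simp: N_def)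
  qed
  show "\<exists>t. ultra t \<and> bmul t r = u" if "r \<in> M" for r
    using ex[OF that u(1)] .
  show "bmul p u = p" if "p \<in> M" for p
    using ex[OF u(1) that] u(2) by (auto simp: bmul_assoc beta_mult_bmul)
  show "minid u"
    unfolding minid_def
    using ul u closed ex by (auto simp: beta_mult_bmul bmul_assoc)
qed

text \<open>Ellis: \<open>v \<beta>\<int> v\<close> is a group with identity \<open>v\<close>.
  Minimality of \<open>v\<close> gives left inverses, which may be multiplied by \<open>v\<close> on
  both sides. A left inverse \<open>h\<close> of the left inverse \<open>g\<close> of
  \<open>q\<close> has to be \<open>q\<close>, so \<open>g\<close> is two-sided.\<close>

lemma minid_group:
  assumes v: "minid v" and p: "ultra p"
  shows "\<exists>g. ultra g \<and> bmul v g = g \<and> bmul g v = g \<and> bmul g (bmul v (bmul p v)) = v \<and>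
    bmul (bmul v (bmul p v)) g = v"
proof -
  note vD = minidD[OF v]
  have left: "\<exists>g. ultra g \<and> bmul v g = g \<and> bmul g v = g \<and> bmul g q = v"
    if q: "ultra q" "bmul v q = q" "bmul q v = q" for q
  proof -
    obtain r where r: "ultra r" "bmul (bmul r q) v = v"
      using vD(4) q(1) by blast
    define g where "g = bmul v (bmul r v)"
    have "bmul g q = v"
      using r q vD by (simp add: g_def bmul_assoc)
    then show ?thesis
      using r vD q by (intro exI[of _ g]) (auto simp: g_def bmul_assoc ultra_bmul)
  qed
  define q where "q = bmul v (bmul p v)"
  have q: "ultra q" "bmul v q = q" "bmul q v = q"
    using vD p by (auto simp: q_def bmul_assoc ultra_bmul)
  obtain g where g: "ultra g" "bmul v g = g" "bmul g v = g" "bmul g q = v"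
    using left[OF q] by blast
  obtain h where h: "ultra h" "bmul v h = h" "bmul h v = h" "bmul h g = v"
    using left[OF g(1-3)] by blast
  have "h = q"
    using h g q by (metis bmul_assoc)
  then show ?thesis
    using g h unfolding q_def[symmetric] by blast
qed

text \<open>Multiplication by \<open>j\<close> maps \<open>\<beta>\<int>\<close> onto the ultrafilters containing \<open>j\<int>\<close>, and every ultrafilter
  contains a coset of \<open>j\<int>\<close>.\<close>

lemma minid_filtermap_times:
  assumes u: "minid u" and j: "j > 0"
  shows "minid (filtermap (\<lambda>n. j * n) u)"
  unfolding minid_def
proof (intro conjI allI impI)
  note uD = minidD[OF u]
  have hom: "filtermap (\<lambda>n. j * n) (bmul p q) = bmul (filtermap (\<lambda>n. j * n) p) (filtermap (\<lambda>n. j * n) q)"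
    for p q :: "int filter"
    by (rule filtermap_bmul) (simp add: distrib_left)
  show "ultra (filtermap (\<lambda>n. j * n) u)"
    using uD(1) by (rule ultra_filtermap)
  show "bmul (filtermap ((*) j) u) (filtermap ((*) j) u) = filtermap ((*) j) u"
    using hom[of u u] uD(2) by simp
  fix q :: "int filter" assume q: "ultra q"
  have "finite A \<Longrightarrow> eventually (\<lambda>n. n mod j \<in> A) q \<Longrightarrow> \<exists>s\<in>A. eventually (\<lambda>n. n mod j = s) q" for A
  proof (induction A rule: finite_induct)
    case empty
    then show ?case using q by (auto simp: ultra_def)
  next
    case (insert a A)
    then have "eventually (\<lambda>n. n mod j = a \<or> n mod j \<in> A) q" by simp
    from ultra_disj[OF q this] insert.IH show ?case by blast
  qed
  from this[of "{0..<j}"] obtain s where s: "eventually (\<lambda>n. n mod j = s) q"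
    using j by (auto simp: eventually_True)
  define q' where "q' = filtermap (\<lambda>n. n div j) q"
  have q': "ultra q'"
    unfolding q'_def using q by (rule ultra_filtermap)
  \<comment> \<open>\<open>q\<close> lives on the coset of residue \<open>s\<close>; after a shift
    by \<open>-s\<close> it is the image of an ultrafilter under multiplication by
    \<open>j\<close>.\<close>
  have eq: "bmul (principal {-s}) q = filtermap ((*) j) q'"
  proof (rule ultra_le_eq)
    show "ultra (filtermap ((*) j) q')" using q' by (rule ultra_filtermap)
    show "bmul (principal {- s}) q \<noteq> bot"
      using ultra_bmul[OF ultra_principal q] by (auto simp: ultra_def)
    show "bmul (principal {- s}) q \<le> filtermap ((*) j) q'"
    proof (rule filter_leI)
      fix P assume "eventually P (filtermap ((*) j) q')"
      then have "eventually (\<lambda>n. P (j * (n div j))) q"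
        by (simp add: q'_def eventually_filtermap)
      with s show "eventually P (bmul (principal {-s}) q)"
        unfolding eventually_bmul_principal_left
      proof eventually_elim
        case (elim n)
        then have "- s + n = j * (n div j)"
          by (metis add.commute minus_mod_eq_mult_div uminus_add_conv_diff)
        with elim show ?case by simp
      qed
    qed
  qed
  obtain r' where r': "ultra r'" "bmul (bmul r' q') u = u"
    using uD(4)[OF q'] by blast
  show "\<exists>r. ultra r \<and> bmul (bmul r q) (filtermap ((*) j) u) = filtermap ((*) j) u"
  proof (intro exI conjI)
    show "ultra (bmul (filtermap ((*) j) r') (principal {-s}))"
      using r' by (simp add: ultra_bmul ultra_filtermap ultra_principal)
    show "bmul (bmul (bmul (filtermap ((*) j) r') (principal {-s})) q) (filtermap ((*) j) u) = filtermap ((*) j) u"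
      by (simp add: bmul_assoc[of _ "principal {-s}" q] eq hom[symmetric] r')
  qed
qed

section \<open>Flows on compact Hausdorff spaces\<close>

definition pact :: "'a topology \<Rightarrow> ('g \<Rightarrow> 'a \<Rightarrow> 'a) \<Rightarrow> 'g filter \<Rightarrow> 'a \<Rightarrow> 'a" where
  "pact X T p x = (THE y. limitin X (\<lambda>n. T n x) y p)"

text \<open>The limit, along \<open>p\<close>, of the translates of the closure of \<open>A\<close>
  in the space of closed subsets. Testing with open sets allows \<open>A\<close> itself to be any
  set and avoids a metric.\<close>

definition circ :: "'a topology \<Rightarrow> ('g \<Rightarrow> 'a \<Rightarrow> 'a) \<Rightarrow> 'g filter \<Rightarrow> 'a set \<Rightarrow> 'a set" where
  "circ X T p A =
     {y \<in> topspace X. \<forall>V. openin X V \<and> y \<in> V \<longrightarrow> (\<forall>\<^sub>F n in p. T n ` A \<inter> V \<noteq> {})}"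

lemma circ_subset_topspace: "circ X T p A \<subseteq> topspace X"
  by (auto simp: circ_def)

lemma circ_in: "y \<in> circ X T p A \<Longrightarrow> y \<in> topspace X"
  by (simp add: circ_def)

lemma circ_mono:
  assumes "A \<subseteq> B"
  shows "circ X T p A \<subseteq> circ X T p B"
proof -
  have "\<forall>\<^sub>F n in p. T n ` B \<inter> V \<noteq> {}" if "\<forall>\<^sub>F n in p. T n ` A \<inter> V \<noteq> {}" for V
    using that by eventually_elim (use assms in blast)
  then show ?thesis by (auto simp: circ_def)
qed

lemma circD: "y \<in> circ X T p A \<Longrightarrow> openin X V \<Longrightarrow> y \<in> V \<Longrightarrow> \<forall>\<^sub>F n in p. T n ` A \<inter> V \<noteq> {}"
  by (auto simp: circ_def)

lemma closure_ofD: "x \<in> X closure_of A \<Longrightarrow> openin X V \<Longrightarrow> x \<in> V \<Longrightarrow> \<exists>a\<in>A. a \<in> V"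
  unfolding in_closure_of by meson

lemma openin_all_finite_cover:
  assumes "compact_space X" "\<And>y. y \<in> topspace X \<Longrightarrow> openin X (U y) \<and> y \<in> U y"
  shows "\<exists>F. finite F \<and> F \<subseteq> topspace X \<and> topspace X \<subseteq> (\<Union>y\<in>F. U y)"
proof -
  obtain \<F> where "finite \<F>" "\<F> \<subseteq> U ` topspace X" "topspace X \<subseteq> \<Union>\<F>"
    using assms(1)[unfolded compact_space_alt, rule_format, of "U ` topspace X"] assms(2) by blast
  then show ?thesis
    by (metis finite_subset_image)
qed

lemma ultra_limit_exists:
  assumes X: "compact_space X" and p: "ultra p" and f: "\<And>n. f n \<in> topspace X"
  shows "\<exists>y. limitin X f y p"
proof (rule ccontr)
  assume "\<not> ?thesis"
  then have "\<forall>y\<in>topspace X. \<exists>U. openin X U \<and> y \<in> U \<and> (\<forall>\<^sub>F n in p. f n \<notin> U)"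
    unfolding limitin_def ultra_not[OF p] by blast
  from bchoice[OF this] obtain U
    where U: "\<forall>y\<in>topspace X. openin X (U y) \<and> y \<in> U y \<and> (\<forall>\<^sub>F n in p. f n \<notin> U y)" ..
  have "\<exists>F. finite F \<and> F \<subseteq> topspace X \<and> topspace X \<subseteq> (\<Union>y\<in>F. U y)"
    by (rule openin_all_finite_cover[OF X]) (simp add: U)
  then obtain F where F: "finite F" "F \<subseteq> topspace X" "topspace X \<subseteq> (\<Union>y\<in>F. U y)"
    by (elim exE conjE)
  have "\<forall>\<^sub>F n in p. \<forall>y\<in>F. f n \<notin> U y"
    using F U by (intro eventually_ball_finite) auto
  from ultra_ex[OF p this] show False
    using F(3) f by blast
qed

section \<open>Limits of points and sets along ultrafilters\<close>

locale cflow =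
  fixes X :: "'a topology" and T :: "'g::ab_group_add \<Rightarrow> 'a \<Rightarrow> 'a"
  assumes comp: "compact_space X" and haus: "Hausdorff_space X"
    and cont: "\<And>g. continuous_map X X (T g)"
    and T_0: "\<And>x. x \<in> topspace X \<Longrightarrow> T 0 x = x"
    and T_add: "\<And>g h x. x \<in> topspace X \<Longrightarrow> T (g + h) x = T g (T h x)"
begin

lemma T_in: "x \<in> topspace X \<Longrightarrow> T g x \<in> topspace X"
  using cont[of g] by (auto simp: continuous_map_def)

lemma T_inv: "x \<in> topspace X \<Longrightarrow> T (- g) (T g x) = x"
  using T_add[of x "- g" g] T_0[of x] by simp

lemma T_inv': "x \<in> topspace X \<Longrightarrow> T g (T (- g) x) = x"
  using T_add[of x g "- g"] T_0[of x] by simp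

lemma T_image_eq: "U \<subseteq> topspace X \<Longrightarrow> T g ` U = {x \<in> topspace X. T (- g) x \<in> U}"
proof (intro subset_antisym subsetI)
  assume U: "U \<subseteq> topspace X"
  show "x \<in> {x \<in> topspace X. T (- g) x \<in> U}" if "x \<in> T g ` U" for x
    using that U T_in T_inv by auto
  show "x \<in> T g ` U" if x: "x \<in> {x \<in> topspace X. T (- g) x \<in> U}" for x
    using x T_inv'[of x g] by (intro image_eqI[of x _ "T (- g) x"]) auto
qed

lemma openin_T_preimage: "openin X U \<Longrightarrow> openin X {x \<in> topspace X. T g x \<in> U}"
  using cont by (rule openin_continuous_map_preimage)

lemma openin_T_image: "openin X U \<Longrightarrow> openin X (T g ` U)"
  by (simp add: T_image_eq openin_subset openin_T_preimage)

lemma closedin_T_image: "closedin X U \<Longrightarrow> closedin X (T g ` U)"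
  by (simp add: T_image_eq closedin_subset closedin_continuous_map_preimage[OF cont])

lemma pact_lim:
  assumes "ultra p" "x \<in> topspace X"
  shows "limitin X (\<lambda>n. T n x) (pact X T p x) p"
proof -
  obtain y where y: "limitin X (\<lambda>n. T n x) y p"
    using ultra_limit_exists[OF comp assms(1), of "\<lambda>n. T n x"] T_in assms(2) by blast
  have "pact X T p x = y"
    unfolding pact_def
    using y assms(1) by (intro the_equality) (auto simp: ultra_def intro: limitin_Hausdorff_unique[OF _ _ _ haus])
  with y show ?thesis by simp
qed

lemma pact_unique:
  "ultra p \<Longrightarrow> x \<in> topspace X \<Longrightarrow> limitin X (\<lambda>n. T n x) y p \<Longrightarrow> pact X T p x = y"
  using pact_lim[of p x] by (auto simp: ultra_def intro: limitin_Hausdorff_unique[OF _ _ _ haus])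

lemma pact_in: "ultra p \<Longrightarrow> x \<in> topspace X \<Longrightarrow> pact X T p x \<in> topspace X"
  using pact_lim limitin_topspace by metis

lemma pactD: "ultra p \<Longrightarrow> x \<in> topspace X \<Longrightarrow> openin X V \<Longrightarrow> pact X T p x \<in> V \<Longrightarrow> \<forall>\<^sub>F n in p. T n x \<in> V"
  using pact_lim limitinD by metis

lemma pact_bmul:
  assumes p: "ultra p" and q: "ultra q" and x: "x \<in> topspace X"
  shows "pact X T (bmul p q) x = pact X T p (pact X T q x)"
proof (rule pact_unique[OF ultra_bmul[OF p q] x], unfold limitin_def, intro conjI allI impI)
  show "pact X T p (pact X T q x) \<in> topspace X"
    using assms by (simp add: pact_in)
  fix U assume U: "openin X U \<and> pact X T p (pact X T q x) \<in> U"
  then have "\<forall>\<^sub>F m in p. T m (pact X T q x) \<in> U"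
    using assms by (auto intro: pactD pact_in)
  then show "\<forall>\<^sub>F n in bmul p q. T n x \<in> U"
    unfolding eventually_bmul
  proof eventually_elim
    case (elim m)
    then have "\<forall>\<^sub>F n in q. T n x \<in> {x \<in> topspace X. T m x \<in> U}"
      using U q x by (intro pactD openin_T_preimage) (auto intro: pact_in)
    then show ?case
      by eventually_elim (simp add: T_add x)
  qed
qed

lemma pact_principal: "x \<in> topspace X \<Longrightarrow> pact X T (principal {k}) x = T k x"
  by (rule pact_unique) (auto simp: ultra_principal limitin_def eventually_principal T_in)

lemma pact_closure_in_circ:
  assumes p: "ultra p" and x: "x \<in> X closure_of A"
  shows "pact X T p x \<in> circ X T p A"
  unfolding circ_def
proof (intro CollectI conjI allI impI)
  have xX: "x \<in> topspace X"
    using x by (simp add: in_closure_of)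
  then show "pact X T p x \<in> topspace X"
    using p by (simp add: pact_in)
  fix V assume V: "openin X V \<and> pact X T p x \<in> V"
  then have "\<forall>\<^sub>F n in p. T n x \<in> V"
    using p xX by (auto intro: pactD)
  then show "\<forall>\<^sub>F n in p. T n ` A \<inter> V \<noteq> {}"
  proof eventually_elim
    case (elim n)
    have "openin X {x \<in> topspace X. T n x \<in> V}"
      using V by (intro openin_T_preimage) auto
    then obtain a where "a \<in> A" "T n a \<in> V"
      using closure_ofD[OF x] elim xX by blast
    then show ?case by blast
  qed
qed

lemma pact_in_circ: "ultra p \<Longrightarrow> x \<in> topspace X \<Longrightarrow> x \<in> A \<Longrightarrow> pact X T p x \<in> circ X T p A"
  by (rule pact_closure_in_circ) (auto simp: in_closure_of)

text \<open>For an idempotent \<open>p = q = v\<close> this is the idempotence of the closure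
  operator \<open>A \<mapsto> F \<inter> v \<circ> A\<close>.\<close>

lemma circ_circ:
  "circ X T p (circ X T q A) \<subseteq> circ X T (bmul p q) A" if A: "A \<subseteq> topspace X"
proof
  fix y assume y: "y \<in> circ X T p (circ X T q A)"
  show "y \<in> circ X T (bmul p q) A"
    unfolding circ_def
  proof (intro CollectI conjI allI impI)
    show "y \<in> topspace X" using y by (simp add: circ_def)
    fix V assume V: "openin X V \<and> y \<in> V"
    then have "\<forall>\<^sub>F m in p. T m ` circ X T q A \<inter> V \<noteq> {}"
      using y by (auto dest: circD)
    then show "\<forall>\<^sub>F n in bmul p q. T n ` A \<inter> V \<noteq> {}"
      unfolding eventually_bmul
    proof eventually_elim
      case (elim m)
      then obtain a where a: "a \<in> circ X T q A" "T m a \<in> V" by blast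
      then have "\<forall>\<^sub>F n in q. T n ` A \<inter> {x \<in> topspace X. T m x \<in> V} \<noteq> {}"
        using V circ_in[OF a(1)] by (intro circD[OF a(1)] openin_T_preimage) auto
      then show ?case
      proof eventually_elim
        case (elim n)
        then obtain b where "b \<in> A" "T m (T n b) \<in> V" by blast
        then have "T (m + n) b \<in> T (m + n) ` A \<inter> V"
          using A by (auto simp: T_add)
        then show ?case by blast
      qed
    qed
  qed
qed

text \<open>Points chosen in the intersections have a limit along \<open>p\<close>, and this limit
  lies in both sets.\<close>

lemma circ_meets:
  assumes p: "ultra p" and A: "A \<subseteq> topspace X" and ev: "\<forall>\<^sub>F n in p. T n ` A \<inter> C \<noteq> {}"
    and C: "closedin X C"
  shows "circ X T p A \<inter> C \<noteq> {}"
proof -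
  \<comment> \<open>Where the intersection is empty any point serves; \<open>f\<close> only has to
    stay in the space for all \<open>n\<close> in order to have a limit.\<close>
  define f where "f n = (if T n ` A \<inter> C \<noteq> {} then SOME y. y \<in> T n ` A \<inter> C else SOME y. y \<in> topspace X)" for n
  have ne: "topspace X \<noteq> {}"
    using ultra_ex[OF p ev] A by blast
  have f1: "f n \<in> T n ` A \<inter> C" if "T n ` A \<inter> C \<noteq> {}" for n
    using that someI_ex[of "\<lambda>y. y \<in> T n ` A \<inter> C"] by (auto simp: f_def)
  have f2: "f n \<in> topspace X" for n
  proof (cases "T n ` A \<inter> C \<noteq> {}")
    case True
    then show ?thesis using f1[of n] closedin_subset[OF C] by blast
  next
    case False
    then show ?thesis using ne by (auto simp: f_def some_in_eq)
  qed
  obtain y where y: "limitin X f y p"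
    using ultra_limit_exists[OF comp p, of f] f2 by blast
  have "y \<in> circ X T p A"
    unfolding circ_def
  proof (intro CollectI conjI allI impI)
    show "y \<in> topspace X" using y limitin_topspace by metis
    fix V assume "openin X V \<and> y \<in> V"
    then have "\<forall>\<^sub>F n in p. f n \<in> V" using y by (auto dest: limitinD)
    with ev show "\<forall>\<^sub>F n in p. T n ` A \<inter> V \<noteq> {}"
      by eventually_elim (use f1 in blast)
  qed
  moreover have "y \<in> C"
  proof (rule ccontr)
    assume "y \<notin> C"
    then have "\<forall>\<^sub>F n in p. f n \<in> topspace X - C"
      using y C limitin_topspace[OF y] by (intro limitinD[OF y]) auto
    with ev have "\<forall>\<^sub>F n in p. False"
      by eventually_elim (use f1 in blast)
    then show False using ultra_ex[OF p] by blast
  qed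
  ultimately show ?thesis by blast
qed

text \<open>The side condition \<open>R\<close> lets a point be reached through elements with a
  prescribed property, as the proof that RIC maps are open requires.\<close>

lemma ultra_orbit:
  assumes x: "x \<in> topspace X" and y: "y \<in> topspace X"
    and near: "\<And>V. openin X V \<Longrightarrow> y \<in> V \<Longrightarrow> \<exists>n. R n \<and> T n x \<in> V"
  shows "\<exists>p. ultra p \<and> (\<forall>\<^sub>F n in p. R n) \<and> pact X T p x = y"
proof -
  have "\<exists>p. ultra p \<and> (\<forall>V\<in>{V. openin X V \<and> y \<in> V}. \<forall>\<^sub>F n in p. R n \<and> T n x \<in> V)"
  proof (rule ultra_directed)
    show "{V. openin X V \<and> y \<in> V} \<noteq> {}" using y by blast
    show "\<exists>n. R n \<and> T n x \<in> V" if "V \<in> {V. openin X V \<and> y \<in> V}" for V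
      using near that by blast
    show "\<exists>c\<in>{V. openin X V \<and> y \<in> V}. \<forall>n. R n \<and> T n x \<in> c \<longrightarrow> (R n \<and> T n x \<in> a) \<and> R n \<and> T n x \<in> b"
      if "a \<in> {V. openin X V \<and> y \<in> V}" "b \<in> {V. openin X V \<and> y \<in> V}" for a b
      using that by (intro bexI[of _ "a \<inter> b"]) auto
  qed
  then obtain p where p: "ultra p" "\<And>V. openin X V \<Longrightarrow> y \<in> V \<Longrightarrow> \<forall>\<^sub>F n in p. R n \<and> T n x \<in> V"
    by blast
  have "limitin X (\<lambda>n. T n x) y p"
    unfolding limitin_def using y p(2) by (simp add: eventually_conj_iff)
  moreover have "\<forall>\<^sub>F n in p. R n"
    using p(2)[OF openin_topspace y] by eventually_elim simp
  ultimately show ?thesis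
    using p(1) pact_unique x by blast
qed

lemma circ_subset_closure:
  assumes "ultra p" shows "circ X T p A \<subseteq> X closure_of (\<Union>n. T n ` A)"
proof
  fix y assume y: "y \<in> circ X T p A"
  show "y \<in> X closure_of (\<Union>n. T n ` A)"
    unfolding in_closure_of
  proof (intro conjI allI impI)
    show "y \<in> topspace X" using y by (rule circ_in)
    fix V assume "y \<in> V \<and> openin X V"
    then have "\<forall>\<^sub>F n in p. T n ` A \<inter> V \<noteq> {}" using y by (auto dest: circD)
    from ultra_ex[OF assms this] show "\<exists>z. z \<in> (\<Union>n. T n ` A) \<and> z \<in> V" by blast
  qed
qed

end

section \<open>Homomorphisms of flows\<close>

locale flow_hom = X: cflow X T + Y: cflow Y S
  for X :: "'a topology" and T :: "'g::ab_group_add \<Rightarrow> 'a \<Rightarrow> 'a"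
    and Y :: "'b topology" and S :: "'g \<Rightarrow> 'b \<Rightarrow> 'b" +
  fixes \<pi> :: "'a \<Rightarrow> 'b"
  assumes cont_hom: "continuous_map X Y \<pi>"
    and onto: "\<pi> ` topspace X = topspace Y"
    and equi: "\<And>x g. x \<in> topspace X \<Longrightarrow> \<pi> (T g x) = S g (\<pi> x)"
begin

lemma hom_in: "x \<in> topspace X \<Longrightarrow> \<pi> x \<in> topspace Y"
  using onto by blast

lemma hom_pact:
  assumes p: "ultra p" and x: "x \<in> topspace X"
  shows "\<pi> (pact X T p x) = pact Y S p (\<pi> x)"
proof (rule Y.pact_unique[OF p hom_in[OF x], symmetric])
  have "limitin Y (\<pi> \<circ> (\<lambda>n. T n x)) (\<pi> (pact X T p x)) p"
    using cont_hom X.pact_lim[OF p x] by (rule continuous_map_limit)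
  then show "limitin Y (\<lambda>n. S n (\<pi> x)) (\<pi> (pact X T p x)) p"
    by (simp add: o_def equi x)
qed

lemma hom_circ:
  assumes A: "A \<subseteq> topspace X"
  shows "\<pi> ` circ X T p A \<subseteq> circ Y S p (\<pi> ` A)"
proof (rule image_subsetI)
  fix x assume x: "x \<in> circ X T p A"
  show "\<pi> x \<in> circ Y S p (\<pi> ` A)"
    unfolding circ_def
  proof (intro CollectI conjI allI impI)
    have xX: "x \<in> topspace X" using x by (rule circ_in)
    then show "\<pi> x \<in> topspace Y" by (rule hom_in)
    fix V assume V: "openin Y V \<and> \<pi> x \<in> V"
    then have "\<forall>\<^sub>F n in p. T n ` A \<inter> {x \<in> topspace X. \<pi> x \<in> V} \<noteq> {}"
      using xX by (intro circD[OF x] openin_continuous_map_preimage[OF cont_hom]) auto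
    then show "\<forall>\<^sub>F n in p. S n ` (\<pi> ` A) \<inter> V \<noteq> {}"
    proof eventually_elim
      case (elim n)
      then obtain a where "a \<in> A" "\<pi> (T n a) \<in> V" by blast
      then have "S n (\<pi> a) \<in> S n ` (\<pi> ` A) \<inter> V" using A by (auto simp: equi)
      then show ?case by blast
    qed
  qed
qed

text \<open>The inclusion valid for every homomorphism: limits of subsets of a fibre stay over the
  limit point. RIC is the converse inclusion for the set of fixed points of the fibre.\<close>

lemma circ_fibre:
  assumes p: "ultra p" and A: "A \<subseteq> topspace X" "\<And>a. a \<in> A \<Longrightarrow> \<pi> a = y" and y: "y \<in> topspace Y"
    and x: "x \<in> circ X T p A"
  shows "\<pi> x = pact Y S p y"
proof (rule Y.pact_unique[OF p y, symmetric], unfold limitin_def, intro conjI allI impI)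
  have *: "\<pi> x \<in> circ Y S p (\<pi> ` A)"
    using hom_circ[OF A(1)] x by blast
  then show "\<pi> x \<in> topspace Y" by (rule circ_in)
  fix U assume "openin Y U \<and> \<pi> x \<in> U"
  then have "\<forall>\<^sub>F n in p. S n ` (\<pi> ` A) \<inter> U \<noteq> {}" using * by (auto dest: circD)
  then show "\<forall>\<^sub>F n in p. S n y \<in> U"
    by eventually_elim (use A(2) in auto)
qed

end

section \<open>RIC extensions\<close>

text \<open>\<open>rel_reg_proximal\<close> without sequences. The single point \<open>z\<close> for
  all neighbourhoods matters: it is later moved into a chosen open set, and the approximating pairs
  follow it.\<close>

definition regprox :: "'a topology \<Rightarrow> (int \<Rightarrow> 'a \<Rightarrow> 'a) \<Rightarrow> ('a \<Rightarrow> 'b) \<Rightarrow> 'a \<Rightarrow> 'a \<Rightarrow> bool" where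
  "regprox X T \<pi> x x' \<longleftrightarrow> (\<exists>z \<in> topspace X. \<forall>U U' W.
     openin X U \<and> openin X U' \<and> openin X W \<and> x \<in> U \<and> x' \<in> U' \<and> z \<in> W \<longrightarrow>
     (\<exists>a\<in>U. \<exists>a'\<in>U'. \<exists>n. \<pi> a = \<pi> a' \<and> T n a \<in> W \<and> T n a' \<in> W))"

definition fixed_fibre ::
    "'a topology \<Rightarrow> ('g \<Rightarrow> 'a \<Rightarrow> 'a) \<Rightarrow> ('a \<Rightarrow> 'b) \<Rightarrow> 'g filter \<Rightarrow> 'b \<Rightarrow> 'a set" where
  "fixed_fibre X T \<pi> v y = {x \<in> topspace X. \<pi> x = y \<and> pact X T v x = x}"

definition minimal_flow :: "'a topology \<Rightarrow> ('g \<Rightarrow> 'a \<Rightarrow> 'a) \<Rightarrow> bool" where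
  "minimal_flow X T \<longleftrightarrow> topspace X \<noteq> {} \<and>
     (\<forall>x \<in> topspace X. \<forall>V. openin X V \<and> V \<noteq> {} \<longrightarrow> (\<exists>n. T n x \<in> V))"

text \<open>With \<open>p\<close> the identity this says that a fibre over a \<open>v\<close>-fixed point is \<open>v \<circ> F\<close>, where \<open>F\<close> is the set
  of its \<open>v\<close>-fixed points; unlike in the definition of RIC, \<open>v\<close> is an arbitrary minimal idempotent.\<close>

definition ric :: "'a topology \<Rightarrow> (int \<Rightarrow> 'a \<Rightarrow> 'a) \<Rightarrow> 'b topology \<Rightarrow> (int \<Rightarrow> 'b \<Rightarrow> 'b) \<Rightarrow> ('a \<Rightarrow> 'b) \<Rightarrow> bool" where
  "ric X T Y S \<pi> \<longleftrightarrow> (\<forall>v y p. minid v \<and> y \<in> topspace Y \<and> pact Y S v y = y \<and> ultra p \<longrightarrow>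
     {x \<in> topspace X. \<pi> x = pact Y S p y} \<subseteq> circ X T (bmul p v) (fixed_fibre X T \<pi> v y))"

context flow_hom begin

abbreviation "FX \<equiv> fixed_fibre X T \<pi>"

lemma FX_sub: "FX v y \<subseteq> topspace X"
  by (auto simp: fixed_fibre_def)

lemma FX_D: "x \<in> FX v y \<Longrightarrow> \<pi> x = y" "x \<in> FX v y \<Longrightarrow> pact X T v x = x"
    "x \<in> FX v y \<Longrightarrow> x \<in> topspace X"
  by (auto simp: fixed_fibre_def)

lemma subset_circ_fixed:
  assumes "ultra v" "C \<subseteq> FX v y" shows "C \<subseteq> circ X T v C"
proof
  fix x assume x: "x \<in> C"
  with assms(2) have "x \<in> FX v y" by blast
  then show "x \<in> circ X T v C"
    using X.pact_in_circ[OF assms(1) _ x] FX_D by metis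
qed

lemma minimal_flow_image:
  assumes "minimal_flow X T" shows "minimal_flow Y S"
  unfolding minimal_flow_def
proof (intro conjI ballI allI impI)
  show "topspace Y \<noteq> {}" using assms onto by (auto simp: minimal_flow_def)
  fix y V assume y: "y \<in> topspace Y" and V: "openin Y V \<and> V \<noteq> {}"
  from y have "y \<in> \<pi> ` topspace X" by (simp add: onto)
  then obtain x where x: "x \<in> topspace X" "\<pi> x = y" by auto
  obtain z where "z \<in> V" using V by auto
  moreover from this have "z \<in> \<pi> ` topspace X" using V openin_subset[of Y V] by (auto simp: onto)
  ultimately have "{x \<in> topspace X. \<pi> x \<in> V} \<noteq> {}"
    by auto
  moreover have "openin X {x \<in> topspace X. \<pi> x \<in> V}"
    using V cont_hom openin_continuous_map_preimage by blast
  ultimately obtain n where "T n x \<in> {x \<in> topspace X. \<pi> x \<in> V}"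
    using assms x unfolding minimal_flow_def by blast
  then show "\<exists>n. S n y \<in> V" using x equi by auto
qed

end

section \<open>The RIC condition at every minimal idempotent\<close>

lemma (in cflow) minimal_flow_ultra:
  assumes "minimal_flow X T" "x \<in> topspace X" "y \<in> topspace X"
  obtains p where "ultra p" "pact X T p x = y"
  using ultra_orbit[OF assms(2,3), of "\<lambda>_. True"] assms unfolding minimal_flow_def by blast

text \<open>The idempotent \<open>v\<close> may lie outside \<open>M\<close>. The element
  \<open>r\<close>, absorbed by \<open>v\<close> on the left and by \<open>u\<close> on the right,
  carries \<open>y0\<close> to \<open>y\<close>, and \<open>e = r t\<close> is an idempotent with
  the same right ideal as \<open>v\<close>. So points fixed by \<open>u\<close> over
  \<open>y0\<close> are images under \<open>t\<close> of points fixed by \<open>v\<close> over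
  \<open>y\<close>.\<close>

lemma ric_of_minimal_left_ideal:
  fixes T :: "int \<Rightarrow> 'a \<Rightarrow> 'a" and S :: "int \<Rightarrow> 'b \<Rightarrow> 'b"
  assumes flow: "flow_hom X T Y S \<pi>"
    and min: "minimal_flow Y S"
    and M: "minimal_left_ideal M" "u \<in> M" "beta_mult u u = u"
    and y0: "y0 \<in> topspace Y" "pact Y S u y0 = y0"
    and sub: "\<And>p. p \<in> M \<Longrightarrow> {x \<in> topspace X. \<pi> x = pact Y S p y0} \<subseteq>
      circ X T p (pact X T u ` {x \<in> topspace X. \<pi> x = y0})"
  shows "ric X T Y S \<pi>"
  unfolding ric_def
proof (intro allI impI, elim conjE)
  interpret flow_hom X T Y S \<pi> by fact
  fix v y and p :: "int filter"
  assume v: "minid v" and y: "y \<in> topspace Y" "pact Y S v y = y" and p: "ultra p"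
  note vD = minidD[OF v]
  note Mu = minid_of_minimal_left_ideal[OF M]
  have u: "ultra u" using Mu(5) M(2) .
  obtain r0 where r0: "ultra r0" "pact Y S r0 y0 = y"
    using Y.minimal_flow_ultra[OF min y0(1) y(1)] by blast
  define r where "r = bmul v (bmul r0 u)"
  have rM: "r \<in> M"
    using Mu(4) vD(1) r0(1) M(2) by (simp add: r_def)
  have ur: "ultra r" using Mu(5)[OF rM] .
  have ry: "pact Y S r y0 = y"
    using r0 y y0 u vD(1) by (simp add: r_def Y.pact_bmul ultra_bmul Y.pact_in)
  have vr: "bmul v r = r" and ru: "bmul r u = r"
    using vD Mu(3)[OF rM] by (auto simp: r_def)
  obtain t where t: "ultra t" "bmul t r = u"
    using Mu(2)[OF rM] by blast
  define e where "e = bmul r t"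
  have e: "ultra e" "bmul e e = e" "bmul v e = e"
  proof -
    show "ultra e" using ur t by (simp add: e_def ultra_bmul)
    have "bmul e e = bmul (bmul r (bmul t r)) t" by (simp add: e_def bmul_assoc)
    also have "\<dots> = e" by (simp add: t ru e_def)
    finally show "bmul e e = e" .
    show "bmul v e = e" by (simp add: e_def vr flip: bmul_assoc)
  qed
  \<comment> \<open>It equals \<open>v\<close>: it is idempotent and absorbed by \<open>v\<close> on
    both sides, and minimality writes \<open>v\<close> as a left multiple of
    \<open>w\<close>.\<close>
  define w where "w = bmul e v"
  have ww: "bmul w w = w" "bmul v w = w" "bmul w v = w"
  proof -
    have "bmul w w = bmul e (bmul (bmul v e) v)" by (simp add: w_def bmul_assoc)
    also have "\<dots> = bmul (bmul e e) v" by (simp only: e(3) bmul_assoc)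
    finally show "bmul w w = w" by (simp add: e(2) w_def)
    show "bmul v w = w" by (simp add: w_def e(3) flip: bmul_assoc)
    show "bmul w v = w" by (simp add: w_def vD bmul_assoc)
  qed
  obtain g where g: "ultra g" "bmul (bmul g e) v = v"
    using vD(4)[OF e(1)] by blast
  have "bmul g w = v" using g(2) by (simp add: w_def bmul_assoc)
  then have "bmul v w = v" using ww(1) by (metis bmul_assoc)
  then have "w = v" by (simp add: ww(2))
  then have ev: "bmul e v = v" by (simp add: w_def)
  define F where "F = fixed_fibre X T \<pi> v y"
  have FX: "F \<subseteq> topspace X" unfolding F_def by (rule FX_sub)
  have 1: "pact X T u ` {x \<in> topspace X. \<pi> x = y0} \<subseteq> circ X T t F"
  proof (rule image_subsetI)
    fix x assume "x \<in> {x \<in> topspace X. \<pi> x = y0}"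
    then have x: "x \<in> topspace X" "\<pi> x = y0" by auto
    have "pact X T u x = pact X T t (pact X T r x)"
      using t x ur by (metis X.pact_bmul)
    moreover have "pact X T r x \<in> F"
      unfolding F_def fixed_fibre_def
    proof (intro CollectI conjI)
      show "pact X T r x \<in> topspace X" using ur x X.pact_in by blast
      show "\<pi> (pact X T r x) = y" using hom_pact[OF ur x(1)] x ry by simp
      show "pact X T v (pact X T r x) = pact X T r x"
        using X.pact_bmul[OF vD(1) ur x(1)] vr by simp
    qed
    ultimately show "pact X T u x \<in> circ X T t F"
      using X.pact_in_circ[OF t(1)] FX by auto
  qed
  have "pact Y S (bmul p r) y0 = pact Y S p y"
    using Y.pact_bmul[OF p ur y0(1)] ry by simp
  then have "{x \<in> topspace X. \<pi> x = pact Y S p y} \<subseteq>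
      circ X T (bmul p r) (pact X T u ` {x \<in> topspace X. \<pi> x = y0})"
    using sub[OF Mu(4)[OF p rM]] by simp
  also have "\<dots> \<subseteq> circ X T (bmul p r) (circ X T t F)"
    by (rule circ_mono[OF 1])
  also have "\<dots> \<subseteq> circ X T (bmul (bmul p r) t) F"
    by (rule X.circ_circ[OF FX])
  also have "bmul (bmul p r) t = bmul p e"
    by (simp add: e_def bmul_assoc)
  also have "circ X T (bmul p e) F \<subseteq> circ X T (bmul p e) (circ X T v F)"
    using subset_circ_fixed[OF vD(1), of F y] by (intro circ_mono) (simp add: F_def)
  also have "\<dots> \<subseteq> circ X T (bmul (bmul p e) v) F"
    by (rule X.circ_circ[OF FX])
  also have "bmul (bmul p e) v = bmul p v"
    by (simp add: bmul_assoc ev)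
  finally show "{x \<in> topspace X. \<pi> x = pact Y S p y} \<subseteq> circ X T (bmul p v) (fixed_fibre X T \<pi> v y)"
    by (simp add: F_def)
qed

section \<open>RIC maps are open\<close>

locale ric_ext = flow_hom X T Y S \<pi>
  for X :: "'a topology" and T :: "int \<Rightarrow> 'a \<Rightarrow> 'a"
    and Y :: "'b topology" and S :: "int \<Rightarrow> 'b \<Rightarrow> 'b" and \<pi> +
  assumes min: "minimal_flow X T" and RIC: "ric X T Y S \<pi>"
begin

lemma minY: "minimal_flow Y S"
  using min by (rule minimal_flow_image)

lemma RIC_D:
  assumes "minid v" "y \<in> topspace Y" "pact Y S v y = y" "ultra p" "x \<in> topspace X" "\<pi> x = pact Y S p y"
  shows "x \<in> circ X T (bmul p v) (FX v y)"
  using RIC assms unfolding ric_def by blast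

text \<open>If \<open>\<pi> x\<close> were a limit of points outside the image of \<open>V\<close>,
  the translates of \<open>F\<close> converging to the fibres over those points would avoid a
  neighbourhood of \<open>x\<close>. By RIC, limits of such translates fill the whole fibre that
  contains \<open>x\<close>.\<close>

lemma open_map:
  assumes v: "minid v" and V: "openin X V"
  shows "openin Y (\<pi> ` V)"
proof (rule ccontr)
  assume "\<not> ?thesis"
  then have "\<not> (\<forall>y'\<in>\<pi> ` V. \<exists>N. openin Y N \<and> y' \<in> N \<and> N \<subseteq> \<pi> ` V)"
    using openin_subopen[of Y "\<pi> ` V"] by simp
  then obtain x y' where x: "x \<in> V" "\<pi> x = y'"
    and bad: "\<And>N. openin Y N \<Longrightarrow> y' \<in> N \<Longrightarrow> \<not> N \<subseteq> \<pi> ` V"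
    by auto
  have xX: "x \<in> topspace X" using x(1) V openin_subset by blast
  have y'Y: "y' \<in> topspace Y" using x xX hom_in by blast
  note vD = minidD[OF v]
  have "neighbourhood_base_of (closedin X) X"
    using compact_Hausdorff_imp_regular_space X.comp X.haus by (simp add: neighbourhood_base_of_closedin)
  from this[unfolded neighbourhood_base_of, rule_format, OF conjI, OF V x(1)]
  obtain U C where UC: "openin X U" "closedin X C" "x \<in> U" "U \<subseteq> C" "C \<subseteq> V"
    by (elim exE conjE)
  define y where "y = pact Y S v y'"
  have yY: "y \<in> topspace Y" unfolding y_def using vD(1) y'Y by (rule Y.pact_in)
  have vy: "pact Y S v y = y"
    unfolding y_def using Y.pact_bmul[OF vD(1) vD(1) y'Y] vD(2) by simp
  define F where "F = FX v y"
  have FX: "F \<subseteq> topspace X" unfolding F_def by (rule FX_sub)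
  \<comment> \<open>The translates of \<open>F\<close> whose limit is the fibre over
    \<open>S n y\<close> eventually avoid \<open>U\<close>.\<close>
  define R where "R n \<longleftrightarrow> (\<forall>\<^sub>F m in v. T (n + m) ` F \<inter> U = {})" for n
  have "\<exists>n. R n \<and> S n y \<in> N" if N: "openin Y N" "y' \<in> N" for N
  proof -
    obtain y'' where y'': "y'' \<in> N" "y'' \<notin> \<pi> ` V" using bad[OF N] by blast
    have y''Y: "y'' \<in> topspace Y" using y''(1) N(1) openin_subset by blast
    obtain p where p: "ultra p" "pact Y S p y = y''"
      using Y.minimal_flow_ultra[OF minY yY y''Y] by blast
    have pv: "ultra (bmul p v)" using p(1) vD(1) by (rule ultra_bmul)
    have "\<not> (\<forall>\<^sub>F n in bmul p v. T n ` F \<inter> U \<noteq> {})"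
    proof
      assume "\<forall>\<^sub>F n in bmul p v. T n ` F \<inter> U \<noteq> {}"
      then have "\<forall>\<^sub>F n in bmul p v. T n ` F \<inter> C \<noteq> {}"
        by eventually_elim (use UC in blast)
      from X.circ_meets[OF pv FX this UC(2)]
      obtain z where z: "z \<in> circ X T (bmul p v) F" "z \<in> C" by blast
      have "\<pi> z = pact Y S (bmul p v) y"
        using z(1) by (intro circ_fibre[OF pv FX _ yY]) (auto simp: F_def dest: FX_D)
      also have "\<dots> = y''" using Y.pact_bmul[OF p(1) vD(1) yY] vy p by simp
      finally show False using y''(2) z(2) UC by blast
    qed
    then have "\<forall>\<^sub>F n in bmul p v. \<not> (T n ` F \<inter> U \<noteq> {})"
      by (simp only: ultra_not[OF pv] not_False_eq_True)
    then have "\<forall>\<^sub>F n in p. R n"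
      by (simp add: R_def eventually_bmul)
    moreover have "\<forall>\<^sub>F n in p. S n y \<in> N"
      using Y.pactD[OF p(1) yY N(1)] p(2) y''(1) by simp
    ultimately have "\<forall>\<^sub>F n in p. R n \<and> S n y \<in> N" by (rule eventually_conj)
    then show ?thesis using ultra_ex[OF p(1)] by blast
  qed
  from Y.ultra_orbit[OF yY y'Y this]
  obtain r where r: "ultra r" "\<forall>\<^sub>F n in r. R n" "pact Y S r y = y'" by blast
  have "x \<in> circ X T (bmul r v) F"
    unfolding F_def using RIC_D[OF v yY vy r(1) xX] x(2) r(3) by simp
  then have "\<forall>\<^sub>F n in bmul r v. T n ` F \<inter> U \<noteq> {}"
    using UC by (auto dest: circD)
  moreover have "\<forall>\<^sub>F n in bmul r v. T n ` F \<inter> U = {}"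
    using r(2) by (simp add: eventually_bmul R_def)
  ultimately have "\<forall>\<^sub>F n in bmul r v. False"
    by eventually_elim simp
  then show False
    using ultra_ex[OF ultra_bmul[OF r(1) vD(1)]] by blast
qed

end

section \<open>The group acting on the fixed points of a fibre\<close>

locale ric_base = ric_ext +
  fixes v y
  assumes v: "minid v" and y: "y \<in> topspace Y" and vy: "pact Y S v y = y"
begin

definition "F = FX v y"

text \<open>The stabilizer of \<open>y\<close> in the group \<open>v \<beta>\<int> v\<close>; the
  two absorption laws express membership in that group.\<close>

definition "A = {q. ultra q \<and> bmul v q = q \<and> bmul q v = q \<and> pact Y S q y = y}"

lemma F_sub: "F \<subseteq> topspace X"
  unfolding F_def by (rule FX_sub)

lemma F_I: "x \<in> topspace X \<Longrightarrow> \<pi> x = y \<Longrightarrow> pact X T v x = x \<Longrightarrow> x \<in> F"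
  by (auto simp: F_def fixed_fibre_def)

lemma F_D: "x \<in> F \<Longrightarrow> \<pi> x = y" "x \<in> F \<Longrightarrow> pact X T v x = x" "x \<in> F \<Longrightarrow> x \<in> topspace X"
  by (auto simp: F_def dest: FX_D)

lemmas vD = minidD[OF v]

lemma sub_circ: "C \<subseteq> F \<Longrightarrow> C \<subseteq> circ X T v C"
  using subset_circ_fixed[OF vD(1)] by (simp add: F_def)

lemma A_inv:
  assumes "q \<in> A"
  shows "\<exists>g\<in>A. bmul g q = v \<and> bmul q g = v"
proof -
  have q: "ultra q" "bmul v q = q" "bmul q v = q" "pact Y S q y = y"
    using assms by (auto simp: A_def)
  obtain g where g: "ultra g" "bmul v g = g" "bmul g v = g" "bmul g q = v" "bmul q g = v"
    using minid_group[OF v q(1)] q by auto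
  have "pact Y S g y = y"
    using Y.pact_bmul[OF g(1) q(1) y] g q vy by simp
  with g show ?thesis by (auto simp: A_def)
qed

lemma A_v: "v \<in> A"
  using vD vy by (simp add: A_def)

lemma A_F:
  assumes "q \<in> A" "x \<in> F" shows "pact X T q x \<in> F"
proof (rule F_I)
  have q: "ultra q" "bmul v q = q" "pact Y S q y = y"
    using assms by (auto simp: A_def)
  note x = F_D[OF assms(2)]
  show "pact X T q x \<in> topspace X" using q x X.pact_in by blast
  show "\<pi> (pact X T q x) = y" using hom_pact[OF q(1) x(3)] x q by simp
  show "pact X T v (pact X T q x) = pact X T q x"
    using X.pact_bmul[OF vD(1) q(1) x(3)] q by simp
qed

lemma A_cancel:
  assumes "q \<in> A" "g \<in> A" "bmul g q = v" "x \<in> F"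
  shows "pact X T g (pact X T q x) = x"
  using X.pact_bmul[of g q x] assms F_D[OF assms(4)] by (auto simp: A_def)

text \<open>The hypothesis says that \<open>K\<close> is closed in the topology of \<open>F\<close>,
  so elements of \<open>A\<close> act by homeomorphisms. A point adherent to the image is brought
  back by the inverse \<open>g\<close> of \<open>q\<close>, and the composed limit
  \<open>g q\<close> is \<open>v\<close>.\<close>

lemma image_closed:
  assumes q: "q \<in> A" and K: "K \<subseteq> F" "F \<inter> circ X T v K \<subseteq> K"
  shows "F \<inter> circ X T v (pact X T q ` K) \<subseteq> pact X T q ` K"
proof
  fix z assume z: "z \<in> F \<inter> circ X T v (pact X T q ` K)"
  obtain g where g: "g \<in> A" "bmul g q = v" "bmul q g = v"
    using A_inv[OF q] by blast
  have uq: "ultra q" "bmul v q = q" and ug: "ultra g" using q g by (auto simp: A_def)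
  have KX: "K \<subseteq> topspace X" using K F_sub by blast
  have "pact X T q ` K \<subseteq> circ X T q K"
    using X.pact_in_circ[OF uq(1)] KX by blast
  then have "z \<in> circ X T v (circ X T q K)"
    using z circ_mono by blast
  then have "z \<in> circ X T q K"
    using X.circ_circ[OF KX, of v q] uq(2) by auto
  then have "pact X T g z \<in> circ X T g (circ X T q K)"
    using X.pact_in_circ[OF ug] circ_in by metis
  then have "pact X T g z \<in> circ X T v K"
    using X.circ_circ[OF KX, of g q] g(2) by auto
  then have "pact X T g z \<in> K"
    using K A_F[OF g(1)] z by blast
  moreover have "pact X T q (pact X T g z) = z"
    using A_cancel[OF g(1) q g(3)] z by blast
  ultimately show "z \<in> pact X T q ` K" by force
qed

end

section \<open>Regionally proximal pairs and the compact topology of \<open>F\<close>\<close>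

context ric_base begin

text \<open>For \<open>q = i\<close> the condition reads \<open>x1 \<notin> K1\<close> and
  \<open>x2 \<notin> K2\<close>, because \<open>i\<close> acts injectively. So the conditions for
  all \<open>i\<close> cover the group \<open>A\<close>, and a finite subcover is wanted.
  Compactness is borrowed from \<open>X \<times> X\<close>, which contains the pairs of images of
  \<open>x1\<close> and \<open>x2\<close>.\<close>

lemma finite_separation:
  assumes K1: "K1 \<subseteq> F" "F \<inter> circ X T v K1 \<subseteq> K1" and K2: "K2 \<subseteq> F" "F \<inter> circ X T v K2 \<subseteq> K2"
    and x1: "x1 \<in> F - K1" and x2: "x2 \<in> F - K2"
  shows "\<exists>I. finite I \<and> I \<subseteq> A \<and>
    (\<forall>q\<in>A. \<exists>i\<in>I. pact X T q x1 \<notin> pact X T i ` K1 \<and> pact X T q x2 \<notin> pact X T i ` K2)"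
proof (rule ccontr)
  assume neg: "\<not> ?thesis"
  have bad: "\<exists>q\<in>A. \<forall>i\<in>I. pact X T q x1 \<in> pact X T i ` K1 \<or> pact X T q x2 \<in> pact X T i ` K2"
    if I: "finite I" "I \<subseteq> A" for I
  proof (rule ccontr)
    assume "\<not> ?thesis"
    with I neg show False by simp
  qed
  \<comment> \<open>The pairs of images for which \<open>i\<close> fails. If no finite
    \<open>I\<close> works, their closures have a common point \<open>(a1, a2)\<close>.\<close>
  define B where "B i = (\<lambda>q. (pact X T q x1, pact X T q x2)) `
      {q \<in> A. pact X T q x1 \<in> pact X T i ` K1 \<or> pact X T q x2 \<in> pact X T i ` K2}" for i
  define E where "E i = prod_topology X X closure_of (B i)" for i
  have xX: "x1 \<in> topspace X" "x2 \<in> topspace X" using x1 x2 F_D by auto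
  have BX: "B i \<subseteq> topspace (prod_topology X X)" for i
    using xX X.pact_in by (auto simp: B_def A_def)
  have "\<Inter> (E ` A) \<noteq> {}"
  proof -
    have "compact_space (prod_topology X X)"
      by (simp add: compact_space_prod_topology X.comp)
    then have *: "(\<forall>C\<in>\<U>. closedin (prod_topology X X) C) \<Longrightarrow>
        (\<forall>\<F>. finite \<F> \<and> \<F> \<subseteq> \<U> \<longrightarrow> \<Inter>\<F> \<noteq> {}) \<Longrightarrow> \<Inter>\<U> \<noteq> {}" for \<U>
      unfolding compact_space_fip by blast
    show ?thesis
    proof (rule *, safe)
      show "closedin (prod_topology X X) (E i)" for i by (simp add: E_def)
      fix \<F> assume "finite \<F>" "\<F> \<subseteq> E ` A" "\<Inter> \<F> = {}"
      then obtain I where I: "finite I" "I \<subseteq> A" "\<F> = E ` I"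
        by (auto dest: finite_subset_image)
      obtain q where q: "q \<in> A"
        "\<forall>i\<in>I. pact X T q x1 \<in> pact X T i ` K1 \<or> pact X T q x2 \<in> pact X T i ` K2"
        using bad[OF I(1,2)] by blast
      have "(pact X T q x1, pact X T q x2) \<in> E i" if "i \<in> I" for i
        using closure_of_subset[OF BX[of i]] q that unfolding E_def by (auto simp: B_def)
      with I(3) \<open>\<Inter> \<F> = {}\<close> show False by blast
    qed
  qed
  then obtain a1 a2 where a: "\<And>i. i \<in> A \<Longrightarrow> (a1, a2) \<in> E i" by auto
  have aX: "a1 \<in> topspace X" "a2 \<in> topspace X"
    using a[OF A_v] closure_of_subset_topspace unfolding E_def by fastforce+
  have near: "\<exists>q\<in>A. pact X T q x1 \<in> U1 \<and> pact X T q x2 \<in> U2 \<and>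
      (pact X T q x1 \<in> pact X T i ` K1 \<or> pact X T q x2 \<in> pact X T i ` K2)"
    if i: "i \<in> A" and U: "openin X U1" "a1 \<in> U1" "openin X U2" "a2 \<in> U2" for i U1 U2
  proof -
    have o: "(a1, a2) \<in> U1 \<times> U2 \<and> openin (prod_topology X X) (U1 \<times> U2)"
      using U by (auto simp: openin_prod_Times_iff)
    have "\<forall>T. (a1, a2) \<in> T \<and> openin (prod_topology X X) T \<longrightarrow> (\<exists>b. b \<in> B i \<and> b \<in> T)"
      using a[OF i, unfolded E_def in_closure_of] by (rule conjunct2)
    from this[rule_format, OF o] have "\<exists>b. b \<in> B i \<and> b \<in> U1 \<times> U2" .
    then show ?thesis by (auto simp: B_def)
  qed
  have "\<exists>p. ultra p \<and> (\<forall>U\<in>{(U1, U2). openin X U1 \<and> a1 \<in> U1 \<and> openin X U2 \<and> a2 \<in> U2}.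
      \<forall>\<^sub>F n in p. T n x1 \<in> fst U \<and> T n x2 \<in> snd U)"
  proof (rule ultra_directed)
    show "{(U1, U2). openin X U1 \<and> a1 \<in> U1 \<and> openin X U2 \<and> a2 \<in> U2} \<noteq> {}"
      using aX openin_topspace by blast
    fix U assume "U \<in> {(U1, U2). openin X U1 \<and> a1 \<in> U1 \<and> openin X U2 \<and> a2 \<in> U2}"
    then obtain U1 U2 where U: "U = (U1, U2)" "openin X U1" "a1 \<in> U1" "openin X U2" "a2 \<in> U2"
      by auto
    obtain q where q: "q \<in> A" "pact X T q x1 \<in> U1" "pact X T q x2 \<in> U2"
      using near[OF A_v U(2-5)] by blast
    have "\<forall>\<^sub>F n in q. T n x1 \<in> U1 \<and> T n x2 \<in> U2"
      using q X.pactD[OF _ xX(1) U(2)] X.pactD[OF _ xX(2) U(4)] by (auto simp: A_def eventually_conj_iff)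
    then have "\<exists>n. T n x1 \<in> U1 \<and> T n x2 \<in> U2"
      using q(1) ultra_ex by (auto simp: A_def)
    then show "\<exists>n. T n x1 \<in> fst U \<and> T n x2 \<in> snd U" by (simp add: U(1))
  next
    fix U V assume UV: "U \<in> {(U1, U2). openin X U1 \<and> a1 \<in> U1 \<and> openin X U2 \<and> a2 \<in> U2}"
      "V \<in> {(U1, U2). openin X U1 \<and> a1 \<in> U1 \<and> openin X U2 \<and> a2 \<in> U2}"
    show "\<exists>c\<in>{(U1, U2). openin X U1 \<and> a1 \<in> U1 \<and> openin X U2 \<and> a2 \<in> U2}.
          \<forall>n. T n x1 \<in> fst c \<and> T n x2 \<in> snd c \<longrightarrow>
             (T n x1 \<in> fst U \<and> T n x2 \<in> snd U) \<and> T n x1 \<in> fst V \<and> T n x2 \<in> snd V"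
      using UV by (intro bexI[of _ "(fst U \<inter> fst V, snd U \<inter> snd V)"]) (auto simp: openin_Int)
  qed
  then obtain p where p: "ultra p" and pU: "\<And>U1 U2. openin X U1 \<Longrightarrow> a1 \<in> U1 \<Longrightarrow> openin X U2 \<Longrightarrow> a2 \<in> U2 \<Longrightarrow>
      \<forall>\<^sub>F n in p. T n x1 \<in> U1 \<and> T n x2 \<in> U2"
    by auto
  have pa: "pact X T p x1 = a1" "pact X T p x2 = a2"
    using pU[OF _ _ openin_topspace aX(2)] pU[OF openin_topspace aX(1)] aX
    by (auto intro!: X.pact_unique[OF p] xX simp: limitin_def eventually_conj_iff)
  have pa1: "\<pi> a1 = y"
  proof (rule ccontr)
    assume ne: "\<pi> a1 \<noteq> y"
    have "closedin Y {y}"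
      using y Y.haus by (simp add: closedin_Hausdorff_singleton)
    then have "openin Y (topspace Y - {y})" by (simp add: openin_diff)
    then have "openin X {x \<in> topspace X. \<pi> x \<in> topspace Y - {y}}"
      by (rule openin_continuous_map_preimage[OF cont_hom])
    from near[OF A_v this _ openin_topspace aX(2)]
    obtain q where q: "q \<in> A" "pact X T q x1 \<in> {x \<in> topspace X. \<pi> x \<in> topspace Y - {y}}"
      using aX hom_in ne by auto
    then show False
      using F_D(1)[OF A_F[OF q(1), of x1]] x1 by auto
  qed
  \<comment> \<open>The limit \<open>p\<close> need not belong to the group. Multiplied by
    \<open>v\<close> on both sides it does, and the contradiction comes from the failure recorded
    for the index \<open>s\<close> itself.\<close>
  define s where "s = bmul v (bmul p v)"
  have vx: "\<pi> x1 = y" "pact X T v x1 = x1" "pact X T v x2 = x2"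
    using F_D[of x1] F_D[of x2] x1 x2 by auto
  have py: "pact Y S p y = y"
    using hom_pact[OF p xX(1)] unfolding pa pa1 vx by simp
  have s: "s \<in> A"
    using p vD py vy y by (simp add: A_def s_def bmul_assoc ultra_bmul Y.pact_bmul Y.pact_in)
  have sx: "pact X T s x1 = pact X T v a1" "pact X T s x2 = pact X T v a2"
    using p vD(1) xX by (simp_all add: s_def X.pact_bmul ultra_bmul X.pact_in vx pa)
  obtain g where g: "g \<in> A" "bmul g s = v" using A_inv[OF s] by blast
  have "a1 \<in> X closure_of (pact X T s ` K1) \<or> a2 \<in> X closure_of (pact X T s ` K2)"
  proof (rule ccontr)
    assume "\<not> ?thesis"
    then have "\<exists>U. openin X U \<and> a1 \<in> U \<and> U \<inter> pact X T s ` K1 = {}"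
      "\<exists>U. openin X U \<and> a2 \<in> U \<and> U \<inter> pact X T s ` K2 = {}"
      using aX by (auto simp: in_closure_of disjoint_iff)
    then obtain U1 U2 where "openin X U1" "a1 \<in> U1" "U1 \<inter> pact X T s ` K1 = {}"
      "openin X U2" "a2 \<in> U2" "U2 \<inter> pact X T s ` K2 = {}"
      by (elim exE conjE)
    then show False using near[OF s, of U1 U2] by blast
  qed
  then show False
  proof
    assume "a1 \<in> X closure_of (pact X T s ` K1)"
    then have "pact X T s x1 \<in> circ X T v (pact X T s ` K1)"
      unfolding sx by (rule X.pact_closure_in_circ[OF vD(1)])
    then have "pact X T s x1 \<in> pact X T s ` K1"
      using image_closed[OF s K1] A_F[OF s] x1 by blast
    then obtain k where "k \<in> K1" "pact X T s x1 = pact X T s k" by blast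
    then have "x1 = k"
      using A_cancel[OF s g] K1(1) x1 by (metis DiffD1 subsetD)
    with \<open>k \<in> K1\<close> x1 show False by blast
  next
    assume "a2 \<in> X closure_of (pact X T s ` K2)"
    then have "pact X T s x2 \<in> circ X T v (pact X T s ` K2)"
      unfolding sx by (rule X.pact_closure_in_circ[OF vD(1)])
    then have "pact X T s x2 \<in> pact X T s ` K2"
      using image_closed[OF s K2] A_F[OF s] x2 by blast
    then obtain k where "k \<in> K2" "pact X T s x2 = pact X T s k" by blast
    then have "x2 = k"
      using A_cancel[OF s g] K2(1) x2 by (metis DiffD1 subsetD)
    with \<open>k \<in> K2\<close> x2 show False by blast
  qed
qed

text \<open>One of the closed sets \<open>{(p, x). x \<in> p \<circ> C}\<close> has interior in the space of pairs \<open>(p, x)\<close> with \<open>\<pi> x = p y\<close>, which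
  they cover.\<close>

lemma selection:
  assumes fin: "finite \<C>" and cover: "F \<subseteq> \<Union>\<C>" and sub: "\<And>C. C \<in> \<C> \<Longrightarrow> C \<subseteq> F"
  shows "\<exists>C\<in>\<C>. \<exists>R V. openin X V \<and>
    (\<exists>p. ultra p \<and> bmul p v = p \<and> eventually R p \<and> (\<exists>b\<in>V. \<pi> b = pact Y S p y)) \<and>
    (\<forall>p b. ultra p \<and> bmul p v = p \<and> eventually R p \<and> b \<in> V \<and> \<pi> b = pact Y S p y \<longrightarrow> b \<in> circ X T p C)"
proof (rule ccontr)
  assume neg: "\<not> ?thesis"
  have bad: "\<exists>p b. ultra p \<and> bmul p v = p \<and> eventually R p \<and> b \<in> V \<and> \<pi> b = pact Y S p y \<and> b \<notin> circ X T p C"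
    if "C \<in> \<C>" "openin X V" "ultra p" "bmul p v = p" "eventually R p" "b \<in> V" "\<pi> b = pact Y S p y"
    for C R V p b
  proof (rule ccontr)
    assume "\<not> ?thesis"
    with that have "openin X V \<and>
      (\<exists>p. ultra p \<and> bmul p v = p \<and> eventually R p \<and> (\<exists>b\<in>V. \<pi> b = pact Y S p y)) \<and>
      (\<forall>p b. ultra p \<and> bmul p v = p \<and> eventually R p \<and> b \<in> V \<and> \<pi> b = pact Y S p y \<longrightarrow> b \<in> circ X T p C)"
      by (intro conjI exI[of _ p] bexI[of _ b]) simp_all
    then have "\<exists>R V. openin X V \<and>
      (\<exists>p. ultra p \<and> bmul p v = p \<and> eventually R p \<and> (\<exists>b\<in>V. \<pi> b = pact Y S p y)) \<and>
      (\<forall>p b. ultra p \<and> bmul p v = p \<and> eventually R p \<and> b \<in> V \<and> \<pi> b = pact Y S p y \<longrightarrow> b \<in> circ X T p C)"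
      by (rule exI[of _ V, THEN exI[of _ R]])
    then show False
      using that(1) by (rule notE[OF neg, OF bexI])
  qed
  \<comment> \<open>\<open>R\<close> and \<open>V\<close> describe a product neighbourhood of a pair
    \<open>(p, b)\<close>. Treating one more set \<open>C\<close> shrinks it until the translates of
    \<open>C\<close> along \<open>R\<close> miss \<open>V\<close>.\<close>
  have "\<exists>R V. openin X V \<and>
      (\<exists>p. ultra p \<and> bmul p v = p \<and> eventually R p \<and> (\<exists>b\<in>V. \<pi> b = pact Y S p y)) \<and>
      (\<forall>C\<in>\<D>. \<forall>n. R n \<longrightarrow> T n ` C \<inter> V = {})" if "finite \<D>" "\<D> \<subseteq> \<C>" for \<D>
    using that
  proof (induction \<D> rule: finite_induct)
    case empty
    from y have "y \<in> \<pi> ` topspace X" by (simp add: onto)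
    then obtain b where b: "b \<in> topspace X" "\<pi> b = y" by auto
    show ?case
      by (intro exI[of _ "\<lambda>_. True"] exI[of _ "topspace X"] conjI exI[of _ v] bexI[of _ b])
        (simp_all add: vD vy b)
  next
    case (insert C \<D>)
    from insert.prems have CD: "C \<in> \<C>" "\<D> \<subseteq> \<C>" by auto
    from insert.IH[OF CD(2)]
    obtain R V p b where IH: "openin X V" "ultra p" "bmul p v = p" "eventually R p" "b \<in> V"
      "\<pi> b = pact Y S p y" "\<forall>C\<in>\<D>. \<forall>n. R n \<longrightarrow> T n ` C \<inter> V = {}"
      by (elim exE conjE bexE)
    from bad[OF CD(1) IH(1-6)] obtain p' b'
      where p': "ultra p'" "bmul p' v = p'" "eventually R p'" "b' \<in> V" "\<pi> b' = pact Y S p' y"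
        "b' \<notin> circ X T p' C" by (elim exE conjE)
    have "b' \<in> topspace X" using p'(4) IH(1) openin_subset by blast
    with p'(6) obtain V' where V': "openin X V'" "b' \<in> V'" "\<not> (\<forall>\<^sub>F n in p'. T n ` C \<inter> V' \<noteq> {})"
      by (auto simp: circ_def)
    then have "\<forall>\<^sub>F n in p'. R n \<and> T n ` C \<inter> V' = {}"
      using p'(3) by (simp add: eventually_conj_iff flip: ultra_not[OF p'(1)])
    moreover have "\<forall>C'\<in>insert C \<D>. \<forall>n. R n \<and> T n ` C \<inter> V' = {} \<longrightarrow> T n ` C' \<inter> (V \<inter> V') = {}"
      using IH(7) by blast
    ultimately show ?case
      using p' V' IH(1)
      by (intro exI[of _ "\<lambda>n. R n \<and> T n ` C \<inter> V' = {}"] exI[of _ "V \<inter> V'"] conjI openin_Int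
          exI[of _ p'] bexI[of _ b']) simp_all
  qed
  from this[OF fin order_refl] obtain R V p b where *: "openin X V" "ultra p" "bmul p v = p"
    "eventually R p" "b \<in> V" "\<pi> b = pact Y S p y" "\<forall>C\<in>\<C>. \<forall>n. R n \<longrightarrow> T n ` C \<inter> V = {}"
    by (elim exE conjE bexE)
  have "b \<in> topspace X" using *(1,5) openin_subset by blast
  from RIC_D[OF v y vy *(2) this *(6)] have "b \<in> circ X T p F"
    by (simp add: *(3) F_def)
  then have "\<forall>\<^sub>F n in p. T n ` F \<inter> V \<noteq> {}" using * by (auto dest: circD)
  with *(4) have "\<forall>\<^sub>F n in p. R n \<and> T n ` F \<inter> V \<noteq> {}" by (rule eventually_conj)
  from ultra_ex[OF *(2) this] obtain n x where "R n" "x \<in> F" "T n x \<in> V" by blast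
  then show False using cover *(7) by blast
qed

text \<open>\<open>p\<close> is minimal, so \<open>R\<close> is piecewise syndetic: countably many
  translates of the closed set \<open>B\<close> cover \<open>Y\<close>, and by Baire's theorem one
  of them, hence \<open>B\<close>, has interior.\<close>

lemma interior_of_orbit_piece:
  assumes p: "ultra p" "bmul p v = p" and R: "eventually R p"
  shows "Y interior_of (Y closure_of {S n y |n. R n}) \<noteq> {}"
proof
  define B where "B = Y closure_of {S n y |n. R n}"
  assume "Y interior_of (Y closure_of {S n y |n. R n}) = {}"
  then have int: "Y interior_of B = {}" by (simp add: B_def)
  have cl: "closedin Y B" by (simp add: B_def)
  have sub: "{S n y |n. R n} \<subseteq> topspace Y" using y Y.T_in by blast
  have "Y interior_of \<Union> (range (\<lambda>k. S k ` B)) = {}"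
  proof (rule Baire_category_alt)
    show "completely_metrizable_space Y \<or> locally_compact_space Y \<and> regular_space Y"
      using Y.comp Y.haus by (simp add: compact_imp_locally_compact_space compact_Hausdorff_imp_regular_space)
    show "countable (range (\<lambda>k. S k ` B))" by simp
    fix C assume "C \<in> range (\<lambda>k. S k ` B)"
    then obtain k where k: "C = S k ` B" by blast
    have "Y interior_of C = {}"
    proof -
      have "S (-k) ` (Y interior_of C) \<subseteq> B"
        using interior_of_subset[of Y C] closedin_subset[OF cl] Y.T_inv by (fastforce simp: k)
      moreover have "openin Y (S (-k) ` (Y interior_of C))"
        by (rule Y.openin_T_image) simp
      ultimately have "S (-k) ` (Y interior_of C) \<subseteq> Y interior_of B"
        by (rule interior_of_maximal)
      then show ?thesis using int by blast
    qed
    then show "closedin Y C \<and> Y interior_of C = {}"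
      using Y.closedin_T_image[OF cl] k by blast
  qed
  moreover have "\<Union> (range (\<lambda>k. S k ` B)) = topspace Y"
  proof
    show "\<Union> (range (\<lambda>k. S k ` B)) \<subseteq> topspace Y"
      using closedin_subset[OF cl] Y.T_in by blast
    show "topspace Y \<subseteq> \<Union> (range (\<lambda>k. S k ` B))"
    proof
      fix z assume z: "z \<in> topspace Y"
      obtain q where q: "ultra q" "pact Y S q y = z"
        using Y.minimal_flow_ultra[OF minY y z] by blast
      obtain g where g: "ultra g" "bmul (bmul g (bmul q v)) v = v"
        using vD(4)[OF ultra_bmul[OF q(1) vD(1)]] by blast
      \<comment> \<open>By minimality \<open>p\<close> is a left multiple of
        \<open>bmul q v\<close>, which carries \<open>y\<close> to \<open>z\<close>; so along
        \<open>R\<close> the orbit of \<open>y\<close> approaches some translate of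
        \<open>z\<close>.\<close>
      then have "bmul (bmul p g) (bmul q v) = p"
        using p vD(2) by (metis bmul_assoc)
      then have "eventually R (bmul (bmul p g) (bmul q v))" using R by simp
      then have "\<forall>\<^sub>F k in bmul p g. \<forall>\<^sub>F n in bmul q v. R (k + n)"
        by (simp only: eventually_bmul[of R])
      from ultra_ex[OF ultra_bmul[OF p(1) g(1)] this]
      obtain k where k: "\<forall>\<^sub>F n in bmul q v. R (k + n)" by blast
      have z': "pact Y S (bmul q v) y = z"
        using Y.pact_bmul[OF q(1) vD(1) y] q vy by simp
      have Skz: "S k z \<in> topspace Y" using z Y.T_in by blast
      have "S k z \<in> B"
        unfolding B_def in_closure_of
      proof (intro conjI allI impI)
        show "S k z \<in> topspace Y" by fact
        fix W assume W: "S k z \<in> W \<and> openin Y W"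
        then have "\<forall>\<^sub>F n in bmul q v. S n y \<in> {w \<in> topspace Y. S k w \<in> W}"
          using z' z by (intro Y.pactD ultra_bmul q vD y Y.openin_T_preimage) auto
        with k have "\<forall>\<^sub>F n in bmul q v. R (k + n) \<and> S (k + n) y \<in> W"
          by eventually_elim (simp add: Y.T_add y)
        from ultra_ex[OF ultra_bmul[OF q(1) vD(1)] this]
        show "\<exists>a. a \<in> {S n y |n. R n} \<and> a \<in> W" by blast
      qed
      then have "z \<in> S (-k) ` B" using Y.T_inv[OF z, of k] by force
      then show "z \<in> \<Union> (range (\<lambda>k. S k ` B))" by blast
    qed
  qed
  ultimately show False using y by (simp add: interior_of_topspace)
qed

text \<open>The selected \<open>C\<close> fills the open set \<open>V\<close> over many points of
  the orbit of \<open>y\<close>. A pair witnessing regional proximality can be moved into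
  \<open>V\<close>, and openness of \<open>\<pi>\<close> replaces it by a pair over a point
  \<open>S l y\<close> of that orbit; both points are then approximated by the same translates of
  \<open>C\<close>.\<close>

lemma regprox_common_cell:
  assumes fin: "finite \<C>" and cover: "F \<subseteq> \<Union>\<C>" and sub: "\<And>C. C \<in> \<C> \<Longrightarrow> C \<subseteq> F"
    and rp: "regprox X T \<pi> x x'" and x: "x \<in> topspace X" "x' \<in> topspace X"
  shows "\<exists>C\<in>\<C>. \<exists>p. ultra p \<and> x \<in> circ X T p C \<and> x' \<in> circ X T p C"
proof -
  obtain C R V p b where C: "C \<in> \<C>" and V: "openin X V"
    and p: "ultra p" "bmul p v = p" "eventually R p" and b: "b \<in> V" "\<pi> b = pact Y S p y"
    and sel: "\<And>p b. ultra p \<Longrightarrow> bmul p v = p \<Longrightarrow> eventually R p \<Longrightarrow> b \<in> V \<Longrightarrow> \<pi> b = pact Y S p y \<Longrightarrow>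
      b \<in> circ X T p C"
    using selection[OF fin cover sub] by blast
  \<comment> \<open>The integers \<open>n\<close> for which \<open>selection\<close> applies to the
    product of \<open>n\<close> and \<open>v\<close> and the fibre over \<open>S n y\<close> meets
    \<open>V\<close>.\<close>
  define R' where "R' n \<longleftrightarrow> (\<forall>\<^sub>F m in v. R (n + m)) \<and> S n y \<in> \<pi> ` V" for n
  have "\<forall>\<^sub>F n in p. \<forall>\<^sub>F m in v. R (n + m)"
    using p(2,3) eventually_bmul[of R p v] by simp
  moreover have "\<forall>\<^sub>F n in p. S n y \<in> \<pi> ` V"
  proof (rule Y.pactD[OF p(1) y open_map[OF v V]])
    show "pact Y S p y \<in> \<pi> ` V" using b by (metis imageI)
  qed
  ultimately have R': "eventually R' p"
    unfolding R'_def by (rule eventually_conj)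
  define J where "J = Y interior_of (Y closure_of {S n y |n. R' n})"
  have J: "openin Y J" "J \<noteq> {}"
    unfolding J_def using interior_of_orbit_piece[OF p(1,2) R'] by auto
  have Jcl: "\<exists>l. R' l \<and> S l y \<in> W" if "c \<in> J" "c \<in> W" "openin Y W" for c W
  proof -
    have "c \<in> Y closure_of {S n y |n. R' n}"
      using that(1) interior_of_subset unfolding J_def by (rule subsetD[rotated])
    from conjunct2[OF this[unfolded in_closure_of], rule_format, OF conjI[OF that(2,3)]]
    show ?thesis by auto
  qed
  define V' where "V' = V \<inter> {x \<in> topspace X. \<pi> x \<in> J}"
  have V': "openin X V'"
    unfolding V'_def using V J(1) by (intro openin_Int openin_continuous_map_preimage[OF cont_hom])
  obtain c where "c \<in> J" using J by blast
  from Jcl[OF this this J(1)] obtain n0 where "R' n0" "S n0 y \<in> J" by blast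
  then have V'ne: "V' \<noteq> {}"
    using openin_subset[OF V] by (auto simp: V'_def R'_def)
  have cell: "b \<in> circ X T (bmul (principal {n}) v) C" if "R' n" "b \<in> V" "\<pi> b = S n y" for n b
  proof (rule sel[OF _ _ _ that(2)])
    show "ultra (bmul (principal {n}) v)" by (simp add: ultra_bmul ultra_principal vD)
    show "bmul (bmul (principal {n}) v) v = bmul (principal {n}) v" by (simp add: bmul_assoc vD)
    show "eventually R (bmul (principal {n}) v)"
      using that(1) by (simp add: eventually_bmul_principal_left R'_def)
    show "\<pi> b = pact Y S (bmul (principal {n}) v) y"
      using that(3) Y.pact_bmul[OF ultra_principal vD(1) y, of n] vy y by (simp add: Y.pact_principal)
  qed
  have near: "\<exists>n. T n ` C \<inter> U \<noteq> {} \<and> T n ` C \<inter> U' \<noteq> {}"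
    if U: "openin X U" "x \<in> U" "openin X U'" "x' \<in> U'" for U U'
  proof -
    from rp[unfolded regprox_def] obtain z where z1: "z \<in> topspace X"
      and z2: "\<forall>U U' W. openin X U \<and> openin X U' \<and> openin X W \<and> x \<in> U \<and> x' \<in> U' \<and> z \<in> W \<longrightarrow>
        (\<exists>a\<in>U. \<exists>a'\<in>U'. \<exists>n. \<pi> a = \<pi> a' \<and> T n a \<in> W \<and> T n a' \<in> W)" ..
    \<comment> \<open>Minimality moves the collision point \<open>z\<close> into \<open>V'\<close>,
      so both members of a close pair land there too.\<close>
    obtain k where k: "T k z \<in> V'"
      using min z1 V' V'ne unfolding minimal_flow_def by meson
    have "\<exists>a\<in>U. \<exists>a'\<in>U'. \<exists>n. \<pi> a = \<pi> a' \<and> T n a \<in> {w \<in> topspace X. T k w \<in> V'} \<and>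
        T n a' \<in> {w \<in> topspace X. T k w \<in> V'}"
      using z2[rule_format, of U U' "{w \<in> topspace X. T k w \<in> V'}"] U z1 k
        X.openin_T_preimage[OF V', of k] by simp
    then obtain a a' n where a: "a \<in> U" "a' \<in> U'" "\<pi> a = \<pi> a'" "T n a \<in> {w \<in> topspace X. T k w \<in> V'}"
      "T n a' \<in> {w \<in> topspace X. T k w \<in> V'}"
      by (elim bexE exE conjE)
    have aX: "a \<in> topspace X" "a' \<in> topspace X" using a U openin_subset by blast+
    define B where "B = V' \<inter> T (k + n) ` U"
    define B' where "B' = V' \<inter> T (k + n) ` U'"
    have B: "openin X B" "openin X B'"
      unfolding B_def B'_def using V' U X.openin_T_image by (auto intro: openin_Int)
    have "T (k + n) a \<in> V'" "T (k + n) a' \<in> V'"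
      using a aX by (simp_all add: X.T_add)
    then have ta: "T (k + n) a \<in> B" "T (k + n) a' \<in> B'"
      using a by (simp_all add: B_def B'_def)
    have "\<pi> (T (k + n) a) = \<pi> (T (k + n) a')"
      using a aX by (simp add: equi)
    then have "\<pi> (T (k + n) a) \<in> \<pi> ` B \<inter> \<pi> ` B'" using ta by (metis IntI imageI)
    moreover have "openin Y (\<pi> ` B \<inter> \<pi> ` B')"
      using B open_map[OF v] by blast
    moreover have "\<pi> (T (k + n) a) \<in> J"
      using ta by (auto simp: B_def V'_def)
    ultimately have "\<exists>l. R' l \<and> S l y \<in> \<pi> ` B \<inter> \<pi> ` B'"
      by (intro Jcl)
    then obtain l c c' where l: "R' l" "c \<in> B" "\<pi> c = S l y" "c' \<in> B'" "\<pi> c' = S l y" by auto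
    have "c \<in> circ X T (bmul (principal {l}) v) C" "c' \<in> circ X T (bmul (principal {l}) v) C"
      using l by (auto intro!: cell simp: B_def B'_def V'_def)
    then have "\<forall>\<^sub>F m in bmul (principal {l}) v. T m ` C \<inter> B \<noteq> {} \<and> T m ` C \<inter> B' \<noteq> {}"
      using B l by (intro eventually_conj) (auto dest: circD)
    from ultra_ex[OF _ this] obtain m where m: "T m ` C \<inter> B \<noteq> {}" "T m ` C \<inter> B' \<noteq> {}"
      by (auto simp: ultra_bmul ultra_principal vD)
    have "T (- (k + n) + m) ` C \<inter> U \<noteq> {}" if TU: "T m ` C \<inter> T (k + n) ` U \<noteq> {}" "openin X U" for U
    proof -
      obtain c u where cu: "c \<in> C" "u \<in> U" "T m c = T (k + n) u" using TU(1) by auto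
      have "c \<in> topspace X" "u \<in> topspace X"
        using cu sub[OF C] F_sub TU(2) openin_subset by blast+
      then have "T (- (k + n) + m) c = u"
        using cu(3) X.T_add[of c "- (k + n)" m] X.T_inv[of u "k + n"] by simp
      with cu show ?thesis by blast
    qed
    from this[of U] this[of U'] m U show ?thesis
      unfolding B_def B'_def by blast
  qed
  have "\<exists>p. ultra p \<and> (\<forall>U\<in>{(U, U'). openin X U \<and> x \<in> U \<and> openin X U' \<and> x' \<in> U'}.
      \<forall>\<^sub>F n in p. T n ` C \<inter> fst U \<noteq> {} \<and> T n ` C \<inter> snd U \<noteq> {})"
  proof (rule ultra_directed)
    show "{(U, U'). openin X U \<and> x \<in> U \<and> openin X U' \<and> x' \<in> U'} \<noteq> {}"
      using x openin_topspace by blast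
    show "\<exists>n. T n ` C \<inter> fst U \<noteq> {} \<and> T n ` C \<inter> snd U \<noteq> {}"
      if "U \<in> {(U, U'). openin X U \<and> x \<in> U \<and> openin X U' \<and> x' \<in> U'}" for U
      using that near by auto
    fix U V assume UV: "U \<in> {(U, U'). openin X U \<and> x \<in> U \<and> openin X U' \<and> x' \<in> U'}"
      "V \<in> {(U, U'). openin X U \<and> x \<in> U \<and> openin X U' \<and> x' \<in> U'}"
    show "\<exists>c\<in>{(U, U'). openin X U \<and> x \<in> U \<and> openin X U' \<and> x' \<in> U'}.
          \<forall>n. T n ` C \<inter> fst c \<noteq> {} \<and> T n ` C \<inter> snd c \<noteq> {} \<longrightarrow>
             (T n ` C \<inter> fst U \<noteq> {} \<and> T n ` C \<inter> snd U \<noteq> {}) \<and> T n ` C \<inter> fst V \<noteq> {} \<and> T n ` C \<inter> snd V \<noteq> {}"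
      using UV by (intro bexI[of _ "(fst U \<inter> fst V, snd U \<inter> snd V)"]) auto
  qed
  then obtain q where q: "ultra q" and qU: "\<And>U U'. openin X U \<Longrightarrow> x \<in> U \<Longrightarrow> openin X U' \<Longrightarrow> x' \<in> U' \<Longrightarrow>
      \<forall>\<^sub>F n in q. T n ` C \<inter> U \<noteq> {} \<and> T n ` C \<inter> U' \<noteq> {}"
    by auto
  have "x \<in> circ X T q C" "x' \<in> circ X T q C"
    using qU[OF _ _ openin_topspace x(2)] qU[OF openin_topspace x(1)] x
    by (auto simp: circ_def eventually_conj_iff)
  with C q show ?thesis by blast
qed

text \<open>Otherwise \<open>K\<close> and the closure \<open>K2\<close> of its complement are
  closed, cover \<open>F\<close> and miss \<open>x\<close> and \<open>x'\<close> respectively. Their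
  finitely many translates from \<open>finite_separation\<close> yield a finite cover such that no
  element of \<open>A\<close> sends \<open>x\<close> and \<open>x'\<close> into one cell, whereas
  \<open>regprox_common_cell\<close> provides such an element.\<close>

theorem regprox_in_closure:
  assumes K: "K \<subseteq> F" "F \<inter> circ X T v K \<subseteq> K" and x: "x \<in> F" "x \<notin> K" and x': "x' \<in> F"
    and rp: "regprox X T \<pi> x x'"
  shows "x' \<in> circ X T v (F - K)"
proof (rule ccontr)
  assume not: "x' \<notin> circ X T v (F - K)"
  define K2 where "K2 = F \<inter> circ X T v (F - K)"
  have K2: "K2 \<subseteq> F" "F \<inter> circ X T v K2 \<subseteq> K2"
  proof -
    show "K2 \<subseteq> F" by (auto simp: K2_def)
    have "circ X T v K2 \<subseteq> circ X T v (circ X T v (F - K))"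
      by (rule circ_mono) (auto simp: K2_def)
    also have "\<dots> \<subseteq> circ X T (bmul v v) (F - K)"
      using F_sub by (intro X.circ_circ) auto
    finally show "F \<inter> circ X T v K2 \<subseteq> K2" by (auto simp: K2_def vD)
  qed
  have un: "F \<subseteq> K \<union> K2"
    using sub_circ[of "F - K"] by (auto simp: K2_def)
  obtain I where I: "finite I" "I \<subseteq> A"
    "\<And>q. q \<in> A \<Longrightarrow> \<exists>i\<in>I. pact X T q x \<notin> pact X T i ` K \<and> pact X T q x' \<notin> pact X T i ` K2"
    using finite_separation[OF K K2, of x x'] x x' not by (auto simp: K2_def)
  \<comment> \<open>\<open>D\<close> records for which \<open>i\<close> the translate of
    \<open>K\<close>, rather than that of \<open>K2\<close>, is chosen.\<close>
  define cell where "cell D = {z \<in> F. \<forall>i\<in>I. z \<in> pact X T i ` (if i \<in> D then K else K2)}" for D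
  have sub: "C \<subseteq> F" if "C \<in> cell ` Pow I" for C
    using that by (auto simp: cell_def)
  have cover: "F \<subseteq> \<Union> (cell ` Pow I)"
  proof
    fix z assume z: "z \<in> F"
    define D where "D = {i \<in> I. z \<in> pact X T i ` K}"
    have "z \<in> pact X T i ` K \<or> z \<in> pact X T i ` K2" if i: "i \<in> I" for i
    proof -
      have iA: "i \<in> A" using i I(2) by blast
      obtain g where g: "g \<in> A" "bmul g i = v" "bmul i g = v" using A_inv[OF iA] by blast
      have "pact X T i (pact X T g z) = z" using A_cancel[OF g(1) iA g(3) z] .
      moreover have "pact X T g z \<in> K \<union> K2" using A_F[OF g(1) z] un by blast
      ultimately show ?thesis by (metis UnE image_eqI)
    qed
    then have "z \<in> cell D" using z by (auto simp: cell_def D_def)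
    moreover have "D \<in> Pow I" by (auto simp: D_def)
    ultimately show "z \<in> \<Union> (cell ` Pow I)" by blast
  qed
  have xX: "x \<in> topspace X" "x' \<in> topspace X" using x x' F_D by auto
  obtain D p where D: "D \<subseteq> I" and p: "ultra p" "x \<in> circ X T p (cell D)" "x' \<in> circ X T p (cell D)"
    using regprox_common_cell[OF _ cover sub rp xX] I(1) by auto
  have cF: "cell D \<subseteq> F" "cell D \<subseteq> topspace X"
    using F_sub by (auto simp: cell_def)
  \<comment> \<open>Again \<open>p\<close> is replaced by an element of the group; that
    \<open>s\<close> fixes \<open>y\<close> follows from \<open>x\<close> being over
    \<open>y\<close> and in a limit along \<open>s\<close> of points over \<open>y\<close>.\<close>
  define s where "s = bmul v (bmul p v)"
  have us: "ultra s" using p vD by (simp add: s_def ultra_bmul)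
  have in_s: "z \<in> circ X T s (cell D)" if "z \<in> F" "z \<in> circ X T p (cell D)" for z
  proof -
    have "z \<in> circ X T v (circ X T p (circ X T v (cell D)))"
    proof -
      have "circ X T p (cell D) \<subseteq> circ X T p (circ X T v (cell D))"
        by (rule circ_mono[OF sub_circ[OF cF(1)]])
      then have "z \<in> circ X T p (circ X T v (cell D))" using that by blast
      from X.pact_in_circ[OF vD(1) _ this] show ?thesis
        using F_D[OF that(1)] by simp
    qed
    also have "\<dots> \<subseteq> circ X T v (circ X T (bmul p v) (cell D))"
      by (rule circ_mono[OF X.circ_circ[OF cF(2)]])
    also have "\<dots> \<subseteq> circ X T s (cell D)"
      unfolding s_def by (rule X.circ_circ[OF cF(2)])
    finally show ?thesis .
  qed
  have "\<pi> x = pact Y S s y"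
    using in_s[OF x(1) p(2)] cF F_D by (intro circ_fibre[OF us _ _ y]) auto
  then have sA: "s \<in> A"
    using us vD x F_D(1) by (auto simp: A_def s_def bmul_assoc)
  obtain q where q: "q \<in> A" "bmul q s = v" using A_inv[OF sA] by blast
  obtain i where i: "i \<in> I" "pact X T q x \<notin> pact X T i ` K" "pact X T q x' \<notin> pact X T i ` K2"
    using I(3)[OF q(1)] by blast
  have in_cell: "pact X T q z \<in> cell D" if "z \<in> F" "z \<in> circ X T p (cell D)" for z
  proof -
    have "pact X T q z \<in> circ X T q (circ X T s (cell D))"
      using q(1) that in_s[OF that] F_D by (intro X.pact_in_circ) (auto simp: A_def)
    then have *: "pact X T q z \<in> circ X T v (cell D)"
      using X.circ_circ[OF cF(2), of q s] q(2) by auto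
    show ?thesis
      unfolding cell_def
    proof (intro CollectI conjI ballI)
      show zF: "pact X T q z \<in> F" using A_F[OF q(1) that(1)] .
      fix j assume j: "j \<in> I"
      have "pact X T q z \<in> circ X T v (pact X T j ` (if j \<in> D then K else K2))"
      proof (rule subsetD[OF circ_mono *])
        show "cell D \<subseteq> pact X T j ` (if j \<in> D then K else K2)"
          using j unfolding cell_def by blast
      qed
      then show "pact X T q z \<in> pact X T j ` (if j \<in> D then K else K2)"
        using image_closed[of j "if j \<in> D then K else K2"] j I(2) zF K K2 by (auto split: if_splits)
    qed
  qed
  have "pact X T q x \<in> cell D" "pact X T q x' \<in> cell D"
    using in_cell x x' p by auto
  then have "pact X T q x \<in> pact X T i ` (if i \<in> D then K else K2)"
    "pact X T q x' \<in> pact X T i ` (if i \<in> D then K else K2)"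
    using i(1) by (auto simp: cell_def)
  with i show False by (auto split: if_splits)
qed

end

section \<open>Canonical towers as towers of flows\<close>

lemma inv_into_homeomorphic_map:
  assumes "homeomorphic_map X X T"
  shows "continuous_map X X (inv_into (topspace X) T)"
    and "\<And>x. x \<in> topspace X \<Longrightarrow> inv_into (topspace X) T (T x) = x"
    and "\<And>x. x \<in> topspace X \<Longrightarrow> T (inv_into (topspace X) T x) = x"
    and "\<And>x. x \<in> topspace X \<Longrightarrow> T x \<in> topspace X"
    and "\<And>x. x \<in> topspace X \<Longrightarrow> inv_into (topspace X) T x \<in> topspace X"
proof -
  obtain g where g: "homeomorphic_maps X X T g"
    using assms homeomorphic_map_maps by blast
  have surj: "T ` topspace X = topspace X" and inj: "inj_on T (topspace X)"
    using assms homeomorphic_imp_surjective_map homeomorphic_imp_injective_map by blast+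
  show 1: "inv_into (topspace X) T (T x) = x" if "x \<in> topspace X" for x
    using inj that by simp
  show "T (inv_into (topspace X) T x) = x" if "x \<in> topspace X" for x
    using surj that by (simp add: f_inv_into_f)
  show "T x \<in> topspace X" if "x \<in> topspace X" for x
    using surj that by blast
  show "inv_into (topspace X) T x \<in> topspace X" if "x \<in> topspace X" for x
    using surj that by (simp add: inv_into_into)
  have "g x = inv_into (topspace X) T x" if x: "x \<in> topspace X" for x
  proof -
    have "T (g x) = x" "g x \<in> topspace X"
      using g x by (auto simp: homeomorphic_maps_def continuous_map_def)
    then show ?thesis using 1[of "g x"] by simp
  qed
  moreover have "continuous_map X X g"
    using g by (simp add: homeomorphic_maps_def)
  ultimately show "continuous_map X X (inv_into (topspace X) T)"
    by (metis continuous_map_eq)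
qed

lemma ziter_0 [simp]: "ziter X T 0 x = x"
  by (simp add: ziter_def)

lemma
  assumes T: "homeomorphic_map X X T"
  shows ziter_in: "x \<in> topspace X \<Longrightarrow> ziter X T n x \<in> topspace X"
    and ziter_Suc: "x \<in> topspace X \<Longrightarrow> ziter X T (n + 1) x = T (ziter X T n x)"
    and ziter_pred: "x \<in> topspace X \<Longrightarrow> ziter X T (n - 1) x = inv_into (topspace X) T (ziter X T n x)"
    and continuous_map_ziter: "continuous_map X X (ziter X T n)"
proof -
  note inv = inv_into_homeomorphic_map[OF T]
  have pow: "(T ^^ k) x \<in> topspace X" "(inv_into (topspace X) T ^^ k) x \<in> topspace X"
    if "x \<in> topspace X" for k x
    by (induction k) (auto simp: that inv)
  show in': "ziter X T n x \<in> topspace X" if "x \<in> topspace X" for x n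
    using pow that by (simp add: ziter_def)
  show suc: "ziter X T (n + 1) x = T (ziter X T n x)" if x: "x \<in> topspace X" for x n
  proof (cases "n \<ge> 0")
    case True
    then show ?thesis by (simp add: ziter_def nat_add_distrib)
  next
    case False
    then have "nat (- n) = Suc (nat (- n - 1))" by simp
    then show ?thesis
      using False x pow by (auto simp: ziter_def inv)
  qed
  show "ziter X T (n - 1) x = inv_into (topspace X) T (ziter X T n x)" if x: "x \<in> topspace X" for x n
    using suc[OF x, of "n - 1"] in'[OF x] inv(2) by simp
  have "continuous_map X X (f ^^ k)" if f: "continuous_map X X f" for f k
  proof (induction k)
    case (Suc k)
    from continuous_map_compose[OF this f] show ?case by (simp add: o_def)
  qed (simp add: id_def)
  then show "continuous_map X X (ziter X T n)"
    using inv(1) homeomorphic_imp_continuous_map[OF T] by (auto simp: ziter_def)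
qed

lemma ziter_add:
  assumes T: "homeomorphic_map X X T" and x: "x \<in> topspace X"
  shows "ziter X T (m + n) x = ziter X T m (ziter X T n x)"
proof (induction m rule: int_induct[where k = 0])
  case base
  then show ?case by simp
next
  case (step1 i)
  have "ziter X T (i + 1 + n) x = T (ziter X T (i + n) x)"
    using ziter_Suc[OF T x, of "i + n"] by (simp add: algebra_simps)
  then show ?case
    by (simp add: step1 ziter_Suc[OF T] ziter_in[OF T] x)
next
  case (step2 i)
  have "ziter X T (i - 1 + n) x = inv_into (topspace X) T (ziter X T (i + n) x)"
    using ziter_pred[OF T x, of "i + n"] by (simp add: algebra_simps)
  then show ?case
    by (simp add: step2 ziter_pred[OF T] ziter_in[OF T] x)
qed

lemma cflow_tds: "tds X T \<Longrightarrow> cflow X (ziter X T)"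
  by unfold_locales
    (auto simp: tds_def metrizable_imp_Hausdorff_space continuous_map_ziter ziter_add)

lemma flow_hom_factor_map:
  assumes "factor_map X T Y S \<pi>"
  shows "flow_hom X (ziter X T) Y (ziter Y S) \<pi>"
proof -
  have X: "homeomorphic_map X X T" "tds X T" and Y: "homeomorphic_map Y Y S" "tds Y S"
    and \<pi>: "continuous_map X Y \<pi>" "\<pi> ` topspace X = topspace Y" "\<And>x. x \<in> topspace X \<Longrightarrow> \<pi> (T x) = S (\<pi> x)"
    using assms by (auto simp: factor_map_def tds_def)
  have Yin: "\<pi> x \<in> topspace Y" if "x \<in> topspace X" for x using \<pi>(2) that by blast
  note invX = inv_into_homeomorphic_map[OF X(1)] and invY = inv_into_homeomorphic_map[OF Y(1)]
  have inv: "\<pi> (inv_into (topspace X) T x) = inv_into (topspace Y) S (\<pi> x)" if x: "x \<in> topspace X" for x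
  proof -
    have "S (\<pi> (inv_into (topspace X) T x)) = \<pi> x"
      using \<pi>(3)[OF invX(5)[OF x]] invX(3)[OF x] by simp
    then show ?thesis
      using invY(2)[OF Yin[OF invX(5)[OF x]]] by simp
  qed
  have "\<pi> (ziter X T n x) = ziter Y S n (\<pi> x)" if x: "x \<in> topspace X" for n x
  proof (induction n rule: int_induct[where k = 0])
    case (step1 i)
    then show ?case
      by (simp add: ziter_Suc[OF X(1)] ziter_Suc[OF Y(1)] x Yin \<pi>(3) ziter_in[OF X(1)])
  next
    case (step2 i)
    then show ?case
      by (simp add: ziter_pred[OF X(1)] ziter_pred[OF Y(1)] x Yin inv ziter_in[OF X(1)])
  qed simp
  then show ?thesis
    using \<pi> cflow_tds[OF X(2)] cflow_tds[OF Y(2)] by (simp add: flow_hom_def flow_hom_axioms_def)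
qed

lemma minimal_flow_minimal_tds:
  assumes "minimal_tds X T" "topspace X \<noteq> {}"
  shows "minimal_flow X (ziter X T)"
  unfolding minimal_flow_def
proof (intro conjI ballI allI impI assms(2))
  fix x V assume x: "x \<in> topspace X" and V: "openin X V \<and> V \<noteq> {}"
  then obtain z where z: "z \<in> V" "z \<in> topspace X" using openin_subset by blast
  have "z \<in> X closure_of orbit X T x"
    using assms(1) x z(2) by (simp add: minimal_tds_def)
  then obtain w where "w \<in> orbit X T x" "w \<in> V"
    using V z(1) by (auto simp: in_closure_of)
  then show "\<exists>n. ziter X T n x \<in> V" by (auto simp: orbit_def)
qed

section \<open>Metric notions translated to flows\<close>

lemma openin_mtopology_of_ball: "openin (mtopology_of m) {y \<in> mspace m. mdist m x y < r}" if "x \<in> mspace m"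
proof -
  interpret Metric_space "mspace m" "mdist m" by (rule Metric_space_mspace_mdist)
  have "{y \<in> mspace m. mdist m x y < r} = mball x r"
    using that by (auto simp: mball_def)
  then show ?thesis by (simp add: mtopology_of_def)
qed

lemma openin_mtopology_of_ex:
  assumes "openin (mtopology_of m) V" "x \<in> V"
  shows "\<exists>r>0. \<forall>y\<in>mspace m. mdist m x y < r \<longrightarrow> y \<in> V"
proof -
  interpret Metric_space "mspace m" "mdist m" by (rule Metric_space_mspace_mdist)
  obtain r where r: "r > 0" "mball x r \<subseteq> V"
    using assms unfolding mtopology_of_def openin_mtopology by blast
  have "x \<in> mspace m" using assms openin_subset by (fastforce simp: mtopology_of_def)
  with r show ?thesis by (intro exI[of _ r]) (auto simp: mball_def)
qed

text \<open>Points of \<open>C\<close> are approximated by translates of the closure of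
  \<open>B\<close>, and an open set that meets a translate of the closure meets the same translate
  of \<open>B\<close>.\<close>

lemma circ_limit_subset:
  assumes tds: "tds (mtopology_of X) T" and lim: "circ_limit X T p B C" and B: "B \<subseteq> mspace X"
  shows "C \<subseteq> circ (mtopology_of X) (ziter (mtopology_of X) T) p B"
proof
  interpret cflow "mtopology_of X" "ziter (mtopology_of X) T" by (rule cflow_tds[OF tds])
  fix c assume c: "c \<in> C"
  let ?B = "mtopology_of X closure_of B"
  have C: "closedin (mtopology_of X) C"
    and ev: "\<And>\<epsilon>. \<epsilon> > 0 \<Longrightarrow> \<forall>\<^sub>F m in p. \<forall>c \<in> C. \<exists>a \<in> ziter (mtopology_of X) T m ` ?B. mdist X c a < \<epsilon>"
    using lim by (auto simp: circ_limit_def hausdorff_limit_def eventually_conj_iff)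
  have cX: "c \<in> topspace (mtopology_of X)" using c C closedin_subset by blast
  show "c \<in> circ (mtopology_of X) (ziter (mtopology_of X) T) p B"
    unfolding circ_def
  proof (intro CollectI conjI allI impI cX)
    fix V assume V: "openin (mtopology_of X) V \<and> c \<in> V"
    then have o: "openin (mtopology_of X) V" "c \<in> V" by auto
    from openin_mtopology_of_ex[OF o]
    obtain r where r: "r > 0" "\<forall>y\<in>mspace X. mdist X c y < r \<longrightarrow> y \<in> V"
      by (elim exE conjE)
    from ev[OF r(1)] show "\<forall>\<^sub>F n in p. ziter (mtopology_of X) T n ` B \<inter> V \<noteq> {}"
    proof eventually_elim
      case (elim n)
      then obtain a where a: "a \<in> ?B" "mdist X c (ziter (mtopology_of X) T n a) < r"
        using c by auto
      have aX: "a \<in> topspace (mtopology_of X)" using a(1) by (simp add: in_closure_of)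
      then have "ziter (mtopology_of X) T n a \<in> V"
        using T_in[OF aX, of n] r(2) a(2) by simp
      then have "a \<in> {x \<in> topspace (mtopology_of X). ziter (mtopology_of X) T n x \<in> V}"
        using aX by blast
      moreover have "openin (mtopology_of X) {x \<in> topspace (mtopology_of X). ziter (mtopology_of X) T n x \<in> V}"
        using V by (intro openin_T_preimage) auto
      ultimately have "\<exists>b\<in>B. b \<in> {x \<in> topspace (mtopology_of X). ziter (mtopology_of X) T n x \<in> V}"
        by (intro closure_ofD[OF a(1)])
      then show ?case by auto
    qed
  qed
qed

lemma beta_act_pact: "beta_act X T p x = pact X (ziter X T) p x"
  by (simp add: beta_act_def pact_def)

lemma RIC_map_nonempty:
  assumes "RIC_map X T Y S \<pi>"
  shows "mspace X \<noteq> {}"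
proof -
  obtain y0 where "y0 \<in> mspace Y" and "\<pi> ` mspace X = mspace Y"
    using assms by (auto simp: RIC_map_def factor_map_def)
  then show ?thesis by auto
qed

lemma ric_ext_RIC_map:
  assumes R: "RIC_map X T Y S \<pi>" and min: "minimal_tds (mtopology_of X) T"
  shows "ric_ext (mtopology_of X) (ziter (mtopology_of X) T) (mtopology_of Y) (ziter (mtopology_of Y) S) \<pi>"
proof -
  have f: "factor_map (mtopology_of X) T (mtopology_of Y) S \<pi>"
    using R by (simp add: RIC_map_def)
  interpret flow_hom "mtopology_of X" "ziter (mtopology_of X) T" "mtopology_of Y" "ziter (mtopology_of Y) S" \<pi>
    by (rule flow_hom_factor_map[OF f])
  have minX: "minimal_flow (mtopology_of X) (ziter (mtopology_of X) T)"
    using minimal_flow_minimal_tds[OF min] RIC_map_nonempty[OF R] by simp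
  obtain M u y0 where M: "minimal_left_ideal M" "u \<in> M" "beta_mult u u = u"
    and y0: "y0 \<in> mspace Y" "beta_act (mtopology_of Y) S u y0 = y0"
    and lim: "\<And>p. p \<in> M \<Longrightarrow> circ_limit X T p (beta_act (mtopology_of X) T u ` fibre X \<pi> y0)
           (fibre X \<pi> (beta_act (mtopology_of Y) S p y0))"
    using R by (auto simp: RIC_map_def)
  have u: "ultra u" using minid_of_minimal_left_ideal(5)[OF M M(2)] .
  have "ric (mtopology_of X) (ziter (mtopology_of X) T) (mtopology_of Y) (ziter (mtopology_of Y) S) \<pi>"
  proof (rule ric_of_minimal_left_ideal[OF flow_hom_axioms minimal_flow_image[OF minX] M])
    show "y0 \<in> topspace (mtopology_of Y)" using y0 by simp
    show "pact (mtopology_of Y) (ziter (mtopology_of Y) S) u y0 = y0"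
      using y0 by (simp add: beta_act_pact)
    fix p assume p: "p \<in> M"
    have tX: "tds (mtopology_of X) T" using f by (simp add: factor_map_def)
    have "beta_act (mtopology_of X) T u ` fibre X \<pi> y0 \<subseteq> mspace X"
      using X.pact_in[OF u] by (auto simp: fibre_def beta_act_pact)
    from circ_limit_subset[OF tX lim[OF p] this]
    show "{x \<in> topspace (mtopology_of X). \<pi> x = pact (mtopology_of Y) (ziter (mtopology_of Y) S) p y0}
      \<subseteq> circ (mtopology_of X) (ziter (mtopology_of X) T) p
          (pact (mtopology_of X) (ziter (mtopology_of X) T) u ` {x \<in> topspace (mtopology_of X). \<pi> x = y0})"
      by (simp add: fibre_def beta_act_pact)
  qed
  then show ?thesis
    using flow_hom_axioms minX by (simp add: ric_ext_def ric_ext_axioms_def)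
qed

lemma RIC_map_minid: "RIC_map X T Y S \<pi> \<Longrightarrow> \<exists>u. minid u"
  unfolding RIC_map_def using minid_of_minimal_left_ideal(1) by blast

lemma regprox_of_rel_reg_proximal:
  assumes "(x, x') \<in> rel_reg_proximal X T \<pi>"
  shows "regprox (mtopology_of X) (ziter (mtopology_of X) T) \<pi> x x'"
proof -
  let ?X = "mtopology_of X" and ?T = "ziter (mtopology_of X) T"
  obtain xs ys n z where s: "\<And>i. (xs i, ys i) \<in> fibre_rel X \<pi>"
    "limitin ?X xs x sequentially" "limitin ?X ys x' sequentially"
    "limitin ?X (\<lambda>i. ?T (n i) (xs i)) z sequentially"
    "limitin ?X (\<lambda>i. ?T (n i) (ys i)) z sequentially"
    using assms by (auto simp: rel_reg_proximal_def)
  show ?thesis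
    unfolding regprox_def
  proof (rule bexI[of _ z], intro allI impI)
    fix U U' W assume A: "openin ?X U \<and> openin ?X U' \<and> openin ?X W \<and> x \<in> U \<and> x' \<in> U' \<and> z \<in> W"
    have "\<forall>\<^sub>F i in sequentially. xs i \<in> U \<and> ys i \<in> U' \<and> ?T (n i) (xs i) \<in> W \<and> ?T (n i) (ys i) \<in> W"
      using A by (intro eventually_conj limitinD[OF s(2)] limitinD[OF s(3)] limitinD[OF s(4)] limitinD[OF s(5)]) auto
    then obtain i where "xs i \<in> U" "ys i \<in> U'" "?T (n i) (xs i) \<in> W" "?T (n i) (ys i) \<in> W"
      using eventually_happens' sequentially_bot by blast
    moreover have "\<pi> (xs i) = \<pi> (ys i)" using s(1)[of i] by (simp add: fibre_rel_def)
    ultimately show "\<exists>a\<in>U. \<exists>a'\<in>U'. \<exists>n. \<pi> a = \<pi> a' \<and> ?T n a \<in> W \<and> ?T n a' \<in> W"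
      by blast
  next
    show "z \<in> topspace ?X" using s(4) by (rule limitin_topspace)
  qed
qed

text \<open>Some \<open>p\<close> identifies the two proximal points. Minimality gives
  \<open>g\<close> such that the product of \<open>g\<close>, \<open>p\<close> and \<open>v\<close>
  is \<open>v\<close>, so \<open>p\<close> is injective on points fixed by \<open>v\<close>.\<close>

lemma proximal_map_inj_fixed:
  assumes prox: "proximal_map X T Y S \<pi>" and v: "minid v"
    and x: "x \<in> mspace X" "pact (mtopology_of X) (ziter (mtopology_of X) T) v x = x"
    and x': "x' \<in> mspace X" "pact (mtopology_of X) (ziter (mtopology_of X) T) v x' = x'"
    and eq: "\<pi> x = \<pi> x'"
  shows "x = x'"
proof -
  let ?X = "mtopology_of X" and ?T = "ziter (mtopology_of X) T"
  have "tds ?X T" using prox by (simp add: proximal_map_def factor_map_def)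
  then interpret cflow ?X ?T by (rule cflow_tds)
  note vD = minidD[OF v]
  have xX: "x \<in> topspace ?X" "x' \<in> topspace ?X" using x x' by auto
  have inf: "(INF n. mdist X (?T n x) (?T n x')) = 0"
    using prox x x' eq by (auto simp: proximal_map_def fibre_rel_def)
  have near: "\<exists>n. mdist X (?T n x) (?T n x') < e" if "e > 0" for e
  proof (rule ccontr)
    assume "\<not> ?thesis"
    then have "e \<le> (INF n. mdist X (?T n x) (?T n x'))"
      by (intro cINF_greatest) (auto simp: not_less)
    with inf that show False by simp
  qed
  have "\<exists>p. ultra p \<and> (\<forall>e\<in>{0<..}. \<forall>\<^sub>F n in p. mdist X (?T n x) (?T n x') < e)"
  proof (rule ultra_directed)
    show "\<exists>c\<in>{0<..}. \<forall>n. mdist X (?T n x) (?T n x') < c \<longrightarrow>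
        mdist X (?T n x) (?T n x') < a \<and> mdist X (?T n x) (?T n x') < b"
      if "a \<in> {0<..}" "b \<in> {0<..}" for a b :: real
      using that by (intro bexI[of _ "min a b"]) auto
  qed (use near in auto)
  then obtain p where p: "ultra p" "\<And>e. e > 0 \<Longrightarrow> \<forall>\<^sub>F n in p. mdist X (?T n x) (?T n x') < e"
    by auto
  let ?a = "pact ?X ?T p x" and ?a' = "pact ?X ?T p x'"
  have aX: "?a \<in> mspace X" "?a' \<in> mspace X" using pact_in[OF p(1)] xX by auto
  have "?a = ?a'"
  proof (rule ccontr)
    assume "?a \<noteq> ?a'"
    then have d: "mdist X ?a ?a' / 3 > 0" using aX by (simp add: less_le)
    have self: "mdist X ?a ?a = 0" "mdist X ?a' ?a' = 0"
      using aX by (simp_all only: mdist_zero)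
    \<comment> \<open>A third of the distance, because two limits and one proximity estimate are
      added.\<close>
    define e where "e = mdist X ?a ?a' / 3"
    have "\<forall>\<^sub>F n in p. ?T n x \<in> {z \<in> mspace X. mdist X ?a z < e}"
      using p(1) xX d aX by (intro pactD openin_mtopology_of_ball) (auto simp: e_def self)
    moreover have "\<forall>\<^sub>F n in p. ?T n x' \<in> {z \<in> mspace X. mdist X ?a' z < e}"
      using p(1) xX d aX by (intro pactD openin_mtopology_of_ball) (auto simp: e_def self)
    moreover have "\<forall>\<^sub>F n in p. mdist X (?T n x) (?T n x') < e"
      using d by (intro p(2)) (simp add: e_def)
    ultimately have "\<forall>\<^sub>F n in p. False"
    proof eventually_elim
      case (elim n)
      have "mdist X ?a ?a' \<le> mdist X ?a (?T n x) + (mdist X (?T n x) (?T n x') + mdist X (?T n x') ?a')"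
        using elim aX mdist_triangle[of ?a X "?T n x" ?a'] mdist_triangle[of "?T n x" X "?T n x'" ?a']
        by auto
      then show ?case
        using elim by (simp add: e_def mdist_commute)
    qed
    then show False using ultra_ex[OF p(1)] by blast
  qed
  moreover obtain g where g: "ultra g" "bmul (bmul g p) v = v"
    using vD(4)[OF p(1)] by blast
  have "z = pact ?X ?T g (pact ?X ?T p z)" if "z \<in> topspace ?X" "pact ?X ?T v z = z" for z
  proof -
    have "z = pact ?X ?T (bmul (bmul g p) v) z" using g that by simp
    also have "\<dots> = pact ?X ?T g (pact ?X ?T p z)"
      using g(1) p(1) vD(1) that by (simp add: pact_bmul ultra_bmul pact_in)
    finally show ?thesis .
  qed
  ultimately show ?thesis
    using xX x(2) x'(2) by metis
qed

section \<open>Composition of homomorphisms and images of limit sets\<close>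

lemma flow_hom_id: "cflow X T \<Longrightarrow> flow_hom X T X T id"
  by (simp add: flow_hom_def flow_hom_axioms_def)

lemma flow_hom_compose:
  assumes "flow_hom X T Y S f" "flow_hom Y S Z R g"
  shows "flow_hom X T Z R (g \<circ> f)"
proof -
  interpret f: flow_hom X T Y S f by fact
  interpret g: flow_hom Y S Z R g by fact
  show ?thesis
  proof
    show "continuous_map X Z (g \<circ> f)"
      using f.cont_hom g.cont_hom by (rule continuous_map_compose)
    show "(g \<circ> f) ` topspace X = topspace Z"
      using f.onto g.onto by (metis image_comp)
    show "(g \<circ> f) (T k x) = R k ((g \<circ> f) x)" if "x \<in> topspace X" for x k
      using that by (simp add: f.equi g.equi f.hom_in)
  qed
qed

lemma (in cflow) closedin_circ: "closedin X (circ X T p A)"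
proof -
  have "X closure_of circ X T p A \<subseteq> circ X T p A"
  proof
    fix y assume y: "y \<in> X closure_of circ X T p A"
    show "y \<in> circ X T p A"
      unfolding circ_def
    proof (intro CollectI conjI allI impI)
      show "y \<in> topspace X" using y by (simp add: in_closure_of)
      fix V assume V: "openin X V \<and> y \<in> V"
      then obtain z where "z \<in> circ X T p A" "z \<in> V" using closure_ofD[OF y] by blast
      then show "\<forall>\<^sub>F n in p. T n ` A \<inter> V \<noteq> {}" using V by (auto dest: circD)
    qed
  qed
  then show ?thesis
    by (simp add: closure_of_subset_eq[symmetric] circ_subset_topspace)
qed

text \<open>The reverse of \<open>hom_circ\<close>, from compactness: a point outside the compact
  image has a closed neighbourhood disjoint from it, yet \<open>circ_meets\<close> makes the limit
  set upstairs meet the preimage of that neighbourhood.\<close>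

lemma (in flow_hom) circ_image:
  assumes p: "ultra p" and A: "A \<subseteq> topspace X"
  shows "circ Y S p (\<pi> ` A) \<subseteq> \<pi> ` circ X T p A"
proof
  fix z assume z: "z \<in> circ Y S p (\<pi> ` A)"
  show "z \<in> \<pi> ` circ X T p A"
  proof (rule ccontr)
    assume nz: "z \<notin> \<pi> ` circ X T p A"
    have "compactin X (circ X T p A)"
      by (rule closedin_compact_space[OF X.comp X.closedin_circ])
    then have "compactin Y (\<pi> ` circ X T p A)"
      by (rule image_compactin[OF _ cont_hom])
    then have "closedin Y (\<pi> ` circ X T p A)"
      by (rule compactin_imp_closedin[OF Y.haus])
    then have o: "openin Y (topspace Y - \<pi> ` circ X T p A)" by blast
    have zo: "z \<in> topspace Y - \<pi> ` circ X T p A" using nz circ_in[OF z] by blast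
    have "neighbourhood_base_of (closedin Y) Y"
      using compact_Hausdorff_imp_regular_space Y.comp Y.haus by (simp add: neighbourhood_base_of_closedin)
    from this[unfolded neighbourhood_base_of, rule_format, OF conjI, OF o zo]
    obtain U C where UC: "openin Y U" "closedin Y C" "z \<in> U" "U \<subseteq> C" "C \<subseteq> topspace Y - \<pi> ` circ X T p A"
      by (elim exE conjE)
    have "\<forall>\<^sub>F n in p. S n ` (\<pi> ` A) \<inter> U \<noteq> {}" using circD[OF z UC(1,3)] .
    then have "\<forall>\<^sub>F n in p. T n ` A \<inter> {x \<in> topspace X. \<pi> x \<in> C} \<noteq> {}"
    proof eventually_elim
      case (elim n)
      then obtain a where a: "a \<in> A" "S n (\<pi> a) \<in> U" by blast
      then have "a \<in> topspace X" using A by blast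
      then have "T n a \<in> {x \<in> topspace X. \<pi> x \<in> C}"
        using a(2) UC(4) X.T_in by (auto simp: equi)
      with a(1) show ?case by blast
    qed
    from X.circ_meets[OF p A this closedin_continuous_map_preimage[OF cont_hom UC(2)]]
    show False using UC(5) by blast
  qed
qed

section \<open>The maps from the top of a complete tower\<close>

context complete_canonical_tower
begin

abbreviation "XT m \<equiv> mtopology_of (XX m)"
abbreviation "XF m \<equiv> ziter (XT m) (TX m)"
abbreviation "YT m \<equiv> mtopology_of (YY m)"
abbreviation "YF m \<equiv> ziter (YT m) (TY m)"

definition "h m = tower_proj \<theta>' m (n - m)"

text \<open>The induced map from \<open>XX n\<close> to \<open>YY m\<close>. Completeness says that
  it is RIC for \<open>m < n\<close>; for \<open>m = n\<close> it is
  \<open>\<pi>m n\<close>.\<close>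

definition "q m = \<pi>m m \<circ> h m"

lemma tower_proj_Suc: "tower_proj \<theta>' m (Suc j) = \<theta>' (Suc m) \<circ> tower_proj \<theta>' (Suc m) j"
  by (induction j) (auto simp: fun_eq_iff)

lemma h_n [simp]: "h n = id"
  by (simp add: h_def)

lemma h_step: "m < n \<Longrightarrow> h m = \<theta>' (Suc m) \<circ> h (Suc m)"
  unfolding h_def by (metis Suc_diff_Suc tower_proj_Suc)

text \<open>Proximal maps are injective on the fixed points of a minimal idempotent, and
  homomorphisms preserve fixed points, so injectivity passes down the composition.\<close>

lemma h_hom_inj:
  assumes "m \<le> n"
  shows "flow_hom (XT n) (XF n) (XT m) (XF m) (h m) \<and>
    (\<forall>v x x'. minid v \<longrightarrow> x \<in> mspace (XX n) \<longrightarrow> x' \<in> mspace (XX n) \<longrightarrow> pact (XT n) (XF n) v x = x \<longrightarrow>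
      pact (XT n) (XF n) v x' = x' \<longrightarrow> h m x = h m x' \<longrightarrow> x = x')"
  using assms
proof (induction rule: inc_induct)
  case base
  have "tds (XT n) (TX n)" using minimal_XX[of n] by (simp add: minimal_tds_def)
  from flow_hom_id[OF cflow_tds[OF this]] show ?case by (simp add: id_def)
next
  case (step m)
  have prox: "proximal_map (XX (Suc m)) (TX (Suc m)) (XX m) (TX m) (\<theta>' (Suc m))"
    using proximal_\<theta>' step.hyps by simp
  have hom: "flow_hom (XT n) (XF n) (XT (Suc m)) (XF (Suc m)) (h (Suc m))" using step.IH by blast
  interpret h: flow_hom "XT n" "XF n" "XT (Suc m)" "XF (Suc m)" "h (Suc m)" by fact
  have "flow_hom (XT (Suc m)) (XF (Suc m)) (XT m) (XF m) (\<theta>' (Suc m))"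
    using prox by (intro flow_hom_factor_map) (simp add: proximal_map_def)
  from flow_hom_compose[OF hom this]
  have 1: "flow_hom (XT n) (XF n) (XT m) (XF m) (h m)"
    using step.hyps by (simp add: h_step)
  have "x = x'" if v: "minid v" and x: "x \<in> mspace (XX n)" "x' \<in> mspace (XX n)"
      "pact (XT n) (XF n) v x = x" "pact (XT n) (XF n) v x' = x'" and eq: "h m x = h m x'" for v x x'
  proof -
    have "h (Suc m) x = h (Suc m) x'"
    proof (rule proximal_map_inj_fixed[OF prox v])
      show "h (Suc m) x \<in> mspace (XX (Suc m))" "h (Suc m) x' \<in> mspace (XX (Suc m))"
        using h.hom_in x(1,2) by simp_all
      show "pact (XT (Suc m)) (XF (Suc m)) v (h (Suc m) x) = h (Suc m) x"
        "pact (XT (Suc m)) (XF (Suc m)) v (h (Suc m) x') = h (Suc m) x'"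
        using h.hom_pact[OF minidD(1)[OF v], of x] h.hom_pact[OF minidD(1)[OF v], of x'] x by simp_all
      show "\<theta>' (Suc m) (h (Suc m) x) = \<theta>' (Suc m) (h (Suc m) x')"
        using eq step.hyps by (simp add: h_step)
    qed
    then show ?thesis using step.IH v x by blast
  qed
  with 1 show ?case by blast
qed

lemma q_ric:
  assumes "m \<le> n"
  shows "ric_ext (XT n) (XF n) (YT m) (YF m) (q m)"
proof (rule ric_ext_RIC_map[OF _ minimal_XX[OF order_refl]])
  show "RIC_map (XX n) (TX n) (YY m) (TY m) (q m)"
  proof (cases "m = n")
    case True
    then show ?thesis using RIC[of n] by (simp add: q_def)
  next
    case False
    then show ?thesis using complete[of m] assms by (simp add: q_def h_def)
  qed
qed

lemma q_open:
  assumes "m \<le> n" "minid v" "openin (XT n) V"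
  shows "openin (XT n) {x \<in> topspace (XT n). \<exists>x'\<in>V. q m x = q m x'}"
proof -
  interpret ric_ext "XT n" "XF n" "YT m" "YF m" "q m" by (rule q_ric[OF assms(1)])
  have "openin (XT n) {x \<in> topspace (XT n). q m x \<in> q m ` V}"
    by (rule openin_continuous_map_preimage[OF cont_hom open_map[OF assms(2,3)]])
  then show ?thesis by (simp add: image_iff)
qed

lemma \<sigma>_h:
  assumes "m < n" "x \<in> mspace (XX n)"
  shows "\<sigma> (Suc m) (h m x) = \<theta> (Suc m) (q (Suc m) x)"
proof -
  interpret h: flow_hom "XT n" "XF n" "XT (Suc m)" "XF (Suc m)" "h (Suc m)"
    using h_hom_inj[of "Suc m"] assms(1) by simp
  have "h (Suc m) x \<in> mspace (XX (Suc m))" using h.hom_in assms(2) by simp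
  then show ?thesis
    using commute_step[OF assms(1)] assms(1) by (simp add: h_step q_def)
qed

lemma h_in: "m \<le> n \<Longrightarrow> x \<in> mspace (XX n) \<Longrightarrow> h m x \<in> mspace (XX m)"
  using flow_hom.hom_in[of "XT n" "XF n" "XT m" "XF m" "h m"] h_hom_inj[of m] by simp

text \<open>\<open>q (Suc m)\<close> determines the image in \<open>ZZ (Suc m)\<close> through
  \<open>\<theta>\<close>. From there \<open>\<rho>\<close> leads to \<open>YY m\<close>, while the
  kernel of \<open>\<sigma>\<close> is regional proximality.\<close>

lemma q_refines:
  assumes m: "m < n" and x: "x \<in> mspace (XX n)" "x' \<in> mspace (XX n)" and eq: "q (Suc m) x = q (Suc m) x'"
  shows "q m x = q m x'" and "(h m x, h m x') \<in> rel_reg_proximal (XX m) (TX m) (\<pi>m m)"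
proof -
  have 1: "\<sigma> (Suc m) (h m x) = \<sigma> (Suc m) (h m x')"
    using m x eq by (simp add: \<sigma>_h)
  have in': "h m x \<in> mspace (XX m)" "h m x' \<in> mspace (XX m)"
    using h_in m x by simp_all
  then show "q m x = q m x'"
    using commute_level[OF m] 1 by (metis comp_apply q_def)
  show "(h m x, h m x') \<in> rel_reg_proximal (XX m) (TX m) (\<pi>m m)"
    using 1 in' unfolding quotient[OF m, symmetric] by (simp add: fibre_rel_def)
qed

lemma q_fibre:
  assumes m: "m \<le> n" and v: "minid v" and x: "x \<in> topspace (XT n)" "pact (XT n) (XF n) v x = x"
    and x': "x' \<in> topspace (XT n)" "q m x' = q m x"
  shows "x' \<in> circ (XT n) (XF n) v (fixed_fibre (XT n) (XF n) (q m) v (q m x))"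
proof -
  interpret ric_ext "XT n" "XF n" "YT m" "YF m" "q m" by (rule q_ric[OF m])
  have y: "q m x \<in> topspace (YT m)" using hom_in x by blast
  have "x' \<in> circ (XT n) (XF n) (bmul (principal {0}) v) (fixed_fibre (XT n) (XF n) (q m) v (q m x))"
  proof (rule RIC_D[OF v y _ ultra_principal x'(1)])
    show "pact (YT m) (YF m) v (q m x) = q m x"
      using hom_pact[OF minidD(1)[OF v] x(1)] x by simp
    show "q m x' = pact (YT m) (YF m) (principal {0}) (q m x)"
      using Y.pact_principal[OF y] x' by simp
  qed
  then show ?thesis by simp
qed

text \<open>Regional proximality is known in \<open>XX m\<close>, but the conclusion is wanted in
  \<open>XX n\<close>. Between the fixed points over \<open>y\<close> in the two systems
  \<open>h m\<close> is a bijection that respects limit sets both ways, so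
  \<open>regprox_in_closure\<close> is applied below and its conclusion lifted.\<close>

lemma q_key:
  assumes m: "m < n" and v: "minid v"
    and K: "K \<subseteq> FF" "FF \<inter> circ (XT n) (XF n) v K \<subseteq> K"
    and x: "x \<in> FF" "x \<notin> K" and x': "x' \<in> FF" and eq: "q (Suc m) x = q (Suc m) x'"
    and FF: "FF = fixed_fibre (XT n) (XF n) (q m) v y"
  shows "x' \<in> circ (XT n) (XF n) v (FF - K)"
proof -
  note vD = minidD[OF v]
  interpret q: ric_ext "XT n" "XF n" "YT m" "YF m" "q m" using q_ric m by simp
  interpret h: flow_hom "XT n" "XF n" "XT m" "XF m" "h m" using h_hom_inj[of m] m by simp
  have FFD: "b \<in> topspace (XT n)" "q m b = y" "pact (XT n) (XF n) v b = b" if "b \<in> FF" for b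
    using that by (auto simp: FF fixed_fibre_def)
  have FFI: "b \<in> FF" if "b \<in> topspace (XT n)" "q m b = y" "pact (XT n) (XF n) v b = b" for b
    using that by (auto simp: FF fixed_fibre_def)
  have FX: "FF \<subseteq> topspace (XT n)" using FFD(1) by blast
  have y: "y \<in> topspace (YT m)" using q.hom_in[OF FFD(1)[OF x(1)]] FFD(2)[OF x(1)] by simp
  have vy: "pact (YT m) (YF m) v y = y"
    using q.hom_pact[OF vD(1) FFD(1)[OF x(1)]] FFD(2,3)[OF x(1)] by simp
  interpret p: ric_base "XT m" "XF m" "YT m" "YF m" "\<pi>m m" v y
  proof -
    interpret ric_ext "XT m" "XF m" "YT m" "YF m" "\<pi>m m"
      using m by (intro ric_ext_RIC_map RIC minimal_XX) simp_all
    show "ric_base (XT m) (XF m) (YT m) (YF m) (\<pi>m m) v y"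
      by unfold_locales (rule v y vy)+
  qed
  have inj: "b = b'" if "b \<in> FF" "b' \<in> FF" "h m b = h m b'" for b b'
    using h_hom_inj[of m] m that FFD v by auto
  have h_FF: "h m b \<in> p.F" if "b \<in> FF" for b
  proof (rule p.F_I)
    show "h m b \<in> topspace (XT m)" using h.hom_in FFD(1)[OF that] .
    show "\<pi>m m (h m b) = y" using FFD(2)[OF that] by (simp add: q_def)
    show "pact (XT m) (XF m) v (h m b) = h m b"
      using h.hom_pact[OF vD(1) FFD(1)[OF that]] FFD(3)[OF that] by simp
  qed
  \<comment> \<open>Compactness lifts \<open>z\<close> to a point of the limit set of
    \<open>B\<close>; applying \<open>v\<close> makes the lift a fixed point without changing its
    image.\<close>
  have retract: "\<exists>b\<in>FF. b \<in> circ (XT n) (XF n) v B \<and> h m b = z"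
    if B: "B \<subseteq> FF" and z: "z \<in> p.F" "z \<in> circ (XT m) (XF m) v (h m ` B)" for B z
  proof -
    have BX: "B \<subseteq> topspace (XT n)" using B FX by blast
    obtain b where b: "b \<in> circ (XT n) (XF n) v B" "h m b = z"
      using h.circ_image[OF vD(1) BX] z(2) by blast
    have bX: "b \<in> topspace (XT n)" using b(1) by (rule circ_in)
    let ?b = "pact (XT n) (XF n) v b"
    have "?b \<in> circ (XT n) (XF n) v (circ (XT n) (XF n) v B)"
      using vD(1) bX b(1) by (rule q.X.pact_in_circ)
    then have 1: "?b \<in> circ (XT n) (XF n) v B"
      using q.X.circ_circ[OF BX, of v v] vD(2) by auto
    have 2: "h m ?b = z"
      using h.hom_pact[OF vD(1) bX] b(2) p.F_D(2)[OF z(1)] by simp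
    have "?b \<in> FF"
    proof (rule FFI)
      show "?b \<in> topspace (XT n)" using q.X.pact_in vD(1) bX .
      show "q m ?b = y" using 2 p.F_D(1)[OF z(1)] by (simp add: q_def)
      show "pact (XT n) (XF n) v ?b = ?b"
        using q.X.pact_bmul[OF vD(1) vD(1) bX] vD(2) by simp
    qed
    with 1 2 show ?thesis by blast
  qed
  have KX: "h m ` K \<subseteq> p.F" "p.F \<inter> circ (XT m) (XF m) v (h m ` K) \<subseteq> h m ` K"
  proof -
    show "h m ` K \<subseteq> p.F" using K(1) h_FF by blast
    show "p.F \<inter> circ (XT m) (XF m) v (h m ` K) \<subseteq> h m ` K"
    proof
      fix z assume z: "z \<in> p.F \<inter> circ (XT m) (XF m) v (h m ` K)"
      then obtain b where "b \<in> FF" "b \<in> circ (XT n) (XF n) v K" "h m b = z"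
        using retract[OF K(1)] by blast
      then show "z \<in> h m ` K" using K(2) by blast
    qed
  qed
  have hx: "h m x \<notin> h m ` K" using inj K(1) x by blast
  have "(h m x, h m x') \<in> rel_reg_proximal (XX m) (TX m) (\<pi>m m)"
    using q_refines(2)[OF m _ _ eq] FFD(1)[OF x(1)] FFD(1)[OF x'] by simp
  then have rp: "regprox (XT m) (XF m) (\<pi>m m) (h m x) (h m x')"
    by (rule regprox_of_rel_reg_proximal)
  have "h m x' \<in> circ (XT m) (XF m) v (p.F - h m ` K)"
    using p.regprox_in_closure[OF KX h_FF[OF x(1)] hx h_FF[OF x'] rp] .
  moreover have "p.F - h m ` K \<subseteq> h m ` (FF - K)"
  proof
    fix z assume z: "z \<in> p.F - h m ` K"
    then have "z \<in> h m ` topspace (XT n)" using h.onto p.F_D(3) by blast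
    then obtain b where b: "b \<in> topspace (XT n)" "h m b = z" by blast
    let ?b = "pact (XT n) (XF n) v b"
    have 2: "h m ?b = z"
      using h.hom_pact[OF vD(1) b(1)] b(2) p.F_D(2)[of z] z by simp
    have "?b \<in> FF"
    proof (rule FFI)
      show "?b \<in> topspace (XT n)" using q.X.pact_in vD(1) b(1) .
      show "q m ?b = y" using 2 p.F_D(1)[of z] z by (simp add: q_def)
      show "pact (XT n) (XF n) v ?b = ?b"
        using q.X.pact_bmul[OF vD(1) vD(1) b(1)] vD(2) by simp
    qed
    with 2 z show "z \<in> h m ` (FF - K)" by blast
  qed
  ultimately have "h m x' \<in> circ (XT m) (XF m) v (h m ` (FF - K))"
    using circ_mono by blast
  then obtain b where "b \<in> FF" "b \<in> circ (XT n) (XF n) v (FF - K)" "h m b = h m x'"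
    using retract[of "FF - K"] h_FF[OF x'] by blast
  then show ?thesis using inj x' by blast
qed

end

section \<open>Products of flows\<close>

locale prodflow =
  fixes J :: "'j set" and X :: "'j \<Rightarrow> 'a topology" and T :: "'j \<Rightarrow> int \<Rightarrow> 'a \<Rightarrow> 'a"
  assumes finJ: "finite J" and flow: "\<And>a. a \<in> J \<Longrightarrow> cflow (X a) (T a)"
begin

definition "P = product_topology X J"

text \<open>The exponent may depend freely on the coordinate, so the motion \<open>\<tau>\<close>,
  the separate transformations and their products are all of this form.\<close>

definition mv :: "('j \<Rightarrow> int) \<Rightarrow> ('j \<Rightarrow> 'a) \<Rightarrow> 'j \<Rightarrow> 'a" where
  "mv f \<xi> = (\<lambda>a\<in>J. T a (f a) (\<xi> a))"

lemma P_I: "\<xi> \<in> extensional J \<Longrightarrow> (\<And>a. a \<in> J \<Longrightarrow> \<xi> a \<in> topspace (X a)) \<Longrightarrow> \<xi> \<in> topspace P"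
  by (auto simp: P_def topspace_product_topology PiE_iff)

lemma P_D: "\<xi> \<in> topspace P \<Longrightarrow> \<xi> \<in> extensional J" "\<xi> \<in> topspace P \<Longrightarrow> a \<in> J \<Longrightarrow> \<xi> a \<in> topspace (X a)"
  by (auto simp: P_def topspace_product_topology PiE_iff)

lemma P_upd: "\<xi> \<in> topspace P \<Longrightarrow> a \<in> J \<Longrightarrow> b \<in> topspace (X a) \<Longrightarrow> \<xi>(a := b) \<in> topspace P"
  by (auto simp: P_def topspace_product_topology PiE_iff extensional_def)

lemma mv_apply: "a \<in> J \<Longrightarrow> mv f \<xi> a = T a (f a) (\<xi> a)"
  by (simp add: mv_def)

lemma mv_in: "\<xi> \<in> topspace P \<Longrightarrow> mv f \<xi> \<in> topspace P"
  using cflow.T_in[OF flow] by (intro P_I) (auto simp: mv_def P_D)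

lemma mv_0: "\<xi> \<in> topspace P \<Longrightarrow> mv (\<lambda>a. 0) \<xi> = \<xi>"
  by (rule extensionalityI[of _ J]) (auto simp: mv_def P_D cflow.T_0[OF flow])

lemma mv_add: "\<xi> \<in> topspace P \<Longrightarrow> mv (\<lambda>a. f a + g a) \<xi> = mv f (mv g \<xi>)"
  by (rule extensionalityI[of _ J]) (auto simp: mv_def P_D cflow.T_add[OF flow])

lemma mv_neg: "\<xi> \<in> topspace P \<Longrightarrow> mv (\<lambda>a. - f a) (mv f \<xi>) = \<xi>" "\<xi> \<in> topspace P \<Longrightarrow> mv f (mv (\<lambda>a. - f a) \<xi>) = \<xi>"
  using mv_add[of \<xi> "\<lambda>a. - f a" f] mv_add[of \<xi> f "\<lambda>a. - f a"] mv_0[of \<xi>] by simp_all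

lemma mv_commute: "\<xi> \<in> topspace P \<Longrightarrow> mv f (mv g \<xi>) = mv g (mv f \<xi>)"
  using mv_add[of \<xi> f g] mv_add[of \<xi> g f] by (simp add: add.commute)

lemma mv_upd: "a \<in> J \<Longrightarrow> mv f (\<xi>(a := b)) = (mv f \<xi>)(a := T a (f a) b)"
  by (auto simp: mv_def fun_eq_iff)

lemma continuous_map_mv: "continuous_map P P (mv f)"
proof -
  have "continuous_map P (X a) (\<lambda>\<xi>. T a (f a) (\<xi> a))" if "a \<in> J" for a
    using continuous_map_compose[OF continuous_map_product_projection[OF that, of X] cflow.cont[OF flow[OF that]]]
    by (simp add: P_def o_def)
  then show ?thesis
    unfolding P_def mv_def by (auto simp: continuous_map_componentwise P_def)
qed

lemma cflow_mv:
  assumes "\<And>g h. \<phi> (g + h) = (\<lambda>a. \<phi> g a + \<phi> h a)"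
  shows "cflow P (\<lambda>g :: 'g::ab_group_add. mv (\<phi> g))"
proof
  show "compact_space P"
    unfolding P_def using cflow.comp[OF flow] by (simp add: compact_space_product_topology)
  show "Hausdorff_space P"
    unfolding P_def using cflow.haus[OF flow] by (simp add: Hausdorff_space_product_topology)
  show "continuous_map P P (mv (\<phi> g))" for g by (rule continuous_map_mv)
  have "\<phi> 0 = (\<lambda>a. 0)"
    using assms[of 0 0] by (metis add_0 add_cancel_right_right)
  then show "mv (\<phi> 0) \<xi> = \<xi>" if "\<xi> \<in> topspace P" for \<xi>
    using mv_0[OF that] by simp
  show "mv (\<phi> (g + h)) \<xi> = mv (\<phi> g) (mv (\<phi> h) \<xi>)" if "\<xi> \<in> topspace P" for g h \<xi>
    using mv_add[OF that] assms by simp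
qed

lemma openin_box:
  assumes "\<And>a. a \<in> J \<Longrightarrow> openin (X a) (B a)"
  shows "openin P {\<eta> \<in> topspace P. \<forall>a\<in>J. \<eta> a \<in> B a}"
proof -
  have "{\<eta> \<in> topspace P. \<forall>a\<in>J. \<eta> a \<in> B a} = PiE J B"
    using openin_subset[OF assms] by (auto simp: P_def topspace_product_topology PiE_iff extensional_def)
  then show ?thesis
    using assms finJ by (simp add: P_def openin_PiE)
qed

lemma box_ex:
  assumes "openin P W" "\<xi> \<in> W"
  shows "\<exists>B. (\<forall>a\<in>J. openin (X a) (B a) \<and> \<xi> a \<in> B a) \<and> (\<forall>\<eta>\<in>topspace P. (\<forall>a\<in>J. \<eta> a \<in> B a) \<longrightarrow> \<eta> \<in> W)"
proof -
  obtain B where "\<forall>a\<in>J. openin (X a) (B a)" "\<xi> \<in> PiE J B" "PiE J B \<subseteq> W"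
    using assms unfolding P_def openin_product_topology_alt by meson
  then show ?thesis
    by (intro exI[of _ B]) (auto simp: P_def topspace_product_topology PiE_iff subset_iff)
qed

lemma limitin_P:
  assumes "\<xi> \<in> topspace P" "\<And>n. f n \<in> topspace P" "\<And>a. a \<in> J \<Longrightarrow> limitin (X a) (\<lambda>n. f n a) (\<xi> a) F"
  shows "limitin P f \<xi> F"
  using assms P_D(1)[OF assms(1)] by (auto simp: P_def limitin_componentwise)

text \<open>Each coordinate sees only the image of \<open>p\<close> under its own exponent; this is
  how different idempotents arise in different coordinates.\<close>

lemma pact_mv:
  assumes \<phi>: "\<And>g h. \<phi> (g + h) = (\<lambda>a. \<phi> g a + \<phi> h a)"
    and p: "ultra p" and \<xi>: "\<xi> \<in> topspace P"
  shows "pact P (\<lambda>g :: 'g::ab_group_add. mv (\<phi> g)) p \<xi> =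
    (\<lambda>a\<in>J. pact (X a) (T a) (filtermap (\<lambda>g. \<phi> g a) p) (\<xi> a))"
proof -
  interpret cflow P "\<lambda>g. mv (\<phi> g)" by (rule cflow_mv[OF \<phi>])
  show ?thesis
  proof (rule pact_unique[OF p \<xi>], rule limitin_P)
    show "(\<lambda>a\<in>J. pact (X a) (T a) (filtermap (\<lambda>g. \<phi> g a) p) (\<xi> a)) \<in> topspace P"
      using P_D(2)[OF \<xi>] p by (intro P_I) (auto intro!: cflow.pact_in[OF flow] ultra_filtermap)
    show "mv (\<phi> n) \<xi> \<in> topspace P" for n using mv_in[OF \<xi>] .
    fix a assume a: "a \<in> J"
    have "limitin (X a) (\<lambda>n. T a n (\<xi> a)) (pact (X a) (T a) (filtermap (\<lambda>g. \<phi> g a) p) (\<xi> a)) (filtermap (\<lambda>g. \<phi> g a) p)"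
      using P_D(2)[OF \<xi> a] p by (intro cflow.pact_lim[OF flow[OF a]] ultra_filtermap)
    then show "limitin (X a) (\<lambda>n. mv (\<phi> n) \<xi> a)
        ((\<lambda>a\<in>J. pact (X a) (T a) (filtermap (\<lambda>g. \<phi> g a) p) (\<xi> a)) a) p"
      using a by (simp add: limitin_def eventually_filtermap mv_apply)
  qed
qed

end

section \<open>Saturation of the orbit closures of open sets\<close>

lemma (in cflow) pact_in_closed_invariant:
  assumes p: "ultra p" and C: "closedin X C" "\<And>n x. x \<in> C \<Longrightarrow> T n x \<in> C" and x: "x \<in> C"
  shows "pact X T p x \<in> C"
proof (rule ccontr)
  assume n: "pact X T p x \<notin> C"
  have xX: "x \<in> topspace X" using C(1) x closedin_subset by blast
  then have "\<forall>\<^sub>F n in p. T n x \<in> topspace X - C"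
    using n C(1) pact_in[OF p] by (intro pactD[OF p]) auto
  from ultra_ex[OF p this] show False using C(2) x by blast
qed

lemma circ_UN_finite:
  assumes p: "ultra p" and I: "finite I"
  shows "circ X T p (\<Union>i\<in>I. A i) \<subseteq> (\<Union>i\<in>I. circ X T p (A i))"
proof
  fix y assume y: "y \<in> circ X T p (\<Union>i\<in>I. A i)"
  show "y \<in> (\<Union>i\<in>I. circ X T p (A i))"
  proof (rule ccontr)
    assume "\<not> ?thesis"
    then have "\<forall>i\<in>I. \<exists>V. openin X V \<and> y \<in> V \<and> \<not> (\<forall>\<^sub>F n in p. T n ` A i \<inter> V \<noteq> {})"
      using circ_in[OF y] by (auto simp: circ_def)
    from bchoice[OF this] obtain V
      where V: "\<forall>i\<in>I. openin X (V i) \<and> y \<in> V i \<and> \<not> (\<forall>\<^sub>F n in p. T n ` A i \<inter> V i \<noteq> {})" ..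
    define W where "W = topspace X \<inter> (\<Inter>i\<in>I. V i)"
    have "openin X W"
      unfolding W_def using V I by (cases "I = {}") (auto intro!: openin_Int openin_INT)
    moreover have "y \<in> W" using V circ_in[OF y] by (auto simp: W_def)
    ultimately have 1: "\<forall>\<^sub>F n in p. T n ` (\<Union>i\<in>I. A i) \<inter> W \<noteq> {}"
      using circD[OF y] by blast
    have "\<forall>\<^sub>F n in p. \<forall>i\<in>I. \<not> (T n ` A i \<inter> V i \<noteq> {})"
      using V I unfolding ultra_not[OF p, symmetric] by (intro eventually_ball_finite) auto
    with 1 have "\<forall>\<^sub>F n in p. False"
      by eventually_elim (auto simp: W_def)
    then show False using ultra_ex[OF p] by blast
  qed
qed

text \<open>In an irredundant finite cover by closed sets each member has interior, namely the
  complement of the union of the others. This produces interior in the topology of the fixed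
  points.\<close>

lemma minimal_subcover:
  assumes "finite I" "S \<subseteq> (\<Union>i\<in>I. C i)"
  shows "\<exists>I'\<subseteq>I. S \<subseteq> (\<Union>i\<in>I'. C i) \<and> (\<forall>i\<in>I'. \<not> S \<subseteq> (\<Union>j\<in>I' - {i}. C j))"
  using assms
proof (induction "card I" arbitrary: I rule: less_induct)
  case less
  show ?case
  proof (cases "\<exists>i\<in>I. S \<subseteq> (\<Union>j\<in>I - {i}. C j)")
    case True
    then obtain i where i: "i \<in> I" "S \<subseteq> (\<Union>j\<in>I - {i}. C j)" by blast
    have "card (I - {i}) < card I" using i(1) less.prems(1) by (rule card_Diff1_less[rotated])
    from less.hyps[OF this _ i(2)] less.prems(1)
    obtain I' where I': "I' \<subseteq> I - {i}" "S \<subseteq> (\<Union>i\<in>I'. C i)" "\<forall>i\<in>I'. \<not> S \<subseteq> (\<Union>j\<in>I' - {i}. C j)"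
      by (elim meta_impE exE conjE) simp_all
    show ?thesis
      by (rule exI[of _ I']) (use I' in simp, blast)
  next
    case False
    with less.prems show ?thesis by (intro exI[of _ I]) simp
  qed
qed

text \<open>The flow under study is \<open>tf\<close>, which moves coordinate \<open>a\<close> at speed \<open>c a\<close>; the set \<open>N\<close> need only be minimal under the
  larger group \<open>\<Gamma>\<close>.\<close>

locale joined_flow = prodflow J X T
  for J :: "'j set" and X :: "'j \<Rightarrow> 'a topology" and T +
  fixes c :: "'j \<Rightarrow> int" and u :: "int filter" and N :: "('j \<Rightarrow> 'a) set" and \<Gamma> :: "('j \<Rightarrow> int) set"
    and q :: "'j \<Rightarrow> 'a \<Rightarrow> 'b" and q' :: "'j \<Rightarrow> 'a \<Rightarrow> 'b"
  assumes c_pos: "\<And>a. a \<in> J \<Longrightarrow> c a > 0" and u: "minid u"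
    and N_closed: "closedin P N"
    and N_inv: "\<And>f \<xi>. f \<in> \<Gamma> \<Longrightarrow> \<xi> \<in> N \<Longrightarrow> mv f \<xi> \<in> N"
    and \<Gamma>_neg: "\<And>f. f \<in> \<Gamma> \<Longrightarrow> (\<lambda>a. - f a) \<in> \<Gamma>"
    and \<Gamma>_tau: "\<And>n. (\<lambda>a. c a * n) \<in> \<Gamma>"
    and N_min: "\<And>\<xi> U. \<xi> \<in> N \<Longrightarrow> openin P U \<Longrightarrow> U \<inter> N \<noteq> {} \<Longrightarrow> \<exists>f\<in>\<Gamma>. mv f \<xi> \<in> U"
    and N_sat: "\<And>\<xi> \<xi>'. \<xi> \<in> N \<Longrightarrow> \<xi>' \<in> topspace P \<Longrightarrow> (\<And>a. a \<in> J \<Longrightarrow> q a (\<xi> a) = q a (\<xi>' a)) \<Longrightarrow> \<xi>' \<in> N"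
    and refine: "\<And>a x x'. a \<in> J \<Longrightarrow> x \<in> topspace (X a) \<Longrightarrow> x' \<in> topspace (X a) \<Longrightarrow> q' a x = q' a x' \<Longrightarrow> q a x = q a x'"
    and equi': "\<And>a x x' n. a \<in> J \<Longrightarrow> x \<in> topspace (X a) \<Longrightarrow> x' \<in> topspace (X a) \<Longrightarrow> q' a x = q' a x' \<Longrightarrow>
      q' a (T a n x) = q' a (T a n x')"
    and open': "\<And>a V. a \<in> J \<Longrightarrow> openin (X a) V \<Longrightarrow> openin (X a) {x \<in> topspace (X a). \<exists>x'\<in>V. q' a x = q' a x'}"
    and fibre': "\<And>a v x x'. a \<in> J \<Longrightarrow> minid v \<Longrightarrow> x \<in> topspace (X a) \<Longrightarrow> pact (X a) (T a) v x = x \<Longrightarrow>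
      x' \<in> topspace (X a) \<Longrightarrow> q' a x' = q' a x \<Longrightarrow>
      x' \<in> circ (X a) (T a) v (fixed_fibre (X a) (T a) (q' a) v (q' a x))"
    and key: "\<And>a v y K x x' F. a \<in> J \<Longrightarrow> minid v \<Longrightarrow> F = fixed_fibre (X a) (T a) (q a) v y \<Longrightarrow>
      K \<subseteq> F \<Longrightarrow> F \<inter> circ (X a) (T a) v K \<subseteq> K \<Longrightarrow> x \<in> F \<Longrightarrow> x \<notin> K \<Longrightarrow> x' \<in> F \<Longrightarrow> q' a x = q' a x' \<Longrightarrow>
      x' \<in> circ (X a) (T a) v (F - K)"
begin

definition "tf n = mv (\<lambda>a. c a * n)"

lemma cflow_tf: "cflow P tf"
proof -
  have "cflow P (\<lambda>n. mv (\<lambda>a. c a * n))"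
    by (rule cflow_mv[of "\<lambda>n a. c a * n"]) (simp add: distrib_left)
  then show ?thesis by (simp add: tf_def[abs_def])
qed

sublocale tf: cflow P tf
  by (rule cflow_tf)

lemma pact_tf:
  assumes "ultra p" "\<xi> \<in> topspace P" "a \<in> J"
  shows "pact P tf p \<xi> a = pact (X a) (T a) (filtermap ((*) (c a)) p) (\<xi> a)"
  using pact_mv[of "\<lambda>n a. c a * n" p \<xi>] assms by (simp add: tf_def[abs_def] distrib_left)

lemma tf_in_N: "\<xi> \<in> N \<Longrightarrow> tf n \<xi> \<in> N"
  using N_inv[OF \<Gamma>_tau] by (simp add: tf_def)

lemma N_sub: "\<xi> \<in> N \<Longrightarrow> \<xi> \<in> topspace P"
  using N_closed closedin_subset by blast

lemmas uD = minidD[OF u]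

text \<open>The idempotent through which \<open>u\<close>, acting along \<open>tf\<close>, moves
  coordinate \<open>a\<close>.\<close>

definition "vv a = filtermap ((*) (c a)) u"

lemma minid_vv: "a \<in> J \<Longrightarrow> minid (vv a)"
  unfolding vv_def using minid_filtermap_times[OF u c_pos] by simp

text \<open>Since \<open>\<xi>\<close> is fixed, its other coordinates return close to themselves
  along \<open>u\<close>, while coordinate \<open>a\<close> runs through translates of
  \<open>B\<close>. This is the continuity in one coordinate that ties the product fibre to a
  factor.\<close>

lemma circ_upd:
  assumes \<xi>: "\<xi> \<in> topspace P" "pact P tf u \<xi> = \<xi>" and a: "a \<in> J"
    and b: "b \<in> circ (X a) (T a) (vv a) B" and B: "\<And>b. b \<in> B \<Longrightarrow> \<xi>(a := b) \<in> D" and D: "D \<subseteq> topspace P"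
  shows "\<xi>(a := b) \<in> circ P tf u D"
  unfolding circ_def
proof (intro CollectI conjI allI impI)
  show in': "\<xi>(a := b) \<in> topspace P" by (rule P_upd[OF \<xi>(1) a circ_in[OF b]])
  fix V assume V: "openin P V \<and> \<xi>(a := b) \<in> V"
  from box_ex[OF conjunct1[OF V] conjunct2[OF V]] obtain W
    where W: "\<forall>a'\<in>J. openin (X a') (W a') \<and> (\<xi>(a := b)) a' \<in> W a'"
      "\<forall>\<eta>\<in>topspace P. (\<forall>a\<in>J. \<eta> a \<in> W a) \<longrightarrow> \<eta> \<in> V"
    by (elim exE conjE)
  have "\<forall>\<^sub>F n in vv a. T a n ` B \<inter> W a \<noteq> {}"
    using circD[OF b, of "W a"] bspec[OF W(1) a] by simp
  then have 1: "\<forall>\<^sub>F n in u. T a (c a * n) ` B \<inter> W a \<noteq> {}"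
    by (simp add: vv_def eventually_filtermap)
  have "\<forall>\<^sub>F n in u. \<forall>a'\<in>J - {a}. T a' (c a' * n) (\<xi> a') \<in> W a'"
  proof (rule eventually_ball_finite)
    show "finite (J - {a})" using finJ by simp
    show "\<forall>a'\<in>J - {a}. \<forall>\<^sub>F n in u. T a' (c a' * n) (\<xi> a') \<in> W a'"
    proof
      fix a' assume a': "a' \<in> J - {a}"
      have "pact (X a') (T a') (vv a') (\<xi> a') = \<xi> a'"
        using pact_tf[OF uD(1) \<xi>(1), of a'] \<xi>(2) a' by (simp add: vv_def)
      then have "pact (X a') (T a') (vv a') (\<xi> a') \<in> W a'"
        using W(1) a' by auto
      then have "\<forall>\<^sub>F n in vv a'. T a' n (\<xi> a') \<in> W a'"
        using a' W(1) P_D(2)[OF \<xi>(1)] minidD(1)[OF minid_vv]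
        by (intro cflow.pactD[OF flow]) auto
      then show "\<forall>\<^sub>F n in u. T a' (c a' * n) (\<xi> a') \<in> W a'"
        by (simp add: vv_def eventually_filtermap)
    qed
  qed
  with 1 show "\<forall>\<^sub>F n in u. tf n ` D \<inter> V \<noteq> {}"
  proof eventually_elim
    case (elim n)
    then obtain b' where b': "b' \<in> B" "T a (c a * n) b' \<in> W a" by blast
    have "\<xi>(a := b') \<in> D" using B b' by blast
    moreover have "tf n (\<xi>(a := b')) \<in> V"
    proof (rule W(2)[rule_format])
      show "tf n (\<xi>(a := b')) \<in> topspace P" using \<open>\<xi>(a := b') \<in> D\<close> D tf.T_in by blast
      show "tf n (\<xi>(a := b')) a' \<in> W a'" if "a' \<in> J" for a'
        using that elim b' by (auto simp: tf_def mv_apply)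
    qed
    ultimately show ?case by blast
  qed
qed

definition "\<Omega> U = P closure_of (\<Union>n. tf n ` (U \<inter> N))"

text \<open>\<open>\<xi>\<close> is chosen in a translate of \<open>U\<close> and outside the closed
  set \<open>K\<close> covered by the other translates. The complement of \<open>K\<close> is an
  open neighbourhood inside the closure of the one translate, and by \<open>key\<close> every
  neighbourhood of a coordinate of \<open>\<xi>\<close> has in its closure the fixed points that
  \<open>q'\<close> identifies with it.\<close>

lemma modification_in_closure:
  assumes U: "openin P U" "U \<inter> N \<noteq> {}"
  shows "\<exists>\<xi>\<in>U \<inter> N. \<forall>a\<in>J. \<forall>b\<in>topspace (X a). q' a b = q' a (\<xi> a) \<longrightarrow> \<xi>(a := b) \<in> \<Omega> U"
proof -
  obtain \<zeta> where \<zeta>: "\<zeta> \<in> N" using U by blast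
  define \<xi>0 where "\<xi>0 = pact P tf u \<zeta>"
  have \<xi>0: "\<xi>0 \<in> N"
    unfolding \<xi>0_def using tf.pact_in_closed_invariant[OF uD(1) N_closed tf_in_N \<zeta>] .
  have fix0: "pact P tf u \<xi>0 = \<xi>0"
    unfolding \<xi>0_def using tf.pact_bmul[OF uD(1) uD(1) N_sub[OF \<zeta>]] uD(2) by simp
  \<comment> \<open>A full fibre of fixed points over the \<open>q\<close>-image of
    \<open>\<xi>0\<close>; it lies in \<open>N\<close> because \<open>N\<close> is saturated over
    \<open>q\<close>.\<close>
  define S where "S = {\<xi> \<in> topspace P. pact P tf u \<xi> = \<xi> \<and> (\<forall>a\<in>J. q a (\<xi>0 a) = q a (\<xi> a))}"
  have SN: "S \<subseteq> N" using N_sat[OF \<xi>0] by (auto simp: S_def)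
  have S0: "\<xi>0 \<in> S" using fix0 N_sub[OF \<xi>0] by (simp add: S_def)
  define W where "W f = {\<zeta> \<in> topspace P. mv f \<zeta> \<in> U}" for f
  have Wo: "openin P (W f)" for f
    unfolding W_def by (rule openin_continuous_map_preimage[OF continuous_map_mv U(1)])
  have "compactin P N" by (rule closedin_compact_space[OF tf.comp N_closed])
  moreover have "\<forall>V\<in>W ` \<Gamma>. openin P V" using Wo by blast
  moreover have "N \<subseteq> \<Union> (W ` \<Gamma>)"
    using N_min[OF _ U] N_sub by (fastforce simp: W_def)
  ultimately have "\<exists>\<F>. finite \<F> \<and> \<F> \<subseteq> W ` \<Gamma> \<and> N \<subseteq> \<Union> \<F>"
    unfolding compactin_def by blast
  then obtain \<F> where \<F>: "finite \<F>" "\<F> \<subseteq> W ` \<Gamma>" "N \<subseteq> \<Union> \<F>" by (elim exE conjE)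
  obtain \<Gamma>0 where \<Gamma>0: "\<Gamma>0 \<subseteq> \<Gamma>" "finite \<Gamma>0" "\<F> = W ` \<Gamma>0"
    using finite_subset_image[OF \<F>(1,2)] by blast
  have cover: "N \<subseteq> \<Union> (W ` \<Gamma>0)" using \<F>(3) \<Gamma>0(3) by simp
  define C where "C f = S \<inter> circ P tf u (S \<inter> W f)" for f
  have SX: "S \<subseteq> topspace P" by (auto simp: S_def)
  have SC: "S \<inter> W f \<subseteq> C f" for f
    using tf.pact_in_circ[OF uD(1), of _ "S \<inter> W f"] by (auto simp: C_def S_def)
  have "S \<subseteq> (\<Union>f\<in>\<Gamma>0. C f)"
  proof
    fix \<xi> assume \<xi>: "\<xi> \<in> S"
    then obtain f where "f \<in> \<Gamma>0" "\<xi> \<in> W f" using SN cover by blast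
    then show "\<xi> \<in> (\<Union>f\<in>\<Gamma>0. C f)" using SC \<xi> by blast
  qed
  from minimal_subcover[OF \<Gamma>0(2) this]
  obtain I where I: "I \<subseteq> \<Gamma>0" "S \<subseteq> (\<Union>f\<in>I. C f)" "\<forall>f\<in>I. \<not> S \<subseteq> (\<Union>g\<in>I - {f}. C g)"
    by (elim exE conjE)
  obtain f where f: "f \<in> I" using I(2) S0 by blast
  define K where "K = (\<Union>g\<in>I - {f}. C g)"
  have finI: "finite I" using I(1) \<Gamma>0(2) finite_subset by blast
  have CC: "S \<inter> circ P tf u (C g) \<subseteq> C g" for g
  proof -
    have "circ P tf u (C g) \<subseteq> circ P tf u (circ P tf u (S \<inter> W g))"
      by (rule circ_mono) (auto simp: C_def)
    also have "\<dots> \<subseteq> circ P tf (bmul u u) (S \<inter> W g)"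
      using SX by (intro tf.circ_circ) auto
    finally show ?thesis by (auto simp: C_def uD)
  qed
  have K: "S \<inter> circ P tf u K \<subseteq> K"
  proof
    fix \<xi> assume \<xi>: "\<xi> \<in> S \<inter> circ P tf u K"
    then have "\<xi> \<in> (\<Union>g\<in>I - {f}. circ P tf u (C g))"
      using circ_UN_finite[OF uD(1), of "I - {f}" P tf C] finI unfolding K_def by blast
    then show "\<xi> \<in> K" using CC \<xi> unfolding K_def by blast
  qed
  \<comment> \<open>Otherwise the closure of \<open>S \<inter> W f\<close> would lie in the closed
    set \<open>K\<close>, and \<open>f\<close> could be dropped from the cover.\<close>
  have "\<not> S \<inter> W f \<subseteq> K"
  proof
    assume "S \<inter> W f \<subseteq> K"
    then have "C f \<subseteq> K" using circ_mono[of "S \<inter> W f" K P tf u] K by (auto simp: C_def)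
    then have "S \<subseteq> K" using I(2) by (auto simp: K_def)
    then show False using I(3) f by (auto simp: K_def)
  qed
  then obtain \<xi> where \<xi>: "\<xi> \<in> S" "\<xi> \<in> W f" "\<xi> \<notin> K" by blast
  have SK: "S - K \<subseteq> circ P tf u (N \<inter> W f)"
  proof
    fix \<eta> assume \<eta>: "\<eta> \<in> S - K"
    then have "\<eta> \<in> C f" using I(2) by (auto simp: K_def)
    moreover have "circ P tf u (S \<inter> W f) \<subseteq> circ P tf u (N \<inter> W f)"
      by (rule circ_mono) (use SN in blast)
    ultimately show "\<eta> \<in> circ P tf u (N \<inter> W f)" by (auto simp: C_def)
  qed
  have NX: "N \<inter> W f \<subseteq> topspace P" using N_sub by blast
  have cc: "\<eta> \<in> circ P tf u (N \<inter> W f)" if "\<eta> \<in> circ P tf u (circ P tf u (N \<inter> W f))" for \<eta>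
    using tf.circ_circ[OF NX, of u u] that uD(2) by auto
  have \<xi>X: "\<xi> \<in> topspace P" "pact P tf u \<xi> = \<xi>" using \<xi>(1) by (auto simp: S_def)
  have fixa: "pact (X a) (T a) (vv a) (\<xi> a) = \<xi> a" if "a \<in> J" for a
    using pact_tf[OF uD(1) \<xi>X(1) that] \<xi>X(2) by (simp add: vv_def)
  have main: "\<xi>(a := b) \<in> circ P tf u (N \<inter> W f)"
    if a: "a \<in> J" and b: "b \<in> topspace (X a)" "q' a b = q' a (\<xi> a)" for a b
  proof -
    define F where "F = fixed_fibre (X a) (T a) (q a) (vv a) (q a (\<xi> a))"
    have S_upd: "\<xi>(a := b') \<in> S" if b': "b' \<in> F" for b'
    proof -
      have b'F: "b' \<in> topspace (X a)" "q a b' = q a (\<xi> a)" "pact (X a) (T a) (vv a) b' = b'"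
        using b' by (auto simp: F_def fixed_fibre_def)
      have 1: "\<xi>(a := b') \<in> topspace P" using P_upd[OF \<xi>X(1) a b'F(1)] .
      have "pact P tf u (\<xi>(a := b')) = \<xi>(a := b')"
      proof (rule extensionalityI[of _ J])
        show "pact P tf u (\<xi>(a := b')) \<in> extensional J" "\<xi>(a := b') \<in> extensional J"
          using P_D(1) 1 tf.pact_in[OF uD(1)] by blast+
        show "pact P tf u (\<xi>(a := b')) a' = (\<xi>(a := b')) a'" if "a' \<in> J" for a'
          using pact_tf[OF uD(1) 1 that] fixa[OF that] b'F(3) by (auto simp: vv_def)
      qed
      then show ?thesis using 1 \<xi>(1) b'F(2) by (auto simp: S_def)
    qed
    have fixed: "\<xi>(a := b') \<in> circ P tf u (N \<inter> W f)" if b': "b' \<in> F" "q' a (\<xi> a) = q' a b'" for b'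
    proof -
      \<comment> \<open>The slice of \<open>K\<close> through \<open>\<xi>\<close> in direction
        \<open>a\<close>; by \<open>circ_upd\<close> it is closed in \<open>F\<close>.\<close>
      define K1 where "K1 = {b \<in> F. \<xi>(a := b) \<in> K}"
      have "K \<subseteq> topspace P" using SX by (auto simp: K_def C_def)
      have K1: "K1 \<subseteq> F" "F \<inter> circ (X a) (T a) (vv a) K1 \<subseteq> K1"
      proof -
        show "K1 \<subseteq> F" by (auto simp: K1_def)
        show "F \<inter> circ (X a) (T a) (vv a) K1 \<subseteq> K1"
        proof
          fix d assume d: "d \<in> F \<inter> circ (X a) (T a) (vv a) K1"
          have "\<xi>(a := d) \<in> circ P tf u K"
            by (rule circ_upd[OF \<xi>X a, of _ K1]) (use d \<open>K \<subseteq> topspace P\<close> in \<open>auto simp: K1_def\<close>)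
          then show "d \<in> K1" using K S_upd d by (auto simp: K1_def)
        qed
      qed
      have "\<xi> a \<in> F" using P_D(2)[OF \<xi>X(1) a] fixa[OF a] by (simp add: F_def fixed_fibre_def)
      moreover have "\<xi> a \<notin> K1" using \<xi>(3) by (simp add: K1_def)
      ultimately have "b' \<in> circ (X a) (T a) (vv a) (F - K1)"
        using key[OF a minid_vv[OF a] F_def K1 _ _ b'] by blast
      then have "\<xi>(a := b') \<in> circ P tf u (S - K)"
        by (rule circ_upd[OF \<xi>X a]) (use S_upd SX in \<open>auto simp: K1_def\<close>)
      then have "\<xi>(a := b') \<in> circ P tf u (circ P tf u (N \<inter> W f))"
        using circ_mono[OF SK] by blast
      then show ?thesis by (rule cc)
    qed
    \<comment> \<open>A point of the \<open>q'\<close>-fibre that is not fixed is reached from fixed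
      ones by RIC, at the cost of one more limit along \<open>u\<close>.\<close>
    have "b \<in> circ (X a) (T a) (vv a) (fixed_fibre (X a) (T a) (q' a) (vv a) (q' a (\<xi> a)))"
      using fibre'[OF a minid_vv[OF a] P_D(2)[OF \<xi>X(1) a] fixa[OF a] b] .
    then have "\<xi>(a := b) \<in> circ P tf u (circ P tf u (N \<inter> W f))"
    proof (rule circ_upd[OF \<xi>X a])
      fix b' assume "b' \<in> fixed_fibre (X a) (T a) (q' a) (vv a) (q' a (\<xi> a))"
      then have b': "b' \<in> topspace (X a)" "q' a b' = q' a (\<xi> a)" "pact (X a) (T a) (vv a) b' = b'"
        by (auto simp: fixed_fibre_def)
      then have "b' \<in> F"
        using refine[OF a b'(1) P_D(2)[OF \<xi>X(1) a]] by (simp add: F_def fixed_fibre_def)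
      then show "\<xi>(a := b') \<in> circ P tf u (N \<inter> W f)" using fixed b'(2) by simp
    qed (rule circ_subset_topspace)
    then show ?thesis by (rule cc)
  qed
  \<comment> \<open>The point found lies in \<open>W f\<close>. Applying \<open>f\<close> moves it
    into \<open>U\<close>, and orbit closures follow because \<open>f\<close> commutes with
    \<open>tf\<close>.\<close>
  have f\<Gamma>: "f \<in> \<Gamma>" using f I(1) \<Gamma>0(1) by blast
  have \<xi>N: "mv f \<xi> \<in> U \<inter> N"
    using \<xi> SN N_inv[OF f\<Gamma>] by (auto simp: W_def)
  show ?thesis
  proof (rule bexI[OF _ \<xi>N], intro ballI impI)
    fix a b assume a: "a \<in> J" and b: "b \<in> topspace (X a)" and eq: "q' a b = q' a (mv f \<xi> a)"
    let ?b = "T a (- f a) b"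
    have fa: "cflow (X a) (T a)" using flow[OF a] .
    have \<xi>a: "\<xi> a \<in> topspace (X a)" using P_D(2)[OF \<xi>X(1) a] .
    have b': "?b \<in> topspace (X a)" using cflow.T_in[OF fa b] .
    have "q' a ?b = q' a (T a (- f a) (T a (f a) (\<xi> a)))"
      using equi'[OF a b cflow.T_in[OF fa \<xi>a]] eq a by (simp add: mv_apply)
    also have "\<dots> = q' a (\<xi> a)" using cflow.T_inv[OF fa \<xi>a] by simp
    finally have "\<xi>(a := ?b) \<in> circ P tf u (N \<inter> W f)" using main[OF a b'] by blast
    then have 1: "\<xi>(a := ?b) \<in> P closure_of (\<Union>n. tf n ` (N \<inter> W f))"
      using tf.circ_subset_closure[OF uD(1)] by blast
    have "mv f ` (\<Union>n. tf n ` (N \<inter> W f)) \<subseteq> (\<Union>n. tf n ` (U \<inter> N))"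
    proof clarify
      fix n \<eta> assume \<eta>: "\<eta> \<in> N" "\<eta> \<in> W f"
      have "mv f (tf n \<eta>) = tf n (mv f \<eta>)"
        unfolding tf_def by (rule mv_commute[OF N_sub[OF \<eta>(1)]])
      moreover have "mv f \<eta> \<in> U \<inter> N" using \<eta> N_inv[OF f\<Gamma>] by (auto simp: W_def)
      ultimately show "mv f (tf n \<eta>) \<in> (\<Union>n. tf n ` (U \<inter> N))" by blast
    qed
    then have "P closure_of (mv f ` (\<Union>n. tf n ` (N \<inter> W f))) \<subseteq> \<Omega> U"
      unfolding \<Omega>_def by (rule closure_of_mono)
    then have "mv f ` (P closure_of (\<Union>n. tf n ` (N \<inter> W f))) \<subseteq> \<Omega> U"
      using continuous_map_image_closure_subset[OF continuous_map_mv] by (rule order_trans[rotated])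
    then have "mv f (\<xi>(a := ?b)) \<in> \<Omega> U" using 1 by blast
    moreover have "mv f (\<xi>(a := ?b)) = (mv f \<xi>)(a := b)"
      using cflow.T_inv'[OF fa b] by (simp add: mv_upd[OF a])
    ultimately show "(mv f \<xi>)(a := b) \<in> \<Omega> U" by simp
  qed
qed

text \<open>Openness of \<open>q'\<close> turns a neighbourhood of the modified point into a
  neighbourhood \<open>V\<close> of \<open>\<zeta>\<close>. \<open>modification_in_closure\<close>,
  applied to the part of the orbit of \<open>U\<close> inside \<open>V\<close>, gives a point that a
  suitable change of coordinate \<open>a\<close> sends into the prescribed neighbourhood.\<close>

lemma \<Omega>_modification:
  assumes U: "openin P U" and \<zeta>: "\<zeta> \<in> \<Omega> U" and a: "a \<in> J" and b: "b \<in> topspace (X a)" "q' a b = q' a (\<zeta> a)"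
  shows "\<zeta>(a := b) \<in> \<Omega> U"
  unfolding \<Omega>_def in_closure_of
proof (intro conjI allI impI)
  have \<zeta>X: "\<zeta> \<in> topspace P" using \<zeta> by (simp add: \<Omega>_def in_closure_of)
  show "\<zeta>(a := b) \<in> topspace P" using P_upd[OF \<zeta>X a b(1)] .
  fix O' assume O': "\<zeta>(a := b) \<in> O' \<and> openin P O'"
  from box_ex[OF conjunct2[OF O'] conjunct1[OF O']] obtain B
    where B: "\<forall>a'\<in>J. openin (X a') (B a') \<and> (\<zeta>(a := b)) a' \<in> B a'"
      "\<forall>\<eta>\<in>topspace P. (\<forall>a\<in>J. \<eta> a \<in> B a) \<longrightarrow> \<eta> \<in> O'"
    by (elim exE conjE)
  define B' where "B' = (\<lambda>a'. if a' = a then {x \<in> topspace (X a). \<exists>x'\<in>B a. q' a x = q' a x'} else B a')"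
  define V where "V = {\<eta> \<in> topspace P. \<forall>a'\<in>J. \<eta> a' \<in> B' a'}"
  have Vo: "openin P V"
    unfolding V_def using B(1) open'[OF a] by (intro openin_box) (auto simp: B'_def a)
  have "b \<in> B a" using B(1) a by fastforce
  then have "\<zeta> a \<in> B' a" using b(2)[symmetric] P_D(2)[OF \<zeta>X a] by (auto simp: B'_def)
  moreover have "\<zeta> a' \<in> B' a'" if "a' \<in> J" "a' \<noteq> a" for a'
    using B(1) that by (auto simp: B'_def)
  ultimately have \<zeta>V: "\<zeta> \<in> V" using \<zeta>X by (auto simp: V_def)
  define U1 where "U1 = V \<inter> (\<Union>n. tf n ` U)"
  have U1: "openin P U1"
    unfolding U1_def using U Vo tf.openin_T_image by (intro openin_Int openin_Union) auto
  have U1N: "U1 \<inter> N \<noteq> {}"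
  proof -
    obtain n \<eta> where \<eta>: "\<eta> \<in> U" "\<eta> \<in> N" "tf n \<eta> \<in> V"
      using closure_ofD[OF \<zeta>[unfolded \<Omega>_def] Vo \<zeta>V] by auto
    then have "tf n \<eta> \<in> U1 \<inter> N" using tf_in_N by (auto simp: U1_def)
    then show ?thesis by blast
  qed
  have sub: "\<Omega> U1 \<subseteq> \<Omega> U"
    unfolding \<Omega>_def
  proof (rule closure_of_mono, clarify)
    fix m \<eta> assume \<eta>: "\<eta> \<in> U1" "\<eta> \<in> N"
    then obtain n \<eta>' where \<eta>': "\<eta>' \<in> U" "\<eta> = tf n \<eta>'" by (auto simp: U1_def)
    have X': "\<eta>' \<in> topspace P" using \<eta>'(1) U openin_subset by blast
    have "\<eta>' = tf (- n) \<eta>" using tf.T_inv[OF X'] \<eta>'(2) by simp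
    then have "\<eta>' \<in> U \<inter> N" using tf_in_N \<eta>(2) \<eta>'(1) by simp
    moreover have "tf m \<eta> = tf (m + n) \<eta>'" using tf.T_add[OF X'] \<eta>'(2) by simp
    ultimately show "tf m \<eta> \<in> (\<Union>n. tf n ` (U \<inter> N))" by blast
  qed
  from modification_in_closure[OF U1 U1N] obtain \<xi>
    where \<xi>: "\<xi> \<in> U1" "\<xi> \<in> N" and mod: "\<forall>a\<in>J. \<forall>b\<in>topspace (X a). q' a b = q' a (\<xi> a) \<longrightarrow> \<xi>(a := b) \<in> \<Omega> U1"
    by blast
  have \<xi>V: "\<xi> \<in> V" using \<xi> by (simp add: U1_def)
  then have "\<xi> a \<in> B' a" using a by (simp add: V_def)
  then obtain x' where x': "x' \<in> B a" "q' a (\<xi> a) = q' a x'" by (auto simp: B'_def)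
  have x'X: "x' \<in> topspace (X a)" using x'(1) B(1) a openin_subset by blast
  have "\<xi>(a := x') \<in> \<Omega> U" using mod a x'(2) x'X sub by auto
  moreover have "\<xi>(a := x') \<in> O'"
  proof (rule B(2)[rule_format])
    show "\<xi>(a := x') \<in> topspace P" using P_upd[OF N_sub[OF \<xi>(2)] a x'X] .
    show "(\<xi>(a := x')) a' \<in> B a'" if "a' \<in> J" for a'
      using that \<xi>V x'(1) by (auto simp: V_def B'_def)
  qed
  ultimately have "\<exists>z\<in>(\<Union>n. tf n ` (U \<inter> N)). z \<in> O'"
    using O' by (intro closure_ofD) (auto simp: \<Omega>_def)
  then show "\<exists>z. z \<in> (\<Union>n. tf n ` (U \<inter> N)) \<and> z \<in> O'" by blast
qed

theorem \<Omega>_saturated: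
  assumes U: "openin P U" and \<zeta>: "\<zeta> \<in> \<Omega> U" and \<zeta>': "\<zeta>' \<in> topspace P"
    and eq: "\<And>a. a \<in> J \<Longrightarrow> q' a (\<zeta> a) = q' a (\<zeta>' a)"
  shows "\<zeta>' \<in> \<Omega> U"
proof -
  have \<zeta>X: "\<zeta> \<in> topspace P" using \<zeta> by (simp add: \<Omega>_def in_closure_of)
  have "(\<lambda>a. if a \<in> A then \<zeta>' a else \<zeta> a) \<in> \<Omega> U" if "finite A" "A \<subseteq> J" for A
    using that
  proof (induction A rule: finite_induct)
    case empty
    then show ?case using \<zeta> by simp
  next
    case (insert a A)
    have "(\<lambda>a. if a \<in> A then \<zeta>' a else \<zeta> a)(a := \<zeta>' a) \<in> \<Omega> U"
      using insert P_D(2)[OF \<zeta>'] eq[of a] by (intro \<Omega>_modification[OF U]) auto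
    moreover have "(\<lambda>a. if a \<in> A then \<zeta>' a else \<zeta> a)(a := \<zeta>' a) = (\<lambda>b. if b \<in> insert a A then \<zeta>' b else \<zeta> b)"
      by (auto simp: fun_eq_iff)
    ultimately show ?case by simp
  qed
  from this[OF finJ order_refl] have "(\<lambda>a. if a \<in> J then \<zeta>' a else \<zeta> a) \<in> \<Omega> U" .
  moreover have "(\<lambda>a. if a \<in> J then \<zeta>' a else \<zeta> a) = \<zeta>'"
    using P_D(1)[OF \<zeta>X] P_D(1)[OF \<zeta>'] by (auto simp: fun_eq_iff extensional_def)
  ultimately show ?thesis by simp
qed

end

lemma compact_metrizable_imp_second_countable:
  assumes "compact_space X" "metrizable_space X"
  shows "second_countable X"
proof -
  obtain M d where Md: "Metric_space M d" "X = Metric_space.mtopology M d"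
    using assms(2) by (auto simp: metrizable_space_def)
  interpret Metric_space M d by fact
  have X: "X = mtopology" by fact
  have "\<exists>F. finite F \<and> F \<subseteq> M \<and> M \<subseteq> (\<Union>y\<in>F. mball y (1 / Suc n))" for n
    using openin_all_finite_cover[of X "\<lambda>y. mball y (1 / Suc n)"] assms(1) by (simp add: X)
  then obtain F where F: "\<And>n. finite (F n)" "\<And>n. F n \<subseteq> M" "\<And>n. M \<subseteq> (\<Union>y\<in>F n. mball y (1 / Suc n))"
    by metis
  show ?thesis
    unfolding second_countable_def
  proof (intro exI conjI allI impI ballI)
    show "countable (\<Union>n. (\<lambda>y. mball y (1 / Suc n)) ` F n)"
      using F(1) by (auto intro: countable_finite)
    show "openin X V" if "V \<in> (\<Union>n. (\<lambda>y. mball y (1 / Suc n)) ` F n)" for V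
      using that by (auto simp: X)
    fix U x assume U: "openin X U \<and> x \<in> U"
    then have xM: "x \<in> M" using openin_subset[of X U] by (auto simp: X)
    obtain r where r: "r > 0" "mball x r \<subseteq> U"
      using U unfolding X openin_mtopology by blast
    obtain n where n: "1 / Suc n < r / 2"
      using r(1) nat_approx_posE[of "r / 2"] by auto
    obtain y where y: "y \<in> F n" "x \<in> mball y (1 / Suc n)" using F(3) xM by blast
    have "mball y (1 / Suc n) \<subseteq> mball x r"
    proof
      fix z assume z: "z \<in> mball y (1 / Suc n)"
      have "d x z \<le> d x y + d y z" using z y(2) by (intro triangle) auto
      also have "\<dots> < r" using z y(2) n by (simp add: commute)
      finally show "z \<in> mball x r" using z xM by simp
    qed
    then show "\<exists>V\<in>\<Union>n. (\<lambda>y. mball y (1 / Suc n)) ` F n. x \<in> V \<and> V \<subseteq> U"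
      using y r(2) by (intro bexI[of _ "mball y (1 / Suc n)"]) auto
  qed
qed

text \<open>Ellis' proof that the diagonal generates a minimal system: an idempotent \<open>u\<close> that is minimal in
  \<open>\<beta>\<int>\<close> can be lifted to the minimal ideal of the larger group.\<close>

lemma simultaneous_inverse:
  fixes \<phi> :: "'i \<Rightarrow> 'g::ab_group_add \<Rightarrow> int" and \<iota> :: "int \<Rightarrow> 'g"
  assumes u: "minid u" and \<phi>: "\<And>a g h. \<phi> a (g + h) = \<phi> a g + \<phi> a h"
    and \<iota>: "\<And>m n. \<iota> (m + n) = \<iota> m + \<iota> n" and sec: "\<And>a n. \<phi> a (\<iota> n) = n"
    and p: "ultra p"
  shows "\<exists>r. ultra r \<and> (\<forall>a. bmul (bmul (filtermap (\<phi> a) r) (filtermap (\<phi> a) p)) u = u)"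
proof -
  note uD = minidD[OF u]
  have hom: "filtermap (\<phi> a) (bmul x y) = bmul (filtermap (\<phi> a) x) (filtermap (\<phi> a) y)" for a x y
    by (rule filtermap_bmul) (rule \<phi>)
  obtain s :: "'g filter" where s: "ultra s" "\<And>q. ultra q \<Longrightarrow> \<exists>r. ultra r \<and> bmul (bmul r q) s = s"
    using ultra_minimal_ex by blast
  define e where "e = filtermap \<iota> u"
  have e: "ultra e" "\<And>a. filtermap (\<phi> a) e = u"
    using uD(1) by (simp_all add: e_def ultra_filtermap filtermap_filtermap sec)
  \<comment> \<open>Multiplication by \<open>e\<close> on both sides puts the images under all
    \<open>\<phi> a\<close> into the group \<open>u \<beta>\<int> u\<close> at once and preserves
    minimality.\<close>
  define s' where "s' = bmul e (bmul s e)"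
  have us': "ultra s'" using s e by (simp add: s'_def ultra_bmul)
  have ee: "bmul e e = e"
    using filtermap_bmul[OF \<iota>, of u u] uD(2) by (simp add: e_def)
  have min': "\<exists>r. ultra r \<and> bmul (bmul r q) s' = s'" if q: "ultra q" for q
  proof -
    obtain r where r: "ultra r" "bmul (bmul r (bmul q e)) s = s"
      using s(2)[OF ultra_bmul[OF q e(1)]] by blast
    have "bmul (bmul (bmul e r) q) s' = bmul e (bmul (bmul (bmul r (bmul q e)) s) e)"
      by (simp add: s'_def bmul_assoc)
    also have "\<dots> = s'" by (simp add: r s'_def)
    finally show ?thesis using r(1) e(1) ultra_bmul by blast
  qed
  obtain r1 where r1: "ultra r1" "bmul (bmul r1 s') s' = s'" using min'[OF us'] by blast
  \<comment> \<open>Its image under every \<open>\<phi> a\<close> is \<open>u\<close>: apply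
    \<open>\<phi> a\<close> to \<open>r1 s' s' = s'\<close> and cancel one factor in the
    group.\<close>
  define E where "E = bmul r1 s'"
  have E: "filtermap (\<phi> a) E = u" for a
  proof -
    define x where "x = bmul u (bmul (filtermap (\<phi> a) s) u)"
    have x: "filtermap (\<phi> a) s' = x" by (simp add: s'_def hom e x_def)
    obtain g where g: "bmul x g = u"
      using minid_group[OF u ultra_filtermap[OF s(1), of "\<phi> a"]] unfolding x_def by blast
    have xu: "bmul x u = x" by (simp add: x_def bmul_assoc uD)
    have "bmul (filtermap (\<phi> a) r1) (bmul x x) = x"
      using arg_cong[OF r1(2), of "filtermap (\<phi> a)"] by (simp add: hom x bmul_assoc)
    then have "bmul (bmul (filtermap (\<phi> a) r1) (bmul x x)) g = bmul x g" by simp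
    then show ?thesis by (simp add: bmul_assoc g xu E_def hom x)
  qed
  obtain r where r: "ultra r" "bmul (bmul r (bmul p r1)) s' = s'"
    using min'[OF ultra_bmul[OF p r1(1)]] by blast
  have "bmul (bmul (bmul r1 r) p) E = E"
    using r(2) by (simp add: E_def bmul_assoc)
  then have "filtermap (\<phi> a) (bmul (bmul (bmul r1 r) p) E) = u" for a
    by (simp add: E)
  then have "bmul (bmul (filtermap (\<phi> a) (bmul r1 r)) (filtermap (\<phi> a) p)) u = u" for a
    by (simp add: hom E)
  then show ?thesis
    using ultra_bmul[OF r1(1) r(1)] by blast
qed

section \<open>Products of powers of minimal flows\<close>

locale power_system =
  fixes I :: "nat set" and X :: "nat \<Rightarrow> 'a topology" and T :: "nat \<Rightarrow> int \<Rightarrow> 'a \<Rightarrow> 'a" and u :: "int filter"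
  assumes finI: "finite I" and flows: "\<And>i. i \<in> I \<Longrightarrow> cflow (X i) (T i)"
    and minimal: "\<And>i. i \<in> I \<Longrightarrow> minimal_flow (X i) (T i)"
    and metr: "\<And>i. i \<in> I \<Longrightarrow> metrizable_space (X i)"
    and u: "minid u"
begin

definition J :: "nat \<Rightarrow> (nat \<times> nat) set" where "J d = {1..d} \<times> I"

lemma J_D: "a \<in> J d \<Longrightarrow> snd a \<in> I" "a \<in> J d \<Longrightarrow> fst a \<ge> 1"
  by (auto simp: J_def)

lemma J_iff: "(j, i) \<in> J d \<longleftrightarrow> 1 \<le> j \<and> j \<le> d \<and> i \<in> I"
  by (auto simp: J_def)

sublocale pf: prodflow "J d" "\<lambda>a. X (snd a)" "\<lambda>a. T (snd a)" for d
proof (rule prodflow.intro)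
  show "finite (J d)" by (simp add: J_def finI)
  show "cflow (X (snd a)) (T (snd a))" if "a \<in> J d" for a
    using flows J_D(1)[OF that] .
qed

sublocale base: prodflow I X T
  by (rule prodflow.intro) (simp_all add: finI flows)

abbreviation "PX \<equiv> base.P"
abbreviation "P d \<equiv> pf.P d"
abbreviation "mv d \<equiv> pf.mv d"

definition "dg d x = (\<lambda>a\<in>J d. x (snd a))"

text \<open>The coordinates \<open>\<gamma> (Suc i)\<close> are the exponents of the separate transformations and \<open>\<gamma> 0\<close> is the
  exponent of \<open>\<tau>\<close>.\<close>

definition phi :: "(nat \<Rightarrow> int) \<Rightarrow> nat \<times> nat \<Rightarrow> int" where
  "phi \<gamma> a = \<gamma> (Suc (snd a)) + int (fst a) * \<gamma> 0"

lemma phi_add: "phi (\<gamma> + \<delta>) = (\<lambda>a. phi \<gamma> a + phi \<delta> a)"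
  by (auto simp: phi_def fun_eq_iff algebra_simps)

definition "tpow d n = mv d (\<lambda>a. int (fst a) * n)"

definition "pts d = {mv d (phi \<gamma>) (dg d x) |\<gamma> x. x \<in> topspace PX}"

definition "N d = P d closure_of (pts d)"

definition "L d x = P d closure_of (range (\<lambda>n. tpow d n (dg d x)))"

definition sat :: "nat \<Rightarrow> (nat \<Rightarrow> 'a \<Rightarrow> 'b) \<Rightarrow> (nat \<times> nat \<Rightarrow> 'a) set \<Rightarrow> bool" where
  "sat d q A \<longleftrightarrow> (\<forall>\<xi>\<in>A. \<forall>\<xi>'\<in>topspace (P d).
     (\<forall>a\<in>J d. q (snd a) (\<xi> a) = q (snd a) (\<xi>' a)) \<longrightarrow> \<xi>' \<in> A)"

text \<open>The condition of \<open>top_char_factor\<close> with the power of the product flattened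
  to the index set \<open>J d\<close>, where each coordinate lies in a single factor.\<close>

definition good :: "nat \<Rightarrow> (nat \<Rightarrow> 'a \<Rightarrow> 'b) \<Rightarrow> bool" where
  "good d q \<longleftrightarrow> (\<exists>X0. gdelta_in PX X0 \<and> PX closure_of X0 = topspace PX \<and> (\<forall>x\<in>X0. sat d q (L d x)))"

lemma dg_in: "x \<in> topspace PX \<Longrightarrow> dg d x \<in> topspace (P d)"
  by (intro pf.P_I) (auto simp: dg_def base.P_D J_D)

lemma dg_mv: "mv d (\<lambda>a. f (snd a)) (dg d x) = dg d (base.mv f x)"
  by (auto simp: pf.mv_def dg_def base.mv_def fun_eq_iff J_iff)

lemma continuous_map_dg: "continuous_map PX (P d) (dg d)"
proof -
  have "continuous_map PX (X (snd a)) (\<lambda>x. x (snd a))" if "a \<in> J d" for a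
    unfolding base.P_def using J_D(1)[OF that] by (intro continuous_map_product_projection)
  then show ?thesis
    unfolding pf.P_def dg_def by (auto simp: continuous_map_componentwise)
qed

lemma tpow_phi: "tpow d n = mv d (phi (\<lambda>i. if i = 0 then n else 0))"
  unfolding tpow_def by (rule arg_cong[of _ _ "mv d"]) (auto simp: phi_def)

lemma tpow_in: "\<xi> \<in> topspace (P d) \<Longrightarrow> tpow d n \<xi> \<in> topspace (P d)"
  unfolding tpow_def by (rule pf.mv_in)

lemma pts_sub: "pts d \<subseteq> topspace (P d)"
  using pf.mv_in dg_in by (auto simp: pts_def)

lemma pts_N: "pts d \<subseteq> N d"
  unfolding N_def by (rule closure_of_subset[OF pts_sub])

lemma dg_pts: "x \<in> topspace PX \<Longrightarrow> dg d x \<in> pts d"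
proof -
  assume x: "x \<in> topspace PX"
  have "phi 0 = (\<lambda>a. 0)" by (simp add: phi_def fun_eq_iff)
  then have "mv d (phi 0) (dg d x) = dg d x"
    using pf.mv_0[OF dg_in[OF x]] by simp
  then show ?thesis using x unfolding pts_def by (metis (mono_tags, lifting) mem_Collect_eq)
qed

lemma mv_phi_pts: "\<xi> \<in> pts d \<Longrightarrow> mv d (phi \<gamma>) \<xi> \<in> pts d"
proof -
  assume "\<xi> \<in> pts d"
  then obtain \<delta> x where x: "x \<in> topspace PX" "\<xi> = mv d (phi \<delta>) (dg d x)" by (auto simp: pts_def)
  have "mv d (phi \<gamma>) \<xi> = mv d (phi (\<gamma> + \<delta>)) (dg d x)"
    using pf.mv_add[OF dg_in[OF x(1)]] by (simp add: x phi_add)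
  then show ?thesis using x(1) by (auto simp: pts_def)
qed

lemma N_closed: "closedin (P d) (N d)"
  by (simp add: N_def)

lemma N_sub: "N d \<subseteq> topspace (P d)"
  by (simp add: N_def closure_of_subset_topspace)

lemma mv_phi_N: "\<xi> \<in> N d \<Longrightarrow> mv d (phi \<gamma>) \<xi> \<in> N d"
proof -
  assume \<xi>: "\<xi> \<in> N d"
  have "mv d (phi \<gamma>) ` (P d closure_of pts d) \<subseteq> P d closure_of (mv d (phi \<gamma>) ` pts d)"
    by (rule continuous_map_image_closure_subset[OF pf.continuous_map_mv])
  also have "\<dots> \<subseteq> P d closure_of pts d"
    using mv_phi_pts by (intro closure_of_mono) auto
  finally show ?thesis using \<xi> by (auto simp: N_def)
qed

section \<open>Minimality of \<open>N d\<close> under the group of all motions\<close>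

lemma PX_minimal:
  assumes x: "x \<in> topspace PX" and V: "openin PX V" "V \<noteq> {}"
  shows "\<exists>f. base.mv f x \<in> V"
proof -
  obtain z where "z \<in> V" using V by blast
  from base.box_ex[OF V(1) this] obtain B
    where B: "\<forall>i\<in>I. openin (X i) (B i) \<and> z i \<in> B i"
      "\<forall>\<eta>\<in>topspace PX. (\<forall>i\<in>I. \<eta> i \<in> B i) \<longrightarrow> \<eta> \<in> V"
    by (elim exE conjE)
  have "\<forall>i\<in>I. \<exists>n. T i n (x i) \<in> B i"
    using minimal base.P_D(2)[OF x] B(1) unfolding minimal_flow_def by blast
  from bchoice[OF this] obtain f where f: "\<forall>i\<in>I. T i (f i) (x i) \<in> B i" ..
  then have "base.mv f x \<in> V"
    using B(2) base.mv_in[OF x] by (simp add: base.mv_apply)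
  then show ?thesis by blast
qed

text \<open>The separate transformations bring one base point \<open>x\<close> close to any other,
  since each factor is minimal; this motion is again of the form
  \<open>phi \<delta>\<close>.\<close>

lemma point_dense:
  assumes x: "x \<in> topspace PX" and U: "openin (P d) U" "U \<inter> N d \<noteq> {}"
  shows "\<exists>\<gamma>. mv d (phi \<gamma>) (dg d x) \<in> U"
proof -
  obtain \<xi> where \<xi>: "\<xi> \<in> U" "\<xi> \<in> P d closure_of pts d" using U(2) by (auto simp: N_def)
  obtain \<gamma> z where z: "z \<in> topspace PX" "mv d (phi \<gamma>) (dg d z) \<in> U"
    using closure_ofD[OF \<xi>(2) U(1) \<xi>(1)] by (auto simp: pts_def)
  define V where "V = {z \<in> topspace PX. (mv d (phi \<gamma>) \<circ> dg d) z \<in> U}"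
  have "openin PX V"
    unfolding V_def
    by (intro openin_continuous_map_preimage[OF _ U(1)] continuous_map_compose[OF continuous_map_dg pf.continuous_map_mv])
  moreover have "V \<noteq> {}" using z by (auto simp: V_def)
  ultimately obtain f where f: "base.mv f x \<in> V" using PX_minimal[OF x] by blast
  define \<delta> where "\<delta> = (\<lambda>i. case i of 0 \<Rightarrow> 0 | Suc i \<Rightarrow> f i)"
  have "phi \<delta> = (\<lambda>a. f (snd a))" by (simp add: phi_def \<delta>_def fun_eq_iff)
  then have "dg d (base.mv f x) = mv d (phi \<delta>) (dg d x)" using dg_mv[of d f x] by simp
  then have "mv d (phi (\<gamma> + \<delta>)) (dg d x) \<in> U"
    using f pf.mv_add[OF dg_in[OF x]] by (simp add: V_def phi_add)
  then show ?thesis by blast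
qed

text \<open>The orbit of \<open>dg d x\<close> is dense, so it suffices to return from
  \<open>\<zeta>\<close> to such a point. The coordinates of \<open>x\<close> are fixed by
  \<open>u\<close>, and one \<open>r\<close> from \<open>simultaneous_inverse\<close> undoes in all
  coordinates the ultrafilter that led to \<open>\<zeta>\<close>.\<close>

lemma N_minimal:
  assumes \<zeta>: "\<zeta> \<in> N d" and U: "openin (P d) U" "U \<inter> N d \<noteq> {}"
  shows "\<exists>\<gamma>. mv d (phi \<gamma>) \<zeta> \<in> U"
proof -
  note uD = minidD[OF u]
  interpret G: cflow "P d" "\<lambda>\<gamma>. mv d (phi \<gamma>)"
    by (rule pf.cflow_mv) (rule phi_add)
  have ne: "\<forall>i\<in>I. \<exists>x. x \<in> topspace (X i)"
    using minimal unfolding minimal_flow_def by blast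
  from bchoice[OF this] obtain x0 where x0: "\<forall>i\<in>I. x0 i \<in> topspace (X i)" ..
  define x where "x = (\<lambda>i\<in>I. pact (X i) (T i) u (x0 i))"
  have x: "x \<in> topspace PX"
    using x0 cflow.pact_in[OF flows uD(1)] by (intro base.P_I) (auto simp: x_def)
  have ux: "pact (X i) (T i) u (x i) = x i" if "i \<in> I" for i
    using cflow.pact_bmul[OF flows[OF that] uD(1) uD(1), of "x0 i"] x0 that uD(2) by (simp add: x_def)
  have \<zeta>X: "\<zeta> \<in> topspace (P d)" using \<zeta> N_sub by blast
  have "\<exists>p. ultra p \<and> (\<forall>\<^sub>F n in p. True) \<and> pact (P d) (\<lambda>\<gamma>. mv d (phi \<gamma>)) p (dg d x) = \<zeta>"
    using point_dense[OF x] \<zeta> by (intro G.ultra_orbit[OF dg_in[OF x] \<zeta>X]) auto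
  then obtain p where p: "ultra p" "pact (P d) (\<lambda>\<gamma>. mv d (phi \<gamma>)) p (dg d x) = \<zeta>" by blast
  \<comment> \<open>The section sends \<open>n\<close> to the motion with every separate exponent
    \<open>n\<close> and \<open>\<tau>\<close>-exponent 0, so each \<open>phi\<close> takes the
    value \<open>n\<close> on it.\<close>
  have "\<exists>r. ultra r \<and> (\<forall>a. bmul (bmul (filtermap (\<lambda>\<gamma>. phi \<gamma> a) r) (filtermap (\<lambda>\<gamma>. phi \<gamma> a) p)) u = u)"
    by (rule simultaneous_inverse[OF u _ _ _ p(1), where \<iota> = "\<lambda>n i. if i = 0 then 0 else n"])
      (auto simp: phi_add phi_def fun_eq_iff)
  then obtain r where r: "ultra r"
    "\<And>a. bmul (bmul (filtermap (\<lambda>\<gamma>. phi \<gamma> a) r) (filtermap (\<lambda>\<gamma>. phi \<gamma> a) p)) u = u"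
    by blast
  have "pact (P d) (\<lambda>\<gamma>. mv d (phi \<gamma>)) r \<zeta> = dg d x"
  proof (rule extensionalityI[of _ "J d"])
    show "pact (P d) (\<lambda>\<gamma>. mv d (phi \<gamma>)) r \<zeta> \<in> extensional (J d)"
      using G.pact_in[OF r(1) \<zeta>X] by (rule pf.P_D)
    show "dg d x \<in> extensional (J d)" by (simp add: dg_def)
    fix a assume a: "a \<in> J d"
    have xa: "x (snd a) \<in> topspace (X (snd a))" using base.P_D(2)[OF x] J_D(1)[OF a] .
    have f: "cflow (X (snd a)) (T (snd a))" using flows J_D(1)[OF a] .
    have "pact (P d) (\<lambda>\<gamma>. mv d (phi \<gamma>)) r \<zeta> a =
      pact (X (snd a)) (T (snd a)) (filtermap (\<lambda>\<gamma>. phi \<gamma> a) r) (\<zeta> a)"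
      using pf.pact_mv[of phi r \<zeta>] phi_add r(1) \<zeta>X a by simp
    also have "\<zeta> a = pact (X (snd a)) (T (snd a)) (filtermap (\<lambda>\<gamma>. phi \<gamma> a) p) (x (snd a))"
      using pf.pact_mv[of phi p "dg d x" d] phi_add p dg_in[OF x] a by (simp add: dg_def)
    also have "x (snd a) = pact (X (snd a)) (T (snd a)) u (x (snd a))"
      using ux[OF J_D(1)[OF a]] by simp
    also have "pact (X (snd a)) (T (snd a)) (filtermap (\<lambda>\<gamma>. phi \<gamma> a) r)
        (pact (X (snd a)) (T (snd a)) (filtermap (\<lambda>\<gamma>. phi \<gamma> a) p) (pact (X (snd a)) (T (snd a)) u (x (snd a))))
      = pact (X (snd a)) (T (snd a)) (bmul (bmul (filtermap (\<lambda>\<gamma>. phi \<gamma> a) r) (filtermap (\<lambda>\<gamma>. phi \<gamma> a) p)) u) (x (snd a))"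
      using r(1) p(1) uD(1) xa
      by (simp add: cflow.pact_bmul[OF f] cflow.pact_in[OF f] ultra_bmul ultra_filtermap)
    also have "\<dots> = dg d x a" using r(2) ux[OF J_D(1)[OF a]] uD(1) a by (simp add: dg_def)
    finally show "pact (P d) (\<lambda>\<gamma>. mv d (phi \<gamma>)) r \<zeta> a = dg d x a" .
  qed
  moreover obtain \<gamma> where \<gamma>: "mv d (phi \<gamma>) (dg d x) \<in> U" using point_dense[OF x U] by blast
  ultimately have "pact (P d) (\<lambda>\<gamma>. mv d (phi \<gamma>)) r \<zeta> \<in> {\<eta> \<in> topspace (P d). mv d (phi \<gamma>) \<eta> \<in> U}"
    using dg_in[OF x] by simp
  then have "\<forall>\<^sub>F \<delta> in r. mv d (phi \<delta>) \<zeta> \<in> {\<eta> \<in> topspace (P d). mv d (phi \<gamma>) \<eta> \<in> U}"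
    by (intro G.pactD[OF r(1) \<zeta>X] openin_continuous_map_preimage[OF pf.continuous_map_mv U(1)])
  from ultra_ex[OF r(1) this] obtain \<delta> where "mv d (phi \<gamma>) (mv d (phi \<delta>) \<zeta>) \<in> U" by blast
  then have "mv d (phi (\<gamma> + \<delta>)) \<zeta> \<in> U" using pf.mv_add[OF \<zeta>X] by (simp add: phi_add)
  then show ?thesis by blast
qed

section \<open>Generic diagonal points\<close>

lemma tpow_apply: "a \<in> J d \<Longrightarrow> tpow d n \<xi> a = T (snd a) (int (fst a) * n) (\<xi> a)"
  by (simp add: tpow_def pf.mv_apply)

lemma cflow_tpow: "cflow (P d) (tpow d)"
proof -
  have "cflow (P d) (\<lambda>n. mv d (\<lambda>a. int (fst a) * n))"
    by (rule pf.cflow_mv[of "\<lambda>n a. int (fst a) * n"]) (simp add: distrib_left)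
  then show ?thesis by (simp add: tpow_def[abs_def])
qed

sublocale tp: cflow "P d" "tpow d" for d
  by (rule cflow_tpow)

lemma tpow_N: "\<xi> \<in> N d \<Longrightarrow> tpow d n \<xi> \<in> N d"
  unfolding tpow_phi by (rule mv_phi_N)

lemma dg_N: "x \<in> topspace PX \<Longrightarrow> dg d x \<in> N d"
  using dg_pts pts_N by blast

lemma base_mv_cflow: "compact_space PX" "Hausdorff_space PX"
  using base.cflow_mv[of "\<lambda>g a. g"] unfolding cflow_def by auto

text \<open>Otherwise finitely many translates of \<open>D\<close> would cover \<open>N\<close>.\<close>

lemma no_diagonal_open:
  assumes D: "closedin (P d) D" "D \<subseteq> N d" "\<And>n \<xi>. \<xi> \<in> D \<Longrightarrow> tpow d n \<xi> \<in> D"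
    and nowhere: "\<And>W. openin (P d) W \<Longrightarrow> W \<inter> N d \<noteq> {} \<Longrightarrow> \<not> W \<inter> N d \<subseteq> D"
    and V: "openin PX V" "V \<noteq> {}"
  shows "\<exists>x\<in>V. dg d x \<notin> D"
proof (rule ccontr)
  assume "\<not> ?thesis"
  then have dgD: "dg d x \<in> D" if "x \<in> V" for x using that by blast
  define U where "U f = {x \<in> topspace PX. base.mv f x \<in> V}" for f
  have Uo: "openin PX (U f)" for f
    unfolding U_def by (rule openin_continuous_map_preimage[OF base.continuous_map_mv V(1)])
  have "\<exists>f. x \<in> U f" if x: "x \<in> topspace PX" for x
    using PX_minimal[OF x V] x by (auto simp: U_def)
  then have "\<forall>x\<in>topspace PX. \<exists>f. x \<in> U f" by blast
  from bchoice[OF this] obtain f where f: "\<forall>x\<in>topspace PX. x \<in> U (f x)" ..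
  have "\<exists>F. finite F \<and> F \<subseteq> topspace PX \<and> topspace PX \<subseteq> (\<Union>y\<in>F. U (f y))"
    by (rule openin_all_finite_cover[OF base_mv_cflow(1)]) (use f Uo in auto)
  then obtain F where F: "finite F" "topspace PX \<subseteq> (\<Union>y\<in>F. U (f y))" by (elim exE conjE)
  define M where "M = f ` F"
  have M: "finite M" "topspace PX \<subseteq> (\<Union>g\<in>M. U g)" using F by (auto simp: M_def)
  define E where "E g = {\<xi> \<in> N d. mv d (\<lambda>a. g (snd a)) \<xi> \<in> D}" for g
  let ?Z = "subtopology (P d) (N d)"
  have Nt: "topspace ?Z = N d" using N_sub by auto
  have phig: "\<exists>\<gamma>. (\<lambda>a. g (snd a)) = phi \<gamma>" for g :: "nat \<Rightarrow> int"
    by (rule exI[of _ "\<lambda>i. case i of 0 \<Rightarrow> 0 | Suc i \<Rightarrow> g i"]) (simp add: phi_def fun_eq_iff)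
  have Ecl: "closedin ?Z (E g)" for g
  proof -
    have "closedin (P d) {\<xi> \<in> topspace (P d). mv d (\<lambda>a. g (snd a)) \<xi> \<in> D}"
      by (rule closedin_continuous_map_preimage[OF pf.continuous_map_mv D(1)])
    moreover have "E g = {\<xi> \<in> topspace (P d). mv d (\<lambda>a. g (snd a)) \<xi> \<in> D} \<inter> N d"
      using N_sub by (auto simp: E_def)
    ultimately show ?thesis by (auto simp: closedin_subtopology)
  qed
  have Eint: "?Z interior_of (E g) = {}" for g
  proof (rule ccontr)
    assume ne: "?Z interior_of (E g) \<noteq> {}"
    have "openin ?Z (?Z interior_of (E g))" by (rule openin_interior_of)
    from this[unfolded openin_subtopology]
    obtain W where W: "openin (P d) W" "?Z interior_of (E g) = W \<inter> N d"
      by (elim exE conjE)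
    have sub: "W \<inter> N d \<subseteq> E g" using interior_of_subset[of ?Z "E g"] W(2) by simp
    obtain \<gamma> where \<gamma>: "(\<lambda>a. g (snd a)) = phi \<gamma>" using phig by blast
    define W' where "W' = {\<xi> \<in> topspace (P d). mv d (phi (- \<gamma>)) \<xi> \<in> W}"
    have neg: "phi (- \<gamma>) = (\<lambda>a. - phi \<gamma> a)" by (simp add: phi_def fun_eq_iff)
    have W': "openin (P d) W'"
      unfolding W'_def by (rule openin_continuous_map_preimage[OF pf.continuous_map_mv W(1)])
    obtain \<xi> where \<xi>: "\<xi> \<in> W" "\<xi> \<in> N d" using ne W(2) by auto
    have "mv d (phi (- \<gamma>)) (mv d (phi \<gamma>) \<xi>) = \<xi>"
      unfolding neg using pf.mv_neg(1) \<xi>(2) N_sub by blast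
    then have "mv d (phi \<gamma>) \<xi> \<in> W' \<inter> N d"
      using \<xi> mv_phi_N[OF \<xi>(2), of \<gamma>] subsetD[OF N_sub, of _ d] by (simp add: W'_def)
    moreover have "W' \<inter> N d \<subseteq> D"
    proof
      fix \<eta> assume \<eta>: "\<eta> \<in> W' \<inter> N d"
      then have "mv d (phi (- \<gamma>)) \<eta> \<in> W \<inter> N d" using mv_phi_N by (auto simp: W'_def)
      then have "mv d (phi \<gamma>) (mv d (phi (- \<gamma>)) \<eta>) \<in> D" using sub \<gamma> by (auto simp: E_def)
      moreover have "mv d (phi \<gamma>) (mv d (phi (- \<gamma>)) \<eta>) = \<eta>"
        unfolding neg using pf.mv_neg(2) \<eta> N_sub by blast
      ultimately show "\<eta> \<in> D" by simp
    qed
    ultimately show False using nowhere[OF W'] by blast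
  qed
  \<comment> \<open>The exponent splits into a \<open>\<tau>\<close>-part, which preserves
    \<open>D\<close>, and a separate part, which only changes the base point. One of the finitely
    many \<open>g\<close> takes the new base point into \<open>V\<close>.\<close>
  have ptsE: "pts d \<subseteq> (\<Union>g\<in>M. E g)"
  proof
    fix \<xi> assume \<xi>: "\<xi> \<in> pts d"
    then obtain \<gamma> x where x: "x \<in> topspace PX" "\<xi> = mv d (phi \<gamma>) (dg d x)" by (auto simp: pts_def)
    define x' where "x' = base.mv (\<lambda>i. \<gamma> (Suc i)) x"
    have x'X: "x' \<in> topspace PX" unfolding x'_def by (rule base.mv_in[OF x(1)])
    have "phi \<gamma> = (\<lambda>a. int (fst a) * \<gamma> 0 + \<gamma> (Suc (snd a)))" by (simp add: phi_def fun_eq_iff)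
    then have \<xi>': "\<xi> = tpow d (\<gamma> 0) (dg d x')"
      using pf.mv_add[OF dg_in[OF x(1)], of d "\<lambda>a. int (fst a) * \<gamma> 0" "\<lambda>a. \<gamma> (Suc (snd a))"]
        dg_mv[of d "\<lambda>i. \<gamma> (Suc i)" x]
      by (simp add: x tpow_def x'_def)
    obtain g where g: "g \<in> M" "x' \<in> U g" using M(2) x'X by blast
    have "mv d (\<lambda>a. g (snd a)) \<xi> = tpow d (\<gamma> 0) (dg d (base.mv g x'))"
      unfolding \<xi>' tpow_def
      using pf.mv_commute[OF dg_in[OF x'X], of d "\<lambda>a. g (snd a)" "\<lambda>a. int (fst a) * \<gamma> 0"] dg_mv[of d g x']
      by simp
    also have "\<dots> \<in> D" using g(2) dgD D(3) by (auto simp: U_def)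
    finally show "\<xi> \<in> (\<Union>g\<in>M. E g)" using g(1) \<xi> pts_N by (auto simp: E_def)
  qed
  have "closedin ?Z (\<Union> (E ` M))" using M(1) Ecl by (intro closedin_Union) auto
  then have "closedin (P d) (\<Union> (E ` M))"
    using closedin_trans_full N_closed by blast
  then have "N d \<subseteq> \<Union> (E ` M)"
    unfolding N_def using ptsE by (intro closure_of_minimal) auto
  moreover have "\<Union> (E ` M) \<subseteq> N d" by (auto simp: E_def)
  ultimately have "\<Union> (E ` M) = topspace ?Z" unfolding Nt by (rule equalityI[rotated])
  moreover have "?Z interior_of \<Union> (E ` M) = {}"
  proof (rule Baire_category_alt)
    have "compact_space ?Z"
      using closedin_compact_space[OF tp.comp N_closed] by (simp add: compact_space_subtopology)
    moreover have "Hausdorff_space ?Z" by (simp add: tp.haus Hausdorff_space_subtopology)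
    ultimately show "completely_metrizable_space ?Z \<or> locally_compact_space ?Z \<and> regular_space ?Z"
      by (simp add: compact_imp_locally_compact_space compact_Hausdorff_imp_regular_space)
    show "countable (E ` M)" using M(1) by (simp add: countable_finite)
    show "closedin ?Z C \<and> ?Z interior_of C = {}" if "C \<in> E ` M" for C
      using that Ecl Eint by auto
  qed
  ultimately have "topspace ?Z = {}" by (metis interior_of_topspace)
  moreover obtain z where "z \<in> V" using V by blast
  then have "dg d z \<in> N d" using dg_N openin_subset[OF V(1)] by blast
  ultimately show False unfolding Nt by simp
qed

definition "Om d U = P d closure_of (\<Union>n. tpow d n ` (U \<inter> N d))"

lemma metr_P: "metrizable_space (P d)"
  unfolding pf.P_def metrizable_space_product_topology using metr finI J_D
  by (auto intro!: countable_finite simp: J_def)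

text \<open>The boundary \<open>D B\<close> of the \<open>\<tau>\<close>-invariant set generated by
  a basic open \<open>B\<close> has no interior in \<open>N d\<close>, so generic diagonal points
  avoid all these boundaries: if \<open>dg d x\<close> adheres to the orbit of
  \<open>B \<inter> N d\<close>, its own orbit meets \<open>B\<close>. Such adherence is, with time
  reversed, what \<open>b \<in> Om d U\<close> for all \<open>U\<close> provides.\<close>

lemma generic_orbit_closure:
  "\<exists>X0. gdelta_in PX X0 \<and> PX closure_of X0 = topspace PX \<and>
    (\<forall>x\<in>X0. \<forall>b. (\<forall>U. openin (P d) U \<longrightarrow> dg d x \<in> U \<longrightarrow> b \<in> Om d U) \<longrightarrow> b \<in> L d x)"
proof -
  obtain \<B> where \<B>: "countable \<B>" "\<forall>V \<in> \<B>. openin (P d) V"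
    "\<forall>U x. openin (P d) U \<and> x \<in> U \<longrightarrow> (\<exists>V \<in> \<B>. x \<in> V \<and> V \<subseteq> U)"
    using compact_metrizable_imp_second_countable[OF tp.comp metr_P, of d] unfolding second_countable_def
    by (elim exE conjE)
  define E where "E B = (\<Union>n. tpow d n ` (B \<inter> N d))" for B
  define W where "W B = (\<Union>n. tpow d n ` B)" for B
  define D where "D B = P d closure_of (E B) - W B" for B
  define G where "G B = {x \<in> topspace PX. dg d x \<in> topspace (P d) - D B}" for B
  have Wo: "openin (P d) (W B)" if "openin (P d) B" for B
    unfolding W_def using tp.openin_T_image[OF that] by (intro openin_Union) auto
  have W_inv: "tpow d n \<xi> \<in> W B" if w: "\<xi> \<in> W B" "openin (P d) B" for n \<xi> B
  proof -
    obtain m \<eta> where "\<eta> \<in> B" "\<xi> = tpow d m \<eta>" using w(1) by (auto simp: W_def)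
    moreover have "\<eta> \<in> topspace (P d)" using \<open>\<eta> \<in> B\<close> w(2) openin_subset by blast
    ultimately have "tpow d n \<xi> = tpow d (n + m) \<eta>" using tp.T_add by simp
    then show ?thesis using \<open>\<eta> \<in> B\<close> by (auto simp: W_def)
  qed
  have EN: "E B \<subseteq> N d" for B using tpow_N by (auto simp: E_def)
  have clEN: "P d closure_of (E B) \<subseteq> N d" for B
    using EN N_closed by (rule closure_of_minimal)
  have EW: "W B \<inter> N d \<subseteq> E B" if "openin (P d) B" for B
  proof
    fix \<xi> assume \<xi>: "\<xi> \<in> W B \<inter> N d"
    then obtain m \<eta> where \<eta>: "\<eta> \<in> B" "\<xi> = tpow d m \<eta>" by (auto simp: W_def)
    have "\<eta> = tpow d (- m) \<xi>" using tp.T_inv[of \<eta> d m] \<eta> openin_subset[OF that] by auto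
    then have "\<eta> \<in> N d" using tpow_N \<xi> by simp
    then show "\<xi> \<in> E B" using \<eta> by (auto simp: E_def)
  qed
  have Dcl: "closedin (P d) (D B)" if "openin (P d) B" for B
    unfolding D_def by (rule closedin_diff[OF closedin_closure_of Wo[OF that]])
  have Go: "openin PX (G B)" if "B \<in> \<B>" for B
    unfolding G_def
    by (rule openin_continuous_map_preimage[OF continuous_map_dg]) (use Dcl \<B>(2) that in blast)
  have Gd: "PX closure_of (G B) = topspace PX" if B: "B \<in> \<B>" for B
  proof -
    have Bo: "openin (P d) B" using B \<B>(2) by blast
    have "G B \<inter> V \<noteq> {}" if V: "openin PX V" "V \<noteq> {}" for V
    proof -
      have "\<exists>x\<in>V. dg d x \<notin> D B"
      proof (rule no_diagonal_open[OF Dcl[OF Bo] _ _ _ V])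
        show "D B \<subseteq> N d" using clEN by (auto simp: D_def)
        show "tpow d n \<xi> \<in> D B" if \<xi>: "\<xi> \<in> D B" for n \<xi>
        proof -
          have X: "\<xi> \<in> topspace (P d)" using \<xi> by (auto simp: D_def in_closure_of)
          have "tpow d n ` (P d closure_of (E B)) \<subseteq> P d closure_of (tpow d n ` E B)"
            by (rule continuous_map_image_closure_subset[OF tp.cont])
          also have "\<dots> \<subseteq> P d closure_of (E B)"
          proof (rule closure_of_mono, clarify)
            fix \<eta> assume "\<eta> \<in> E B"
            then obtain m \<zeta> where \<zeta>: "\<zeta> \<in> B \<inter> N d" "\<eta> = tpow d m \<zeta>" by (auto simp: E_def)
            then have "tpow d n \<eta> = tpow d (n + m) \<zeta>" using tp.T_add[of \<zeta> d n m] subsetD[OF N_sub] by auto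
            then show "tpow d n \<eta> \<in> E B" using \<zeta>(1) by (auto simp: E_def)
          qed
          finally have "tpow d n \<xi> \<in> P d closure_of (E B)" using \<xi> by (auto simp: D_def)
          moreover have "tpow d n \<xi> \<notin> W B"
          proof
            assume "tpow d n \<xi> \<in> W B"
            from W_inv[OF this Bo, of "- n"] have "\<xi> \<in> W B" using tp.T_inv[OF X] by simp
            then show False using \<xi> by (simp add: D_def)
          qed
          ultimately show ?thesis by (simp add: D_def)
        qed
        show "\<not> O' \<inter> N d \<subseteq> D B" if O': "openin (P d) O'" "O' \<inter> N d \<noteq> {}" for O'
        proof
          assume sub: "O' \<inter> N d \<subseteq> D B"
          obtain \<xi> where \<xi>: "\<xi> \<in> O'" "\<xi> \<in> N d" using O'(2) by blast
          have "\<xi> \<in> P d closure_of (E B)" using sub \<xi> by (auto simp: D_def)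
          from closure_ofD[OF this O'(1) \<xi>(1)] obtain \<eta> where \<eta>: "\<eta> \<in> E B" "\<eta> \<in> O'" by blast
          have "\<eta> \<in> N d" using EN \<eta>(1) by blast
          then have "\<eta> \<in> D B" using sub \<eta>(2) by blast
          moreover have "\<eta> \<in> W B" using \<eta>(1) by (auto simp: E_def W_def)
          ultimately show False by (simp add: D_def)
        qed
      qed
      then obtain x where x: "x \<in> V" "dg d x \<notin> D B" by blast
      then have "x \<in> G B" using openin_subset[OF V(1)] dg_in by (auto simp: G_def)
      with x show ?thesis by blast
    qed
    then show ?thesis
      by (auto simp: dense_intersects_open)
  qed
  define X0 where "X0 = \<Inter> (insert (topspace PX) (G ` \<B>))"
  have "PX closure_of X0 = topspace PX"
    unfolding X0_def
  proof (rule Baire_category)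
    show "completely_metrizable_space PX \<or> locally_compact_space PX \<and> regular_space PX"
      using base_mv_cflow by (simp add: compact_imp_locally_compact_space compact_Hausdorff_imp_regular_space)
    show "countable (insert (topspace PX) (G ` \<B>))" using \<B>(1) by simp
    show "openin PX C \<and> PX closure_of C = topspace PX" if "C \<in> insert (topspace PX) (G ` \<B>)" for C
      using that Go Gd by auto
  qed
  moreover have "gdelta_in PX X0"
    unfolding X0_def using \<B>(1) Go by (intro gdelta_in_Inter) (auto intro: open_imp_gdelta_in)
  moreover have "b \<in> L d x"
    if x: "x \<in> X0" and b: "\<And>U. openin (P d) U \<Longrightarrow> dg d x \<in> U \<Longrightarrow> b \<in> Om d U" for x b
  proof -
    have xX: "x \<in> topspace PX" using x by (simp add: X0_def)
    have bX: "b \<in> topspace (P d)"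
      using b[OF openin_topspace dg_in[OF xX]] by (simp add: Om_def in_closure_of)
    show ?thesis
      unfolding L_def in_closure_of
    proof (intro conjI bX allI impI)
      fix O' assume "b \<in> O' \<and> openin (P d) O'"
      then obtain B where B: "B \<in> \<B>" "b \<in> B" "B \<subseteq> O'" using \<B>(3) by blast
      have Bo: "openin (P d) B" using B \<B>(2) by blast
      have "dg d x \<in> P d closure_of (E B)"
        unfolding in_closure_of
      proof (intro conjI dg_in[OF xX] allI impI)
        fix U assume U: "dg d x \<in> U \<and> openin (P d) U"
        then have "b \<in> Om d U" using b by blast
        then obtain n \<eta> where \<eta>: "\<eta> \<in> U" "\<eta> \<in> N d" "tpow d n \<eta> \<in> B"
          using closure_ofD[of b "P d" _ B] Bo B(2) unfolding Om_def by blast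
        have "\<eta> = tpow d (- n) (tpow d n \<eta>)" using tp.T_inv[of \<eta> d n] \<eta>(2) subsetD[OF N_sub] by simp
        moreover have "tpow d n \<eta> \<in> B \<inter> N d" using \<eta> tpow_N by blast
        ultimately have "\<eta> \<in> E B" unfolding E_def by blast
        then show "\<exists>y. y \<in> E B \<and> y \<in> U" using \<eta>(1) by blast
      qed
      moreover have "dg d x \<notin> D B" using x B(1) by (auto simp: X0_def G_def)
      ultimately obtain n \<eta> where \<eta>: "\<eta> \<in> B" "dg d x = tpow d n \<eta>" by (auto simp: D_def W_def)
      have "tpow d (- n) (dg d x) = \<eta>" using \<eta> openin_subset[OF Bo] tp.T_inv[of \<eta> d n] by auto
      then show "\<exists>y. y \<in> range (\<lambda>n. tpow d n (dg d x)) \<and> y \<in> O'"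
        using \<eta>(1) B(3) by blast
    qed
  qed
  ultimately show ?thesis by blast
qed

lemma L_sub_Om:
  assumes "x \<in> topspace PX" "dg d x \<in> U"
  shows "L d x \<subseteq> Om d U"
  unfolding L_def Om_def using dg_N[OF assms(1)] assms(2) by (intro closure_of_mono) auto

lemma good_of_Om:
  assumes "\<And>U. openin (P d) U \<Longrightarrow> U \<inter> N d \<noteq> {} \<Longrightarrow> sat d q (Om d U)"
  shows "good d q"
proof -
  obtain X0 where X0: "gdelta_in PX X0" "PX closure_of X0 = topspace PX"
    "\<And>x b. x \<in> X0 \<Longrightarrow> (\<And>U. openin (P d) U \<Longrightarrow> dg d x \<in> U \<Longrightarrow> b \<in> Om d U) \<Longrightarrow> b \<in> L d x"
    using generic_orbit_closure[of d] by (elim exE conjE) blast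
  have "sat d q (L d x)" if x: "x \<in> X0" for x
    unfolding sat_def
  proof (intro ballI impI)
    fix \<xi> \<xi>' assume \<xi>: "\<xi> \<in> L d x" "\<xi>' \<in> topspace (P d)" "\<forall>a\<in>J d. q (snd a) (\<xi> a) = q (snd a) (\<xi>' a)"
    have xX: "x \<in> topspace PX" using x X0(1) gdelta_in_subset by blast
    show "\<xi>' \<in> L d x"
    proof (rule X0(3)[OF x])
      fix U assume U: "openin (P d) U" "dg d x \<in> U"
      have "U \<inter> N d \<noteq> {}" using U(2) dg_N[OF xX] by blast
      from assms[OF U(1) this] show "\<xi>' \<in> Om d U"
        using \<xi> L_sub_Om[OF xX U(2)] unfolding sat_def by blast
    qed
  qed
  with X0 show ?thesis unfolding good_def by blast
qed

lemma sat_0: "sat 0 q A" if "A \<subseteq> topspace (P 0)"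
  unfolding sat_def
proof (intro ballI impI)
  fix \<xi> \<xi>' assume \<xi>: "\<xi> \<in> A" "\<xi>' \<in> topspace (P 0)"
  have "\<xi>' = \<xi>"
    using \<xi> that by (intro extensionalityI[of _ "J 0"] pf.P_D(1)) (auto simp: J_def)
  with \<xi>(1) show "\<xi>' \<in> A" by simp
qed

lemma dg_1_surj:
  assumes \<xi>: "\<xi> \<in> topspace (P 1)" shows "\<exists>x\<in>topspace PX. dg 1 x = \<xi>"
proof
  define x where "x = (\<lambda>i\<in>I. \<xi> (1, i))"
  show "x \<in> topspace PX"
    using pf.P_D(2)[OF \<xi>, of "(1, _)"] by (intro base.P_I) (auto simp: x_def J_def)
  show "dg 1 x = \<xi>"
    by (rule extensionalityI[of _ "J 1"])
      (use pf.P_D(1)[OF \<xi>] in \<open>auto simp: dg_def x_def J_def\<close>)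
qed

text \<open>In the first power every point is diagonal; hence \<open>N 1\<close> is saturated over
  any factor, which is the case \<open>d = 0\<close> of \<open>N_sat\<close>.\<close>

lemma N_1: "N 1 = topspace (P 1)"
proof
  show "topspace (P 1) \<subseteq> N 1" using dg_1_surj dg_N by blast
qed (rule N_sub)

end

section \<open>The induction on level and power\<close>

definition open_fibres :: "'a topology \<Rightarrow> ('a \<Rightarrow> 'b) \<Rightarrow> bool" where
  "open_fibres X q \<longleftrightarrow> (\<forall>V. openin X V \<longrightarrow> openin X {x \<in> topspace X. \<exists>x'\<in>V. q x = q x'})"

text \<open>What the induction uses about two consecutive maps \<open>q\<close>, \<open>q'\<close> from the top of a tower to its base.\<close>

definition char_step :: "'a topology \<Rightarrow> (int \<Rightarrow> 'a \<Rightarrow> 'a) \<Rightarrow> ('a \<Rightarrow> 'b) \<Rightarrow> ('a \<Rightarrow> 'b) \<Rightarrow> bool" where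
  "char_step X T q q' \<longleftrightarrow>
    (\<forall>x\<in>topspace X. \<forall>x'\<in>topspace X. q' x = q' x' \<longrightarrow> q x = q x' \<and> (\<forall>n. q' (T n x) = q' (T n x'))) \<and>
    open_fibres X q' \<and>
    (\<forall>v x x'. minid v \<and> x \<in> topspace X \<and> pact X T v x = x \<and> x' \<in> topspace X \<and> q' x' = q' x \<longrightarrow>
      x' \<in> circ X T v (fixed_fibre X T q' v (q' x))) \<and>
    (\<forall>v y K x x'. minid v \<and> K \<subseteq> fixed_fibre X T q v y \<and> fixed_fibre X T q v y \<inter> circ X T v K \<subseteq> K \<and>
      x \<in> fixed_fibre X T q v y \<and> x \<notin> K \<and> x' \<in> fixed_fibre X T q v y \<and> q' x = q' x' \<longrightarrow>
      x' \<in> circ X T v (fixed_fibre X T q v y - K))"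

context power_system begin

text \<open>The instance of \<open>joined_flow\<close> with speed \<open>j\<close> in coordinate
  \<open>(j, i)\<close> and the group \<open>range phi\<close>; minimality under that group is
  \<open>N_minimal\<close>.\<close>

lemma good_char_step:
  assumes step: "\<And>i. i \<in> I \<Longrightarrow> char_step (X i) (T i) (q i) (q' i)" and sat: "sat d q (N d)"
  shows "good d q'"
proof -
  interpret jf: joined_flow "J d" "\<lambda>a. X (snd a)" "\<lambda>a. T (snd a)" "\<lambda>a. int (fst a)" u "N d" "range phi"
    "\<lambda>a. q (snd a)" "\<lambda>a. q' (snd a)"
  proof (unfold_locales, goal_cases)
    case (1 a) then show ?case using J_D(2)[OF 1] by simp
  next
    case 2 show ?case by (rule u)
  next
    case 3 show ?case by (rule N_closed)
  next
    case (4 f \<xi>) then show ?case using mv_phi_N by auto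
  next
    case (5 f)
    then obtain \<gamma> where "f = phi \<gamma>" by blast
    then have "(\<lambda>a. - f a) = phi (- \<gamma>)" by (simp add: phi_def fun_eq_iff)
    then show ?case by blast
  next
    case (6 n)
    have "(\<lambda>a. int (fst a) * n) = phi (\<lambda>i. if i = 0 then n else 0)"
      by (simp add: phi_def fun_eq_iff)
    then show ?case by blast
  next
    case (7 \<xi> U) then show ?case using N_minimal by blast
  next
    case (8 \<xi> \<xi>') then show ?case using sat unfolding sat_def by blast
  next
    case (9 a x x') then show ?case using step[OF J_D(1)[OF 9(1)]] unfolding char_step_def by blast
  next
    case (10 a x x' n) then show ?case using step[OF J_D(1)[OF 10(1)]] unfolding char_step_def by blast
  next
    case (11 a V) then show ?case using step[OF J_D(1)[OF 11(1)]] unfolding char_step_def open_fibres_def by blast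
  next
    case (12 a v x x') then show ?case using step[OF J_D(1)[OF 12(1)]] unfolding char_step_def by blast
  next
    case (13 a v y K x x' F) then show ?case
      using step[OF J_D(1)[OF 13(1)]] unfolding char_step_def by blast
  qed
  have Om: "Om d U = jf.\<Omega> U" for U
    by (simp add: Om_def jf.\<Omega>_def jf.tf_def[abs_def] tpow_def[abs_def])
  show ?thesis
  proof (rule good_of_Om)
    fix U assume "openin (P d) U"
    then show "sat d q' (Om d U)"
      unfolding sat_def Om using jf.\<Omega>_saturated[of U] by blast
  qed
qed

text \<open>Write \<open>a_i + j l = (a_i + l) + (j - 1) l\<close>. Relative to the new base point
  the first coordinate is at rest and the others form a point of its orbit under
  \<open>\<tau>\<close> in the power \<open>d\<close>. With a generic base point \<open>z\<close>
  nearby, saturation of \<open>L d z\<close> allows them to be changed.\<close>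

lemma N_sat_later:
  assumes good: "good d q" and op: "\<And>i. i \<in> I \<Longrightarrow> open_fibres (X i) (q i)"
    and \<xi>: "\<xi> \<in> N (Suc d)" and \<xi>': "\<xi>' \<in> topspace (P (Suc d))"
    and first: "\<And>i. i \<in> I \<Longrightarrow> \<xi>' (1, i) = \<xi> (1, i)"
    and eq: "\<And>a. a \<in> J (Suc d) \<Longrightarrow> q (snd a) (\<xi> a) = q (snd a) (\<xi>' a)"
  shows "\<xi>' \<in> N (Suc d)"
  unfolding N_def in_closure_of
proof (intro conjI \<xi>' allI impI)
  let ?D = "Suc d"
  fix O' assume O': "\<xi>' \<in> O' \<and> openin (P ?D) O'"
  from pf.box_ex[OF conjunct2[OF O'] conjunct1[OF O']] obtain B
    where B: "\<forall>a\<in>J ?D. openin (X (snd a)) (B a) \<and> \<xi>' a \<in> B a"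
      "\<forall>\<eta>\<in>topspace (P ?D). (\<forall>a\<in>J ?D. \<eta> a \<in> B a) \<longrightarrow> \<eta> \<in> O'"
    by (elim exE conjE)
  \<comment> \<open>The first coordinate has to be kept, so its neighbourhood is not enlarged; the
    others are enlarged along the fibres of \<open>q\<close>.\<close>
  define B' where "B' a = (if fst a = 1 then B a
    else {z \<in> topspace (X (snd a)). \<exists>z'\<in>B a. q (snd a) z = q (snd a) z'})" for a
  define V where "V = {\<eta> \<in> topspace (P ?D). \<forall>a\<in>J ?D. \<eta> a \<in> B' a}"
  have Vo: "openin (P ?D) V"
    unfolding V_def
  proof (rule pf.openin_box)
    fix a assume a: "a \<in> J ?D"
    then show "openin (X (snd a)) (B' a)"
      using B(1) op[OF J_D(1)[OF a]] by (auto simp: B'_def open_fibres_def)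
  qed
  have \<xi>X: "\<xi> \<in> topspace (P ?D)" using \<xi> N_sub by blast
  have "\<xi> a \<in> B' a" if a: "a \<in> J ?D" for a
  proof (cases "fst a = 1")
    case True
    then have "\<xi>' a = \<xi> a" using first[OF J_D(1)[OF a]] by (metis prod.collapse)
    then show ?thesis using B(1) a True by (auto simp: B'_def)
  next
    case False
    then show ?thesis using B(1) a eq[OF a] pf.P_D(2)[OF \<xi>X a] by (auto simp: B'_def)
  qed
  then have \<xi>V: "\<xi> \<in> V" using \<xi>X by (simp add: V_def)
  obtain \<gamma> x where x: "x \<in> topspace PX" "mv ?D (phi \<gamma>) (dg ?D x) \<in> V"
    using closure_ofD[OF \<xi>[unfolded N_def] Vo \<xi>V] by (auto simp: pts_def)
  define l where "l = \<gamma> 0"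
  define x0 where "x0 = base.mv (\<lambda>i. \<gamma> (Suc i) + l) x"
  define sh where "sh = mv ?D (\<lambda>a. (int (fst a) - 1) * l) \<circ> dg ?D"
  have x0X: "x0 \<in> topspace PX" unfolding x0_def by (rule base.mv_in[OF x(1)])
  have "phi \<gamma> = (\<lambda>a. (int (fst a) - 1) * l + (\<gamma> (Suc (snd a)) + l))"
    by (simp add: phi_def l_def fun_eq_iff algebra_simps)
  then have "sh x0 = mv ?D (phi \<gamma>) (dg ?D x)"
    using pf.mv_add[OF dg_in[OF x(1)], of ?D "\<lambda>a. (int (fst a) - 1) * l" "\<lambda>a. \<gamma> (Suc (snd a)) + l"]
      dg_mv[of ?D "\<lambda>i. \<gamma> (Suc i) + l" x]
    by (simp add: sh_def x0_def)
  then have x0V: "sh x0 \<in> V" using x by simp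
  have "continuous_map PX (P ?D) sh"
    unfolding sh_def by (rule continuous_map_compose[OF continuous_map_dg pf.continuous_map_mv])
  then have shV: "openin PX {z \<in> topspace PX. sh z \<in> V}"
    using Vo by (rule openin_continuous_map_preimage)
  obtain X0 where X0: "PX closure_of X0 = topspace PX" "\<And>x. x \<in> X0 \<Longrightarrow> sat d q (L d x)"
    using good unfolding good_def by blast
  have "x0 \<in> PX closure_of X0" using X0(1) x0X by simp
  from closure_ofD[OF this shV] x0X x0V
  obtain z where z: "z \<in> X0" "z \<in> topspace PX" "sh z \<in> V" by auto
  have sh_apply: "sh z a = T (snd a) ((int (fst a) - 1) * l) (z (snd a))" if "a \<in> J ?D" for a
    using that by (simp add: sh_def pf.mv_apply dg_def)
  define \<eta> where "\<eta> = tpow d l (dg d z)"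
  have \<eta>: "\<eta> \<in> L d z"
  proof -
    have "range (\<lambda>n. tpow d n (dg d z)) \<subseteq> L d z"
      unfolding L_def using tpow_in[OF dg_in[OF z(2)]] by (intro closure_of_subset) auto
    then show ?thesis by (auto simp: \<eta>_def)
  qed
  \<comment> \<open>Coordinate \<open>j\<close> of the power \<open>d\<close> corresponds to
    coordinate \<open>j + 1\<close> of the power \<open>Suc d\<close>.\<close>
  have S: "(Suc (fst a), snd a) \<in> J ?D" if "a \<in> J d" for a using that by (auto simp: J_def)
  have "\<forall>a\<in>J d. \<exists>z'. z' \<in> B (Suc (fst a), snd a) \<and> q (snd a) (\<eta> a) = q (snd a) z'"
  proof
    fix a assume a: "a \<in> J d"
    have "sh z (Suc (fst a), snd a) \<in> B' (Suc (fst a), snd a)"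
      using z(3) S[OF a] by (auto simp: V_def)
    moreover have "sh z (Suc (fst a), snd a) = \<eta> a"
      using sh_apply[OF S[OF a]] a by (simp add: \<eta>_def tpow_apply dg_def)
    moreover have "fst a \<noteq> 0" using J_D(2)[OF a] by simp
    ultimately show "\<exists>z'. z' \<in> B (Suc (fst a), snd a) \<and> q (snd a) (\<eta> a) = q (snd a) z'"
      by (auto simp: B'_def)
  qed
  from bchoice[OF this] obtain g
    where g: "\<forall>a\<in>J d. g a \<in> B (Suc (fst a), snd a) \<and> q (snd a) (\<eta> a) = q (snd a) (g a)" ..
  have Bo: "openin (X (snd a)) (B (Suc (fst a), snd a))" if "a \<in> J d" for a
    using B(1) S[OF that] by force
  have gP: "restrict g (J d) \<in> topspace (P d)"
    using g openin_subset[OF Bo] by (intro pf.P_I) auto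
  have gL: "restrict g (J d) \<in> L d z"
    using X0(2)[OF z(1)] \<eta> gP g unfolding sat_def by simp
  have "openin (P d) {\<eta> \<in> topspace (P d). \<forall>a\<in>J d. \<eta> a \<in> B (Suc (fst a), snd a)}"
    using Bo by (rule pf.openin_box)
  from closure_ofD[OF gL[unfolded L_def] this] g gP
  obtain l' where l': "\<forall>a\<in>J d. tpow d l' (dg d z) a \<in> B (Suc (fst a), snd a)" by auto
  \<comment> \<open>The separate exponents \<open>- l'\<close> cancel the motion of the first
    coordinate.\<close>
  define \<gamma>' where "\<gamma>' = (\<lambda>i::nat. if i = 0 then l' else - l')"
  have \<gamma>': "phi \<gamma>' = (\<lambda>a. (int (fst a) - 1) * l')"
    by (simp add: phi_def \<gamma>'_def fun_eq_iff algebra_simps)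
  have "mv ?D (phi \<gamma>') (dg ?D z) \<in> O'"
  proof (rule B(2)[rule_format])
    show "mv ?D (phi \<gamma>') (dg ?D z) \<in> topspace (P ?D)" using pf.mv_in dg_in z(2) by blast
    fix a assume a: "a \<in> J ?D"
    have val: "mv ?D (phi \<gamma>') (dg ?D z) a = T (snd a) ((int (fst a) - 1) * l') (z (snd a))"
      using a by (simp add: pf.mv_apply \<gamma>' dg_def)
    show "mv ?D (phi \<gamma>') (dg ?D z) a \<in> B a"
    proof (cases "fst a = 1")
      case True
      have "T (snd a) 0 (z (snd a)) = sh z a" using sh_apply[OF a] True by simp
      moreover have "sh z a \<in> B a" using z(3) a True by (auto simp: V_def B'_def)
      ultimately show ?thesis using val True by simp
    next
      case False
      define b where "b = (fst a - 1, snd a)"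
      have b: "b \<in> J d" "a = (Suc (fst b), snd b)" "int (fst a) - 1 = int (fst b)" "snd a = snd b"
        using a False J_D(2)[OF a] by (cases a; auto simp: b_def J_def)+
      have "tpow d l' (dg d z) b \<in> B a" using l' b by auto
      then show ?thesis using val b by (simp add: tpow_apply dg_def)
    qed
  qed
  moreover have "mv ?D (phi \<gamma>') (dg ?D z) \<in> pts ?D" using z(2) by (auto simp: pts_def)
  ultimately show "\<exists>y. y \<in> pts ?D \<and> y \<in> O'" by blast
qed

section \<open>Reversal of the coordinates\<close>

definition "flip d \<xi> = (\<lambda>a\<in>J d. \<xi> (Suc d - fst a, snd a))"

lemma J_rev: "a \<in> J d \<Longrightarrow> (Suc d - fst a, snd a) \<in> J d"
  by (auto simp: J_def)

lemma flip_in: "\<xi> \<in> topspace (P d) \<Longrightarrow> flip d \<xi> \<in> topspace (P d)"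
  using pf.P_D(2)[OF _ J_rev] by (intro pf.P_I) (auto simp: flip_def)

lemma flip_flip: "\<xi> \<in> topspace (P d) \<Longrightarrow> flip d (flip d \<xi>) = \<xi>"
  by (rule extensionalityI[of _ "J d"]) (auto simp: flip_def J_rev pf.P_D, auto simp: J_def)

lemma continuous_map_flip: "continuous_map (P d) (P d) (flip d)"
proof -
  have "continuous_map (P d) (X (snd a)) (\<lambda>\<xi>. \<xi> (Suc d - fst a, snd a))" if "a \<in> J d" for a
    using continuous_map_product_projection[OF J_rev[OF that], of "\<lambda>a. X (snd a)"] by (simp add: pf.P_def)
  then show ?thesis
    unfolding flip_def by (auto simp: pf.P_def continuous_map_componentwise)
qed

text \<open>Replacing \<open>j\<close> by \<open>d + 1 - j\<close> turns \<open>a_i + j l\<close>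
  into \<open>(a_i + (d + 1) l) - j l\<close>, an exponent of the same form.\<close>

lemma flip_N: assumes "\<xi> \<in> N d" shows "flip d \<xi> \<in> N d"
proof -
  have "flip d ` pts d \<subseteq> pts d"
  proof clarify
    fix \<xi> assume "\<xi> \<in> pts d"
    then obtain \<gamma> x where x: "x \<in> topspace PX" "\<xi> = mv d (phi \<gamma>) (dg d x)" by (auto simp: pts_def)
    define \<delta> where "\<delta> = (\<lambda>i. if i = 0 then - \<gamma> 0 else \<gamma> i + int (Suc d) * \<gamma> 0)"
    have "flip d \<xi> = mv d (phi \<delta>) (dg d x)"
    proof (rule extensionalityI[of _ "J d"])
      show "flip d \<xi> \<in> extensional (J d)" "mv d (phi \<delta>) (dg d x) \<in> extensional (J d)"
        by (auto simp: flip_def pf.mv_def)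
      fix a assume a: "a \<in> J d"
      have "phi \<gamma> (Suc d - fst a, snd a) = phi \<delta> a"
        using a by (auto simp: phi_def \<delta>_def J_def of_nat_diff algebra_simps)
      then show "flip d \<xi> a = mv d (phi \<delta>) (dg d x) a"
        using a J_rev[OF a] by (simp add: flip_def x pf.mv_apply dg_def)
    qed
    then show "flip d \<xi> \<in> pts d" using x(1) by (auto simp: pts_def)
  qed
  then have "P d closure_of (flip d ` pts d) \<subseteq> N d" unfolding N_def by (rule closure_of_mono)
  moreover have "flip d ` (N d) \<subseteq> P d closure_of (flip d ` pts d)"
    unfolding N_def by (rule continuous_map_image_closure_subset[OF continuous_map_flip])
  ultimately show ?thesis using assms by blast
qed

text \<open>The slices of \<open>N (Suc d)\<close> over the first coordinate are the sets \<open>L d x\<close>; by the symmetry \<open>flip\<close> so are,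
  up to orientation, those over the last coordinate.\<close>

lemma N_sat:
  assumes good: "good d q" and op: "\<And>i. i \<in> I \<Longrightarrow> open_fibres (X i) (q i)"
  shows "sat (Suc d) q (N (Suc d))"
proof (cases "d = 0")
  \<comment> \<open>With a single coordinate reversal is of no help, but here the set is the whole
    space.\<close>
  case True
  then show ?thesis using N_1 unfolding sat_def by simp
next
  case False
  let ?D = "Suc d"
  show ?thesis
    unfolding sat_def
  proof (intro ballI impI)
    fix \<xi> \<xi>' assume \<xi>: "\<xi> \<in> N ?D" and \<xi>': "\<xi>' \<in> topspace (P ?D)"
      and eq: "\<forall>a\<in>J ?D. q (snd a) (\<xi> a) = q (snd a) (\<xi>' a)"
    have \<xi>X: "\<xi> \<in> topspace (P ?D)" using \<xi> N_sub by blast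
    \<comment> \<open>All coordinates but the first are changed; after reversal the first has become
      the last and can be changed as well.\<close>
    define \<xi>1 where "\<xi>1 = (\<lambda>a\<in>J ?D. if fst a = 1 then \<xi> a else \<xi>' a)"
    have \<xi>1X: "\<xi>1 \<in> topspace (P ?D)"
      using pf.P_D(2)[OF \<xi>X] pf.P_D(2)[OF \<xi>'] by (intro pf.P_I) (auto simp: \<xi>1_def)
    have 1: "\<xi>1 \<in> N ?D"
    proof (rule N_sat_later[OF good op \<xi> \<xi>1X])
      show "\<xi>1 (1, i) = \<xi> (1, i)" if "i \<in> I" for i using that by (simp add: \<xi>1_def J_def)
      show "q (snd a) (\<xi> a) = q (snd a) (\<xi>1 a)" if "a \<in> J ?D" for a
        using that eq by (simp add: \<xi>1_def)
    qed
    have "flip ?D \<xi>' \<in> N ?D"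
    proof (rule N_sat_later[OF good op flip_N[OF 1] flip_in[OF \<xi>']])
      show "flip ?D \<xi>' (1, i) = flip ?D \<xi>1 (1, i)" if "i \<in> I" for i
        using that False by (simp add: flip_def \<xi>1_def J_def)
      show "q (snd a) (flip ?D \<xi>1 a) = q (snd a) (flip ?D \<xi>' a)" if a: "a \<in> J ?D" for a
        using a J_rev[OF a] eq by (auto simp: flip_def \<xi>1_def)
    qed
    from flip_N[OF this] show "\<xi>' \<in> N ?D" by (simp add: flip_flip[OF \<xi>'])
  qed
qed

lemma good_Suc:
  assumes "good d q" "\<And>i. i \<in> I \<Longrightarrow> open_fibres (X i) (q i)"
    and "\<And>i. i \<in> I \<Longrightarrow> char_step (X i) (T i) (q i) (q' i)"
  shows "good (Suc d) q'"
  using N_sat[OF assms(1,2)] assms(3) by (intro good_char_step)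

lemma good_0: "good 0 q"
  unfolding good_def
proof (intro exI conjI ballI)
  show "gdelta_in PX (topspace PX)" by simp
  show "PX closure_of topspace PX = topspace PX" by simp
  show "sat 0 q (L 0 x)" for x
    by (rule sat_0) (simp add: L_def closure_of_subset_topspace)
qed

text \<open>Transitivity makes the orbit of every nonempty open set dense, so each
  \<open>Om 1 U\<close> is the whole space. This is the origin of the additional power.\<close>

lemma good_1_transitive:
  assumes trans: "\<And>U V. openin PX U \<Longrightarrow> U \<noteq> {} \<Longrightarrow> openin PX V \<Longrightarrow> V \<noteq> {} \<Longrightarrow>
    \<exists>x\<in>U. \<exists>n. base.mv (\<lambda>i. n) x \<in> V"
  shows "good 1 q"
proof (rule good_of_Om)
  fix U assume U: "openin (P 1) U" "U \<inter> N 1 \<noteq> {}"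
  have ne: "openin PX {x \<in> topspace PX. dg 1 x \<in> W} \<and> {x \<in> topspace PX. dg 1 x \<in> W} \<noteq> {}"
    if W: "openin (P 1) W" "W \<noteq> {}" for W
    using openin_continuous_map_preimage[OF continuous_map_dg W(1)] dg_1_surj W(2) openin_subset[OF W(1)]
    by fastforce
  have "Om 1 U = topspace (P 1)"
  proof
    show "Om 1 U \<subseteq> topspace (P 1)" by (simp add: Om_def closure_of_subset_topspace)
    show "topspace (P 1) \<subseteq> Om 1 U"
    proof
      fix \<xi> assume \<xi>: "\<xi> \<in> topspace (P 1)"
      show "\<xi> \<in> Om 1 U"
        unfolding Om_def in_closure_of
      proof (intro conjI \<xi> allI impI)
        fix W assume W: "\<xi> \<in> W \<and> openin (P 1) W"
        obtain x n where x: "x \<in> topspace PX" "dg 1 x \<in> U" "dg 1 (base.mv (\<lambda>i. n) x) \<in> W"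
          using trans[OF conjunct1[OF ne] conjunct2[OF ne] conjunct1[OF ne] conjunct2[OF ne], of U W] U W by auto
        have "tpow 1 n (dg 1 x) = dg 1 (base.mv (\<lambda>i. n) x)"
        proof (rule extensionalityI[of _ "J 1"])
          show "tpow 1 n (dg 1 x) \<in> extensional (J 1)" "dg 1 (base.mv (\<lambda>i. n) x) \<in> extensional (J 1)"
            by (simp_all add: tpow_def pf.mv_def dg_def)
          fix a assume a: "a \<in> J 1"
          then have "fst a = 1" by (auto simp: J_def)
          then show "tpow 1 n (dg 1 x) a = dg 1 (base.mv (\<lambda>i. n) x) a"
            using tpow_apply[OF a] a J_D(1)[OF a] by (simp add: dg_def base.mv_apply)
        qed
        moreover have "dg 1 x \<in> U \<inter> N 1" using x dg_N by blast
        ultimately have "dg 1 (base.mv (\<lambda>i. n) x) \<in> (\<Union>n. tpow 1 n ` (U \<inter> N 1))"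
          by (intro UN_I[of n] image_eqI[of _ _ "dg 1 x"]) simp_all
        with x(3) show "\<exists>y. y \<in> (\<Union>n. tpow 1 n ` (U \<inter> N 1)) \<and> y \<in> W"
          by blast
      qed
    qed
  qed
  then show "sat 1 q (Om 1 U)" by (simp add: sat_def)
qed

end

lemma (in complete_canonical_tower) tower_char_step:
  assumes m: "m < n" and v: "minid u"
  shows "char_step (XT n) (XF n) (q m) (q (Suc m))"
proof -
  interpret r: ric_ext "XT n" "XF n" "YT (Suc m)" "YF (Suc m)" "q (Suc m)"
    by (rule q_ric) (use m in simp)
  have le: "Suc m \<le> n" using m by simp
  show ?thesis
    unfolding char_step_def open_fibres_def
  proof (intro conjI ballI allI impI)
    show "q m x = q m x'" if "x \<in> topspace (XT n)" "x' \<in> topspace (XT n)" "q (Suc m) x = q (Suc m) x'" for x x'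
      by (rule q_refines(1)[OF m]) (use that in simp_all)
    show "q (Suc m) (XF n l x) = q (Suc m) (XF n l x')"
      if "x \<in> topspace (XT n)" "x' \<in> topspace (XT n)" "q (Suc m) x = q (Suc m) x'" for x x' l
      using that r.equi[of x l] r.equi[of x' l] by simp
    show "openin (XT n) {x \<in> topspace (XT n). \<exists>x'\<in>V. q (Suc m) x = q (Suc m) x'}" if "openin (XT n) V" for V
      by (rule q_open[OF le v that])
    show "x' \<in> circ (XT n) (XF n) v (fixed_fibre (XT n) (XF n) (q (Suc m)) v (q (Suc m) x))"
      if "minid v \<and> x \<in> topspace (XT n) \<and> pact (XT n) (XF n) v x = x \<and> x' \<in> topspace (XT n) \<and>
        q (Suc m) x' = q (Suc m) x" for v x x'
    proof -
      from that have a: "minid v" "x \<in> topspace (XT n)" "pact (XT n) (XF n) v x = x" "x' \<in> topspace (XT n)"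
        "q (Suc m) x' = q (Suc m) x"
        by blast+
      show ?thesis by (rule q_fibre[OF le a])
    qed
    show "x' \<in> circ (XT n) (XF n) v (fixed_fibre (XT n) (XF n) (q m) v y - K)"
      if "minid v \<and> K \<subseteq> fixed_fibre (XT n) (XF n) (q m) v y \<and>
        fixed_fibre (XT n) (XF n) (q m) v y \<inter> circ (XT n) (XF n) v K \<subseteq> K \<and>
        x \<in> fixed_fibre (XT n) (XF n) (q m) v y \<and> x \<notin> K \<and>
        x' \<in> fixed_fibre (XT n) (XF n) (q m) v y \<and> q (Suc m) x = q (Suc m) x'" for v y K x x'
    proof -
      from that have a: "minid v" "K \<subseteq> fixed_fibre (XT n) (XF n) (q m) v y"
        "fixed_fibre (XT n) (XF n) (q m) v y \<inter> circ (XT n) (XF n) v K \<subseteq> K"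
        "x \<in> fixed_fibre (XT n) (XF n) (q m) v y" "x \<notin> K"
        "x' \<in> fixed_fibre (XT n) (XF n) (q m) v y" "q (Suc m) x = q (Suc m) x'"
        by blast+
      show ?thesis by (rule q_key[OF m a refl])
    qed
  qed
qed

section \<open>Products of systems\<close>

lemma homeomorphic_map_intro:
  assumes "continuous_map X X f" "continuous_map X X g"
    and "\<And>x. x \<in> topspace X \<Longrightarrow> g (f x) = x" "\<And>x. x \<in> topspace X \<Longrightarrow> f (g x) = x"
  shows "homeomorphic_map X X f"
  unfolding homeomorphic_map_maps homeomorphic_maps_def using assms by blast

lemma continuous_map_prod_map:
  assumes "\<And>i. i \<in> I \<Longrightarrow> continuous_map (X i) (Y i) (f i)"
  shows "continuous_map (product_topology X I) (product_topology Y I) (prod_map I f)"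
proof -
  have "continuous_map (product_topology X I) (Y i) (\<lambda>x. f i (x i))" if "i \<in> I" for i
    using continuous_map_compose[OF continuous_map_product_projection[OF that, of X] assms[OF that]]
    by (simp add: o_def)
  then show ?thesis
    unfolding prod_map_def by (auto simp: continuous_map_componentwise)
qed

lemma homeomorphic_map_prod_map:
  assumes "\<And>i. i \<in> I \<Longrightarrow> homeomorphic_map (X i) (X i) (f i)"
  shows "homeomorphic_map (product_topology X I) (product_topology X I) (prod_map I f)"
proof (rule homeomorphic_map_intro)
  let ?g = "\<lambda>i. inv_into (topspace (X i)) (f i)"
  show "continuous_map (product_topology X I) (product_topology X I) (prod_map I f)"
    using assms homeomorphic_imp_continuous_map by (blast intro: continuous_map_prod_map)
  show "continuous_map (product_topology X I) (product_topology X I) (prod_map I ?g)"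
    using inv_into_homeomorphic_map(1)[OF assms] by (intro continuous_map_prod_map)
  fix x assume "x \<in> topspace (product_topology X I)"
  then have x: "x \<in> extensional I" "\<And>i. i \<in> I \<Longrightarrow> x i \<in> topspace (X i)"
    by (auto simp: topspace_product_topology PiE_iff)
  show "prod_map I ?g (prod_map I f x) = x"
    by (rule extensionalityI[of _ I])
      (use x inv_into_homeomorphic_map(2)[OF assms] in \<open>auto simp: prod_map_def\<close>)
  show "prod_map I f (prod_map I ?g x) = x"
    by (rule extensionalityI[of _ I])
      (use x inv_into_homeomorphic_map(3)[OF assms] in \<open>auto simp: prod_map_def\<close>)
qed

text \<open>The forward recursion over all integers determines the iterates, which spares
  computations with \<open>inv_into\<close> for products and powers.\<close>

lemma ziter_unique:
  assumes T: "homeomorphic_map X X T" and 0: "g 0 = x"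
    and g: "\<And>n. g n \<in> topspace X" "\<And>n. g (n + 1) = T (g n)"
  shows "ziter X T n x = g n"
proof (induction n rule: int_induct[where k = 0])
  case base
  then show ?case by (simp add: 0)
next
  have x: "x \<in> topspace X" using g(1)[of 0] 0 by simp
  case (step1 i)
  then show ?case using ziter_Suc[OF T x] g(2) by simp
next
  have x: "x \<in> topspace X" using g(1)[of 0] 0 by simp
  case (step2 i)
  have "T (g (i - 1)) = g i" using g(2)[of "i - 1"] by simp
  then have "inv_into (topspace X) T (g i) = g (i - 1)"
    using inv_into_homeomorphic_map(2)[OF T g(1)[of "i - 1"]] by simp
  then show ?case using ziter_pred[OF T x] step2.IH by simp
qed

lemma ziter_prod_map:
  assumes f: "\<And>i. i \<in> I \<Longrightarrow> homeomorphic_map (X i) (X i) (f i)"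
    and x: "x \<in> topspace (product_topology X I)"
  shows "ziter (product_topology X I) (prod_map I f) n x = (\<lambda>i\<in>I. ziter (X i) (f i) n (x i))"
proof (rule ziter_unique[OF homeomorphic_map_prod_map[OF f]])
  have xi: "x \<in> extensional I" "\<And>i. i \<in> I \<Longrightarrow> x i \<in> topspace (X i)"
    using x by (auto simp: topspace_product_topology PiE_iff)
  show "(\<lambda>i\<in>I. ziter (X i) (f i) 0 (x i)) = x"
    by (rule extensionalityI[of _ I]) (use xi in auto)
  show "(\<lambda>i\<in>I. ziter (X i) (f i) n (x i)) \<in> topspace (product_topology X I)" for n
    using xi ziter_in[OF f] by (auto simp: topspace_product_topology)
  show "(\<lambda>i\<in>I. ziter (X i) (f i) (n + 1) (x i)) = prod_map I f (\<lambda>i\<in>I. ziter (X i) (f i) n (x i))" for n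
    using xi ziter_Suc[OF f] by (auto simp: prod_map_def fun_eq_iff)
qed

lemma homeomorphic_map_funpow:
  assumes "homeomorphic_map X X T"
  shows "homeomorphic_map X X (T ^^ j)"
proof (induction j)
  case 0
  show ?case by (rule homeomorphic_map_intro[where g = id]) (auto simp: id_def)
next
  case (Suc j)
  then show ?case using homeomorphic_map_compose[OF Suc assms] by (simp add: o_def)
qed

lemma ziter_funpow:
  assumes T: "homeomorphic_map X X T" and x: "x \<in> topspace X"
  shows "ziter X (T ^^ j) n x = ziter X T (int j * n) x"
proof (rule ziter_unique[OF homeomorphic_map_funpow[OF T]])
  show "ziter X T (int j * 0) x = x" by simp
  show "ziter X T (int j * n) x \<in> topspace X" for n by (rule ziter_in[OF T x])
  show "ziter X T (int j * (n + 1)) x = (T ^^ j) (ziter X T (int j * n) x)" for n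
    using ziter_add[OF T x, of "int j" "int j * n"] by (simp add: distrib_left add.commute ziter_def)
qed

lemma tds_prod_map:
  assumes I: "finite I" and f: "\<And>i. i \<in> I \<Longrightarrow> tds (X i) (f i)"
  shows "tds (product_topology X I) (prod_map I f)"
  unfolding tds_def
proof (intro conjI)
  show "compact_space (product_topology X I)"
    using f by (simp add: tds_def compact_space_product_topology)
  show "metrizable_space (product_topology X I)"
    unfolding metrizable_space_product_topology using f I
    by (auto simp: tds_def intro: countable_finite)
  show "homeomorphic_map (product_topology X I) (product_topology X I) (prod_map I f)"
    using f by (intro homeomorphic_map_prod_map) (simp add: tds_def)
qed

lemma factor_map_prod_map:
  assumes I: "finite I" and \<pi>: "\<And>i. i \<in> I \<Longrightarrow> factor_map (X i) (f i) (Y i) (g i) (\<pi> i)"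
  shows "factor_map (product_topology X I) (prod_map I f) (product_topology Y I) (prod_map I g) (prod_map I \<pi>)"
  unfolding factor_map_def
proof (intro conjI ballI)
  show "tds (product_topology X I) (prod_map I f)" "tds (product_topology Y I) (prod_map I g)"
    using \<pi> by (auto intro!: tds_prod_map[OF I] simp: factor_map_def)
  show cont: "continuous_map (product_topology X I) (product_topology Y I) (prod_map I \<pi>)"
    using \<pi> by (intro continuous_map_prod_map) (simp add: factor_map_def)
  show "prod_map I \<pi> ` topspace (product_topology X I) = topspace (product_topology Y I)"
  proof
    show "prod_map I \<pi> ` topspace (product_topology X I) \<subseteq> topspace (product_topology Y I)"
      using cont by (auto simp: continuous_map_def)
    show "topspace (product_topology Y I) \<subseteq> prod_map I \<pi> ` topspace (product_topology X I)"
    proof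
      fix y assume "y \<in> topspace (product_topology Y I)"
      then have y: "y \<in> extensional I" "\<And>i. i \<in> I \<Longrightarrow> y i \<in> topspace (Y i)"
        by (auto simp: topspace_product_topology PiE_iff)
      have "\<forall>i\<in>I. \<exists>x. x \<in> topspace (X i) \<and> \<pi> i x = y i"
      proof
        fix i assume i: "i \<in> I"
        have "y i \<in> \<pi> i ` topspace (X i)" using \<pi>[OF i] y(2)[OF i] by (simp add: factor_map_def)
        then show "\<exists>x. x \<in> topspace (X i) \<and> \<pi> i x = y i" by auto
      qed
      from bchoice[OF this] obtain x where x: "\<forall>i\<in>I. x i \<in> topspace (X i) \<and> \<pi> i (x i) = y i" ..
      have "prod_map I \<pi> (restrict x I) = y"
        by (rule extensionalityI[of _ I]) (use x y in \<open>auto simp: prod_map_def\<close>)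
      moreover have "restrict x I \<in> topspace (product_topology X I)"
        using x by (auto simp: topspace_product_topology)
      ultimately show "y \<in> prod_map I \<pi> ` topspace (product_topology X I)" by blast
    qed
  qed
  show "prod_map I \<pi> (prod_map I f x) = prod_map I g (prod_map I \<pi> x)" if "x \<in> topspace (product_topology X I)" for x
    using that \<pi> by (auto simp: prod_map_def fun_eq_iff factor_map_def topspace_product_topology PiE_iff)
qed

text \<open>\<open>F\<close> and \<open>H\<close> are the two directions of currying, a
  homeomorphism between the power of the product and the product over \<open>J d\<close> that takes
  the orbit under \<open>tau\<close> to the orbit under \<open>tpow\<close>.\<close>

lemma diag_orbit_closure_flat:
  assumes ps: "power_system I X (\<lambda>i. ziter (X i) (f i)) u"
    and f: "\<And>i. i \<in> I \<Longrightarrow> homeomorphic_map (X i) (X i) (f i)"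
    and x: "x \<in> topspace (product_topology X I)"
  shows "diag_orbit_closure d (product_topology X I) (prod_map I f) x =
    {\<xi> \<in> topspace (power_topology d (product_topology X I)).
      (\<lambda>a\<in>power_system.J I d. \<xi> (fst a) (snd a)) \<in> power_system.L I X (\<lambda>i. ziter (X i) (f i)) d x}"
proof -
  interpret ps: power_system I X "\<lambda>i. ziter (X i) (f i)" u by fact
  let ?PX = "product_topology X I" and ?PT = "prod_map I f"
  let ?Q = "power_topology d ?PX"
  have xi: "x \<in> extensional I" "\<And>i. i \<in> I \<Longrightarrow> x i \<in> topspace (X i)"
    using x by (auto simp: topspace_product_topology PiE_iff)
  have PT: "homeomorphic_map ?PX ?PX ?PT" by (rule homeomorphic_map_prod_map[OF f])
  define F where "F \<xi> = (\<lambda>a\<in>ps.J d. \<xi> (fst a) (snd a))" for \<xi> :: "nat \<Rightarrow> nat \<Rightarrow> 'a"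
  define H where "H \<eta> = (\<lambda>j\<in>{1..d}. \<lambda>i\<in>I. \<eta> (j, i))" for \<eta> :: "nat \<times> nat \<Rightarrow> 'a"
  have Qtop: "\<xi> \<in> topspace ?Q \<longleftrightarrow> \<xi> \<in> extensional {1..d} \<and> (\<forall>j\<in>{1..d}. \<xi> j \<in> extensional I \<and> (\<forall>i\<in>I. \<xi> j i \<in> topspace (X i)))" for \<xi>
    by (auto simp: topspace_product_topology PiE_iff)
  have HF: "H (F \<xi>) = \<xi>" if "\<xi> \<in> topspace ?Q" for \<xi>
    using that unfolding Qtop H_def F_def
    by (auto simp: fun_eq_iff ps.J_def extensional_def)
  have contF: "continuous_map ?Q (ps.P d) F"
  proof -
    have "continuous_map ?Q (X (snd a)) (\<lambda>\<xi>. \<xi> (fst a) (snd a))" if "a \<in> ps.J d" for a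
    proof -
      have a: "fst a \<in> {1..d}" "snd a \<in> I" using that by (auto simp: ps.J_def)
      from continuous_map_compose[OF continuous_map_product_projection[OF a(1), of "\<lambda>_. ?PX"]
          continuous_map_product_projection[OF a(2), of X]]
      show ?thesis by (simp add: o_def)
    qed
    then show ?thesis unfolding ps.pf.P_def F_def by (auto simp: continuous_map_componentwise)
  qed
  have contH: "continuous_map (ps.P d) ?Q H"
  proof -
    have "continuous_map (ps.P d) ?PX (\<lambda>\<eta>. \<lambda>i\<in>I. \<eta> (j, i))" if j: "j \<in> {1..d}" for j
    proof -
      have "continuous_map (ps.P d) (X i) (\<lambda>\<eta>. \<eta> (j, i))" if "i \<in> I" for i
      proof -
        have "(j, i) \<in> ps.J d" using that j by (simp add: ps.J_iff)
        from continuous_map_product_projection[OF this, of "\<lambda>a. X (snd a)"]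
        show ?thesis by (simp add: ps.pf.P_def)
      qed
      then show ?thesis by (auto simp: continuous_map_componentwise)
    qed
    then show ?thesis unfolding H_def by (auto simp: continuous_map_componentwise)
  qed
  have xd: "(\<lambda>j\<in>{1..d}. x) \<in> topspace ?Q"
    using x by (auto simp: topspace_product_topology)
  have orb: "ziter ?Q (tau d ?PT) n (\<lambda>j\<in>{1..d}. x) = H (ps.tpow d n (ps.dg d x))" for n
  proof -
    have "ziter ?Q (tau d ?PT) n (\<lambda>j\<in>{1..d}. x) = (\<lambda>j\<in>{1..d}. ziter ?PX (?PT ^^ j) n ((\<lambda>j\<in>{1..d}. x) j))"
      unfolding tau_def by (rule ziter_prod_map[OF homeomorphic_map_funpow[OF PT] xd])
    also have "\<dots> = (\<lambda>j\<in>{1..d}. \<lambda>i\<in>I. ziter (X i) (f i) (int j * n) (x i))"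
      by (rule restrict_ext) (simp add: ziter_funpow[OF PT x] ziter_prod_map[OF f x])
    also have "\<dots> = H (ps.tpow d n (ps.dg d x))"
      unfolding H_def
      by (intro restrict_ext) (simp add: ps.tpow_apply ps.J_def ps.dg_def)
    finally show ?thesis .
  qed
  let ?O = "range (\<lambda>n. ps.tpow d n (ps.dg d x))"
  have O: "orbit ?Q (tau d ?PT) (\<lambda>j\<in>{1..d}. x) = H ` ?O"
    by (simp only: orbit_def orb image_image)
  have FH: "F (H \<eta>) = \<eta>" if "\<eta> \<in> topspace (ps.P d)" for \<eta>
    by (rule extensionalityI[of _ "ps.J d"])
      (use ps.pf.P_D(1)[OF that] in \<open>auto simp: F_def H_def ps.J_def\<close>)
  have xP: "x \<in> topspace ps.PX" using x by (simp add: ps.base.P_def)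
  have FO: "F ` H ` ?O = ?O"
    using FH[OF ps.tpow_in[OF ps.dg_in[OF xP]]] by (force simp: image_image)
  show ?thesis
    unfolding diag_orbit_closure_def O ps.L_def F_def[symmetric]
  proof (intro set_eqI iffI)
    fix \<xi> assume \<xi>: "\<xi> \<in> ?Q closure_of (H ` ?O)"
    then have "F \<xi> \<in> ps.P d closure_of (F ` H ` ?O)"
      using continuous_map_image_closure_subset[OF contF] by blast
    moreover have "\<xi> \<in> topspace ?Q" using \<xi> by (simp only: in_closure_of)
    ultimately show "\<xi> \<in> {\<xi> \<in> topspace ?Q. F \<xi> \<in> ps.P d closure_of ?O}" unfolding FO by blast
  next
    fix \<xi> assume "\<xi> \<in> {\<xi> \<in> topspace ?Q. F \<xi> \<in> ps.P d closure_of ?O}"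
    then have \<xi>: "\<xi> \<in> topspace ?Q" "F \<xi> \<in> ps.P d closure_of ?O" by auto
    then have "H (F \<xi>) \<in> ?Q closure_of (H ` ?O)"
      using continuous_map_image_closure_subset[OF contH] by blast
    then show "\<xi> \<in> ?Q closure_of (H ` ?O)" by (simp only: HF[OF \<xi>(1)])
  qed
qed

lemma top_char_factor_of_good:
  assumes ps: "power_system I X (\<lambda>i. ziter (X i) (f i)) u"
    and fac: "\<And>i. i \<in> I \<Longrightarrow> factor_map (X i) (f i) (Y i) (g i) (\<pi> i)"
    and good: "power_system.good I X (\<lambda>i. ziter (X i) (f i)) d \<pi>"
  shows "top_char_factor d (product_topology X I) (prod_map I f) (product_topology Y I) (prod_map I g) (prod_map I \<pi>)"
proof -
  interpret ps: power_system I X "\<lambda>i. ziter (X i) (f i)" u by fact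
  let ?PX = "product_topology X I"
  have PX: "ps.PX = ?PX" by (simp add: ps.base.P_def)
  have f: "homeomorphic_map (X i) (X i) (f i)" if "i \<in> I" for i
    using fac[OF that] by (simp add: factor_map_def tds_def)
  obtain X0 where X0: "gdelta_in ?PX X0" "?PX closure_of X0 = topspace ?PX"
    "\<And>x. x \<in> X0 \<Longrightarrow> ps.sat d \<pi> (ps.L d x)"
    using good unfolding ps.good_def PX by blast
  have "power_saturated d ?PX (prod_map I \<pi>) (diag_orbit_closure d ?PX (prod_map I f) x)" if x: "x \<in> X0" for x
  proof -
    have xX: "x \<in> topspace ?PX" using x gdelta_in_subset[OF X0(1)] by blast
    have flat: "diag_orbit_closure d ?PX (prod_map I f) x = {\<xi> \<in> topspace (power_topology d ?PX).
        (\<lambda>a\<in>ps.J d. \<xi> (fst a) (snd a)) \<in> ps.L d x}"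
      by (rule diag_orbit_closure_flat[OF ps _ xX]) (rule f)
    show ?thesis
      unfolding power_saturated_def flat
    proof (intro ballI impI)
      fix \<xi> \<xi>'
      assume \<xi>: "\<xi> \<in> {\<xi> \<in> topspace (power_topology d ?PX). (\<lambda>a\<in>ps.J d. \<xi> (fst a) (snd a)) \<in> ps.L d x}"
        and \<xi>': "\<xi>' \<in> topspace (power_topology d ?PX)"
        and eq: "\<forall>j\<in>{1..d}. prod_map I \<pi> (\<xi> j) = prod_map I \<pi> (\<xi>' j)"
      have "\<pi> i (\<xi> j i) = \<pi> i (\<xi>' j i)" if "j \<in> {1..d}" "i \<in> I" for j i
        using bspec[OF eq that(1)] that(2) by (auto simp: prod_map_def fun_eq_iff split: if_splits dest!: spec[of _ i])
      then have e: "\<forall>a\<in>ps.J d. \<pi> (snd a) ((\<lambda>a\<in>ps.J d. \<xi> (fst a) (snd a)) a) =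
          \<pi> (snd a) ((\<lambda>a\<in>ps.J d. \<xi>' (fst a) (snd a)) a)"
        by (auto simp: ps.J_def)
      have "(\<lambda>a\<in>ps.J d. \<xi>' (fst a) (snd a)) \<in> topspace (ps.P d)"
        using \<xi>' by (intro ps.pf.P_I) (auto simp: topspace_product_topology PiE_iff ps.J_def)
      then have "(\<lambda>a\<in>ps.J d. \<xi>' (fst a) (snd a)) \<in> ps.L d x"
        using X0(3)[OF x] \<xi> e unfolding ps.sat_def by blast
      then show "\<xi>' \<in> {\<xi> \<in> topspace (power_topology d ?PX). (\<lambda>a\<in>ps.J d. \<xi> (fst a) (snd a)) \<in> ps.L d x}"
        using \<xi>' by blast
    qed
  qed
  moreover have "factor_map ?PX (prod_map I f) (product_topology Y I) (prod_map I g) (prod_map I \<pi>)"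
    by (rule factor_map_prod_map[OF ps.finI]) (rule fac)
  ultimately show ?thesis
    unfolding top_char_factor_def using X0(1,2) by blast
qed

theorem theorem6p1:
  fixes k n :: nat
    and X :: "nat \<Rightarrow> 'a metric" and T :: "nat \<Rightarrow> 'a \<Rightarrow> 'a"
    and Y :: "nat \<Rightarrow> 'b metric" and S :: "nat \<Rightarrow> 'b \<Rightarrow> 'b"
    and \<pi> :: "nat \<Rightarrow> 'a \<Rightarrow> 'b"
    and XX :: "nat \<Rightarrow> nat \<Rightarrow> 'x metric" and TX :: "nat \<Rightarrow> nat \<Rightarrow> 'x \<Rightarrow> 'x"
    and YY :: "nat \<Rightarrow> nat \<Rightarrow> 'y metric" and TY :: "nat \<Rightarrow> nat \<Rightarrow> 'y \<Rightarrow> 'y"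
    and ZZ :: "nat \<Rightarrow> nat \<Rightarrow> 'z metric" and TZ :: "nat \<Rightarrow> nat \<Rightarrow> 'z \<Rightarrow> 'z"
    and \<pi>m :: "nat \<Rightarrow> nat \<Rightarrow> 'x \<Rightarrow> 'y"
    and \<theta>0' :: "nat \<Rightarrow> 'x \<Rightarrow> 'a" and \<theta>0 :: "nat \<Rightarrow> 'y \<Rightarrow> 'b"
    and \<sigma> :: "nat \<Rightarrow> nat \<Rightarrow> 'x \<Rightarrow> 'z" and \<rho> :: "nat \<Rightarrow> nat \<Rightarrow> 'z \<Rightarrow> 'y"
    and \<theta> :: "nat \<Rightarrow> nat \<Rightarrow> 'y \<Rightarrow> 'z" and \<theta>' :: "nat \<Rightarrow> nat \<Rightarrow> 'x \<Rightarrow> 'x"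
  assumes towers: "\<And>i. i \<in> {1..k} \<Longrightarrow>
    complete_canonical_tower n (X i) (T i) (Y i) (S i) (\<pi> i)
      (XX i) (TX i) (YY i) (TY i) (ZZ i) (TZ i) (\<pi>m i) (\<theta>0' i) (\<theta>0 i) (\<sigma> i) (\<rho> i) (\<theta> i) (\<theta>' i)"
  defines "PX \<equiv> product_topology (\<lambda>i. mtopology_of (XX i n)) {1..k}"
    and "PY \<equiv> product_topology (\<lambda>i. mtopology_of (YY i n)) {1..k}"
    and "PTX \<equiv> prod_map {1..k} (\<lambda>i. TX i n)"
    and "PTY \<equiv> prod_map {1..k} (\<lambda>i. TY i n)"
    and "P\<pi> \<equiv> prod_map {1..k} (\<lambda>i. \<pi>m i n)"
  shows "top_char_factor n PX PTX PY PTY P\<pi> \<and>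
    (transitive_tds PX PTX \<longrightarrow> top_char_factor (n + 1) PX PTX PY PTY P\<pi>)"
proof -
  define I where "I = {1..k}"
  let ?X = "\<lambda>i. mtopology_of (XX i n)" and ?T = "\<lambda>i. ziter (mtopology_of (XX i n)) (TX i n)"
  have R: "RIC_map (XX i n) (TX i n) (YY i n) (TY i n) (\<pi>m i n)"
    and min: "minimal_tds (?X i) (TX i n)" if "i \<in> I" for i
  proof -
    interpret complete_canonical_tower n "X i" "T i" "Y i" "S i" "\<pi> i" "XX i" "TX i" "YY i" "TY i" "ZZ i" "TZ i"
      "\<pi>m i" "\<theta>0' i" "\<theta>0 i" "\<sigma> i" "\<rho> i" "\<theta> i" "\<theta>' i"
      using towers that unfolding I_def .
    show "RIC_map (XX i n) (TX i n) (YY i n) (TY i n) (\<pi>m i n)" by (rule RIC[OF order_refl])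
    show "minimal_tds (?X i) (TX i n)" by (rule minimal_XX[OF order_refl])
  qed
  have tds: "tds (?X i) (TX i n)" if "i \<in> I" for i
    using min[OF that] by (simp add: minimal_tds_def)
  have fac: "factor_map (?X i) (TX i n) (mtopology_of (YY i n)) (TY i n) (\<pi>m i n)" if "i \<in> I" for i
    using R[OF that] by (simp add: RIC_map_def)
  show ?thesis
  proof (cases "I = {}")
    \<comment> \<open>The product is a single point. The case is separate because the idempotent
      \<open>u\<close> is obtained from one of the towers.\<close>
    case True
    have "top_char_factor d PX PTX PY PTY P\<pi>" for d
    proof -
      have top: "topspace PX = {\<lambda>_. undefined}"
        unfolding PX_def I_def[symmetric] True by (simp add: topspace_product_topology)
      have pt: "\<xi> = (\<lambda>j\<in>{1..d}. \<lambda>_. undefined)" if "\<xi> \<in> topspace (power_topology d PX)" for \<xi>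
      proof -
        have "\<xi> \<in> extensional {1..d}" "\<forall>j\<in>{1..d}. \<xi> j = (\<lambda>_. undefined)"
          using that top by (simp_all add: topspace_product_topology PiE_iff)
        then show ?thesis
          by (intro ext) (metis extensional_arb restrict_apply)
      qed
      have "power_saturated d PX P\<pi> (diag_orbit_closure d PX PTX x)" for x
        unfolding power_saturated_def
      proof (intro ballI impI)
        fix \<xi> \<xi>' assume \<xi>: "\<xi> \<in> diag_orbit_closure d PX PTX x" and \<xi>': "\<xi>' \<in> topspace (power_topology d PX)"
        have "\<xi> \<in> topspace (power_topology d PX)"
          using \<xi> unfolding diag_orbit_closure_def by (simp only: in_closure_of)
        then have "\<xi> = \<xi>'" using pt[of \<xi>] pt[OF \<xi>'] by simp
        with \<xi> show "\<xi>' \<in> diag_orbit_closure d PX PTX x" by simp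
      qed
      moreover have "factor_map PX PTX PY PTY P\<pi>"
        unfolding PX_def PTX_def PY_def PTY_def P\<pi>_def
        by (rule factor_map_prod_map) (use fac in \<open>simp_all add: I_def\<close>)
      ultimately show ?thesis
        unfolding top_char_factor_def by (intro conjI exI[of _ "topspace PX"]) auto
    qed
    then show ?thesis by blast
  next
    case False
    then obtain i0 where "i0 \<in> I" by blast
    then obtain u where u: "minid u" using RIC_map_minid[OF R] by blast
    interpret ps: power_system I ?X ?T u
    proof (rule power_system.intro)
      show "finite I" by (simp add: I_def)
      fix i assume i: "i \<in> I"
      show "cflow (?X i) (?T i)" by (rule cflow_tds[OF tds[OF i]])
      show "minimal_flow (?X i) (?T i)"
        using minimal_flow_minimal_tds[OF min[OF i]] RIC_map_nonempty[OF R[OF i]] by simp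
      show "metrizable_space (?X i)" using tds[OF i] by (simp add: tds_def)
    qed (rule u)
    define q where "q m i = \<pi>m i m \<circ> tower_proj (\<theta>' i) m (n - m)" for m i
    have step: "char_step (?X i) (?T i) (q m i) (q (Suc m) i)"
      and op: "open_fibres (?X i) (q m i)" if i: "i \<in> I" and m: "m < n" for m i
    proof -
      interpret t: complete_canonical_tower n "X i" "T i" "Y i" "S i" "\<pi> i" "XX i" "TX i" "YY i" "TY i" "ZZ i" "TZ i"
        "\<pi>m i" "\<theta>0' i" "\<theta>0 i" "\<sigma> i" "\<rho> i" "\<theta> i" "\<theta>' i"
        using towers i unfolding I_def .
      have q: "q m i = t.q m" for m by (simp add: q_def t.q_def t.h_def)
      show "char_step (?X i) (?T i) (q m i) (q (Suc m) i)"
        unfolding q by (rule t.tower_char_step[OF m u])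
      show "open_fibres (?X i) (q m i)"
        unfolding q open_fibres_def using t.q_open[OF _ u] m by simp
    qed
    \<comment> \<open>Level and power rise together, so a start in power \<open>d\<close> at level 0
      ends in power \<open>d + n\<close> at the top.\<close>
    have climb: "ps.good (d + m) (q m)" if "ps.good d (q 0)" "m \<le> n" for d m
      using that(2)
    proof (induction m)
      case 0
      then show ?case using that(1) by simp
    next
      case (Suc m)
      then have "ps.good (d + m) (q m)" by simp
      then have "ps.good (Suc (d + m)) (q (Suc m))"
        by (rule ps.good_Suc) (use op step Suc.prems in auto)
      then show ?case by simp
    qed
    have qn: "q n = (\<lambda>i. \<pi>m i n)" by (rule ext) (simp add: q_def)
    have concl: "top_char_factor d PX PTX PY PTY P\<pi>" if "ps.good d (q n)" for d
      unfolding PX_def PTX_def PY_def PTY_def P\<pi>_def I_def[symmetric]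
      by (rule top_char_factor_of_good[OF ps.power_system_axioms fac]) (use that qn in simp_all)
    have "ps.good n (q n)"
      using climb[OF ps.good_0 order_refl] by simp
    moreover have "ps.good (n + 1) (q n)" if tr: "transitive_tds PX PTX"
    proof -
      have PX: "ps.PX = PX" unfolding PX_def I_def[symmetric] by (rule ps.base.P_def)
      have "ps.good 1 (q 0)"
      proof (rule ps.good_1_transitive, unfold PX)
        fix U V assume UV: "openin PX U" "U \<noteq> {}" "openin PX V" "V \<noteq> {}"
        \<comment> \<open>The definition of transitivity moves its second set, hence
          \<open>U\<close> and \<open>V\<close> are exchanged.\<close>
        then obtain l where "V \<inter> ziter PX PTX (- l) ` U \<noteq> {}"
          using tr unfolding transitive_tds_def by blast
        then obtain x where x: "x \<in> U" "ziter PX PTX (- l) x \<in> V" by blast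
        have "x \<in> topspace PX" using x(1) UV(1) openin_subset by blast
        then have "ziter PX PTX (- l) x = ps.base.mv (\<lambda>i. - l) x"
          unfolding PX_def PTX_def I_def[symmetric] ps.base.mv_def
          using tds by (intro ziter_prod_map) (simp_all add: tds_def)
        with x show "\<exists>x\<in>U. \<exists>n. ps.base.mv (\<lambda>i. n) x \<in> V" by auto
      qed
      from climb[OF this order_refl] show ?thesis by simp
    qed
    ultimately show ?thesis using concl by blast
  qed
qed

end
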